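(* There is a constant $c>0$ such that for every $n$ and every $k\ge 4$ the following holds. Let $\mathcal{E}$ be an ensemble of circuits implementing $n$-qubit Clifford unitaries which is an $\varepsilon$-approximate additive-error unitary $k$-design over the Clifford group $\mathrm{Cl}_n$ with $\varepsilon<1/4$. Then the lightcone of at least one circuit in the ensemble contains at least $c\,n$ qubits. Consequently, $\mathcal{E}$ must have circuit depth $d=\Omega(n)$ if the circuits are one-dimensional, and $d=\Omega(\log n)$ if the circuits have all-to-all connectivity.
   Context: The $n$-qubit Clifford group $\mathrm{Cl}_n$ is the group of unitaries normalizing the $n$-qubit Pauli group (global phases are irrelevant, so it is treated as a finite group with the uniform = Haar measure). For an ensemble (probability distribution) $\mathcal{E}$ of unitaries on $\mathcal{H}=(\mathbb{C}^2)^{\otimes n}$, the $k$-wise twirl is $\Phi^{(k)}_{\mathcal{E}}(A)=\mathbb{E}_{U\sim\mathcal{E}}U^{\otimes k}A\,U^{\dagger,\otimes k}$; $\Phi^{(k)}_G$ is the twirl over the Haar measure of a compact group $G$. $\mathcal{E}$ is an $\varepsilon$-approximate additive-error unitary $k$-design over $G$ if $\mathcal{E}$ is supported on $G$ and $\|\Phi_G^{(k)}-\Phi_{\mathcal{E}}^{(k)}\|_\diamond\le\varepsilon$ (diamond norm). Circuits: a depth-$d$ circuit is a product $U=U_d\cdots U_1$ of $d$ layers; each layer is a product of gates with disjoint supports, each gate acting on at most a constant number $r$ of qubits that are connected in the architecture graph (vertices = qubits). One-dimensional: the graph is a path or cycle; all-to-all: the complete graph. The individual gates need not belong to the group, only the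 total unitary. The depth of an ensemble is the maximal depth of its circuits. The implied constants in $\Omega(\cdot)$ may depend on $r$. Lightcone: fix an arbitrary ordering of the qubits. The lightcone of a circuit is the lightcone starting from the first qubit, i.e. the set $S_d$ defined by $S_0=\{1\}$ and $S_t=S_{t-1}\cup\bigcup\{\text{supports of gates in layer } t \text{ that intersect } S_{t-1}\}$. *)

theory Defs
  imports
    "HOL-Probability.Probability_Measure"
    "HOL-Combinatorics.Permutations"
    "Jordan_Normal_Form.Schur_Decomposition"
begin

section \<open>Tensor products and the Clifford group\<close>

text \<open>
  A basis vector of an \<open>m\<close>-fold tensor power of a \<open>b\<close>-dimensional space is numbered by
  \<open>x < b ^ m\<close>; its component in tensor factor \<open>t < m\<close> is the \<open>t\<close>-th base-\<open>b\<close> digit of \<open>x\<close>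
  (factor 0 is the least significant one). In particular qubit \<open>q\<close> of an \<open>n\<close>-qubit system
  is the \<open>q\<close>-th binary digit of the index.
\<close>

definition digit :: "nat \<Rightarrow> nat \<Rightarrow> nat \<Rightarrow> nat" where
  "digit b t x = x div b ^ t mod b"

definition tensor_prod :: "nat \<Rightarrow> nat \<Rightarrow> (nat \<Rightarrow> complex mat) \<Rightarrow> complex mat" where
  "tensor_prod b m A =
     Matrix.mat (b ^ m) (b ^ m) (\<lambda>(i, j). \<Prod>t<m. A t $$ (digit b t i, digit b t j))"

definition tensor_pow :: "nat \<Rightarrow> nat \<Rightarrow> complex mat \<Rightarrow> complex mat" where
  "tensor_pow b k U = tensor_prod b k (\<lambda>_. U)"

definition unitary_mat :: "nat \<Rightarrow> complex mat \<Rightarrow> bool" where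
  "unitary_mat d U \<longleftrightarrow> U \<in> carrier_mat d d \<and> U * mat_adjoint U = 1\<^sub>m d \<and> mat_adjoint U * U = 1\<^sub>m d"

definition pauli_matrices :: "complex mat set" where
  "pauli_matrices =
     {1\<^sub>m 2,
      mat_of_rows_list 2 [[0, 1], [1, 0]],
      mat_of_rows_list 2 [[0, - \<i>], [\<i>, 0]],
      mat_of_rows_list 2 [[1, 0], [0, - 1]]}"

definition pauli_group :: "nat \<Rightarrow> complex mat set" where
  "pauli_group n =
     {c \<cdot>\<^sub>m tensor_prod 2 n P | c P. c \<in> {1, - 1, \<i>, - \<i>} \<and> (\<forall>q<n. P q \<in> pauli_matrices)}"

definition clifford_group :: "nat \<Rightarrow> complex mat set" where
  "clifford_group n =
     {U. unitary_mat (2 ^ n) U \<and> (\<lambda>P. U * P * mat_adjoint U) ` pauli_group n = pauli_group n}"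

definition phase_rel :: "nat \<Rightarrow> (complex mat \<times> complex mat) set" where
  "phase_rel n =
     {(U, V). U \<in> clifford_group n \<and> V \<in> clifford_group n \<and> (\<exists>z. cmod z = 1 \<and> V = z \<cdot>\<^sub>m U)}"


section \<open>Twirls, diamond norm and approximate designs\<close>

text \<open>
  Twirl of a random unitary \<open>u\<close> on a probability space \<open>M\<close>; \<open>d\<close> is the dimension of the
  underlying space and the expectation is taken entrywise.
\<close>

definition twirl :: "nat \<Rightarrow> nat \<Rightarrow> 'w measure \<Rightarrow> ('w \<Rightarrow> complex mat) \<Rightarrow> complex mat \<Rightarrow> complex mat" where
  "twirl d k M u A =
     Matrix.mat (d ^ k) (d ^ k) (\<lambda>(i, j).
       LINT w|M. (tensor_pow d k (u w) * A * tensor_pow d k (mat_adjoint (u w))) $$ (i, j))"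

text \<open>
  The Clifford group modulo global phases is finite, and its Haar measure is the uniform
  distribution. A twirl does not depend on the phases, so the choice of a representative of
  each phase class is immaterial.
\<close>

definition clifford_twirl :: "nat \<Rightarrow> nat \<Rightarrow> complex mat \<Rightarrow> complex mat" where
  "clifford_twirl n k =
     twirl (2 ^ n) k (uniform_count_measure (clifford_group n // phase_rel n)) (\<lambda>K. SOME U. U \<in> K)"

text \<open>
  The sum of the singular values, i.e. of the square roots of the eigenvalues (with
  multiplicity) of \<open>A\<^sup>\<dagger> A\<close>.
\<close>

definition trace_norm :: "complex mat \<Rightarrow> real" where
  "trace_norm A = (\<Sum>e \<in># proots (char_poly (mat_adjoint A * A)). sqrt (Re e))"

text \<open>
  The map \<open>\<Delta> \<otimes> id\<close> with an \<open>m\<close>-dimensional ancilla, where \<open>\<Delta>\<close> is a linear map on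
  \<open>D \<times> D\<close> matrices: \<open>\<Delta>\<close> is applied to each of the blocks \<open>(1 \<otimes> \<langle>a|) X (1 \<otimes> |b\<rangle>)\<close>, \<open>a, b < m\<close>.
\<close>

definition ancilla_ext :: "nat \<Rightarrow> nat \<Rightarrow> (complex mat \<Rightarrow> complex mat) \<Rightarrow> complex mat \<Rightarrow> complex mat" where
  "ancilla_ext D m \<Delta> X =
     Matrix.mat (D * m) (D * m) (\<lambda>(i, j).
       \<Delta> (Matrix.mat D D (\<lambda>(i', j'). X $$ (i' * m + i mod m, j' * m + j mod m))) $$ (i div m, j div m))"

definition diamond_norm :: "nat \<Rightarrow> (complex mat \<Rightarrow> complex mat) \<Rightarrow> ereal" where
  "diamond_norm D \<Delta> =
     (SUP m \<in> {1..}. SUP X \<in> {X \<in> carrier_mat (D * m) (D * m). trace_norm X \<le> 1}.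
        ereal (trace_norm (ancilla_ext D m \<Delta> X)))"

definition approx_clifford_design ::
  "nat \<Rightarrow> nat \<Rightarrow> real \<Rightarrow> 'w measure \<Rightarrow> ('w \<Rightarrow> complex mat) \<Rightarrow> bool" where
  "approx_clifford_design n k \<epsilon> M u \<longleftrightarrow>
     (\<forall>w\<in>space M. u w \<in> clifford_group n) \<and>
     diamond_norm ((2 ^ n) ^ k) (\<lambda>A. clifford_twirl n k A - twirl (2 ^ n) k M u A) \<le> ereal \<epsilon>"


section \<open>Circuits\<close>

text \<open>A gate is the set of qubits it acts on together with its operator on the whole system.\<close>

type_synonym gate = "nat set \<times> complex mat"
type_synonym layer = "gate list"
type_synonym circuit = "layer list"

text \<open>
  \<open>V = W \<otimes> 1\<close> with \<open>W\<close> an operator on the qubits in \<open>S\<close>. The basis states of these qubits are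
  labelled by the subset of \<open>S\<close> of qubits in state 1, and \<open>w\<close> lists the matrix entries of \<open>W\<close>.
\<close>

definition acts_on :: "nat \<Rightarrow> nat set \<Rightarrow> complex mat \<Rightarrow> bool" where
  "acts_on n S V \<longleftrightarrow>
     V \<in> carrier_mat (2 ^ n) (2 ^ n) \<and>
     (\<exists>w :: nat set \<Rightarrow> nat set \<Rightarrow> complex. \<forall>x<2 ^ n. \<forall>y<2 ^ n.
        V $$ (x, y) =
          (if \<forall>q\<in>{..<n} - S. digit 2 q x = digit 2 q y
           then w {q\<in>S. digit 2 q x = 1} {q\<in>S. digit 2 q y = 1} else 0))"

definition architecture :: "nat \<Rightarrow> (nat \<times> nat) set \<Rightarrow> bool" where
  "architecture n G \<longleftrightarrow> G \<subseteq> {..<n} \<times> {..<n} \<and> sym G \<and> irrefl G"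

definition connected_in :: "(nat \<times> nat) set \<Rightarrow> nat set \<Rightarrow> bool" where
  "connected_in G S \<longleftrightarrow> (\<forall>x\<in>S. \<forall>y\<in>S. (x, y) \<in> (G \<inter> S \<times> S)\<^sup>*)"

definition valid_gate :: "nat \<Rightarrow> nat \<Rightarrow> (nat \<times> nat) set \<Rightarrow> gate \<Rightarrow> bool" where
  "valid_gate n r G g \<longleftrightarrow>
     fst g \<subseteq> {..<n} \<and> card (fst g) \<le> r \<and> connected_in G (fst g) \<and>
     unitary_mat (2 ^ n) (snd g) \<and> acts_on n (fst g) (snd g)"

definition valid_layer :: "nat \<Rightarrow> nat \<Rightarrow> (nat \<times> nat) set \<Rightarrow> layer \<Rightarrow> bool" where
  "valid_layer n r G L \<longleftrightarrow>
     (\<forall>g\<in>set L. valid_gate n r G g) \<and> sorted_wrt (\<lambda>g h. fst g \<inter> fst h = {}) L"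

definition valid_circuit :: "nat \<Rightarrow> nat \<Rightarrow> (nat \<times> nat) set \<Rightarrow> circuit \<Rightarrow> bool" where
  "valid_circuit n r G C \<longleftrightarrow> (\<forall>L\<in>set C. valid_layer n r G L)"

text \<open>The head of a circuit is the layer \<open>U\<^sub>1\<close> that is applied first.\<close>

definition layer_unitary :: "nat \<Rightarrow> layer \<Rightarrow> complex mat" where
  "layer_unitary n L = fold (\<lambda>g A. snd g * A) L (1\<^sub>m (2 ^ n))"

definition circuit_unitary :: "nat \<Rightarrow> circuit \<Rightarrow> complex mat" where
  "circuit_unitary n C = fold (\<lambda>L A. layer_unitary n L * A) C (1\<^sub>m (2 ^ n))"

definition depth :: "circuit \<Rightarrow> nat" where
  "depth C = length C"

definition lightcone :: "nat \<Rightarrow> circuit \<Rightarrow> nat set" where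
  "lightcone q C = fold (\<lambda>L S. S \<union> \<Union>{fst g | g. g \<in> set L \<and> fst g \<inter> S \<noteq> {}}) C {q}"

text \<open>
  An ensemble is a probability measure whose space is the set of circuits in the ensemble. The
  sigma-algebra is arbitrary, subject to the implemented unitary being a random variable.
\<close>

definition circuit_ensemble :: "nat \<Rightarrow> nat \<Rightarrow> (nat \<times> nat) set \<Rightarrow> circuit measure \<Rightarrow> bool" where
  "circuit_ensemble n r G E \<longleftrightarrow>
     prob_space E \<and>
     (\<forall>C\<in>space E. valid_circuit n r G C) \<and>
     (\<forall>i<2 ^ n. \<forall>j<2 ^ n. (\<lambda>C. circuit_unitary n C $$ (i, j)) \<in> borel_measurable E)"

definition ensemble_depth :: "circuit measure \<Rightarrow> ereal" where
  "ensemble_depth E = (SUP C\<in>space E. ereal (real (depth C)))"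

definition complete_graph :: "nat \<Rightarrow> (nat \<times> nat) set" where
  "complete_graph n = {(i, j). i < n \<and> j < n \<and> i \<noteq> j}"

definition path_graph :: "nat \<Rightarrow> (nat \<times> nat) set" where
  "path_graph n = {(i, j). i < n \<and> j < n \<and> (j = Suc i \<or> i = Suc j)}"

definition cycle_graph :: "nat \<Rightarrow> (nat \<times> nat) set" where
  "cycle_graph n = {(i, j). i < n \<and> j < n \<and> i \<noteq> j \<and> (j = Suc i mod n \<or> i = Suc j mod n)}"

text \<open>The qubits may be arranged along the path or cycle in any order \<open>p\<close>.\<close>

definition one_dimensional :: "nat \<Rightarrow> (nat \<times> nat) set \<Rightarrow> bool" where
  "one_dimensional n G \<longleftrightarrow>
     (\<exists>p. p permutes {..<n} \<and>
        (G = map_prod p p ` path_graph n \<or> G = map_prod p p ` cycle_graph n))"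

end

(*
  In the Heisenberg picture, U Z_q U^\<dagger> is supported on the lightcone of qubit q. If all lightcones are small,
  it therefore commutes with Z_j for most j, whereas for a random Clifford U the signs of these commutation
  relations have nonpositive mean: if A and B are anticommuting Pauli operators, then (A + B) / sqrt 2 is a
  Clifford involution exchanging A and B, so that Z_q may be replaced by a random Pauli operator that
  anticommutes with it. The sign is visible on four copies: U^\<dagger> Z_j U is a Pauli operator R, and the
  expectation of R \<otimes> R \<otimes> R \<otimes> R in two maximally entangled pairs, with Z_q applied to the first copy, is +1
  or -1 according to whether R commutes with Z_q. Averaged over j this is a diagonal observable of norm at most 1,
  which bounds the diamond distance of the two twirls from below.
*)

theory Submission
  imports Defs
begin

section \<open>Matrices\<close>

text \<open>Why four copies: in one maximally entangled pair, R \<otimes> R has expectation tr (R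
  R^T) / 2^n, and this is itself a sign. It contains the square of the phase of R and a factor -1
  for every Y in R. The second, unmodified pair contributes the same sign once more, so that only
  the commutation sign with Z_q is left. Why an average over j: the qubits outside the lightcone
  vary from circuit to circuit, so no fixed j would serve. The mean over j of the commutation signs
  is at least 1 - 2 |L| / n for every circuit with lightcone L. Why the Clifford mean is only
  bounded above by 0: a random Pauli operator that anticommutes with Z_q has mean sign 0 against R,
  except when R is a multiple of Z_q, where the sign is always -1, or of the identity, which
  U^\<dagger> Z_j U never is. The trace norm is given by the roots of a characteristic polynomial,
  so bounding it from either side first requires a unitary diagonalisation of A^\<dagger> A.\<close>

declare index_mult_mat(1) [simp del]

lemma of_real_cmod_square: "complex_of_real ((cmod z)\<^sup>2) = cnj z * z"
  by (metis complex_norm_square mult.commute of_real_power)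

lemma of_real_sum_cmod_square:
  "complex_of_real (\<Sum>i\<in>A. (cmod (f i))\<^sup>2) = (\<Sum>i\<in>A. cnj (f i) * f i)"
  by (simp only: of_real_sum of_real_cmod_square)

text \<open>Entries of products are expanded as sums over \<open>{..<m}\<close>, the form that
  \<open>sum.swap\<close> and the sums over digits can handle. The removed simp rule would produce
  scalar products of rows and columns instead.\<close>

lemma mult_mat_index:
  assumes "A \<in> carrier_mat n m" "B \<in> carrier_mat m p" "i < n" "j < p"
  shows "(A * B) $$ (i, j) = (\<Sum>l<m. A $$ (i, l) * B $$ (l, j))"
  using assms by (auto simp: index_mult_mat(1) scalar_prod_def atLeast0LessThan intro!: sum.cong)

lemma mat_adjoint_carrier [simp, intro]: "A \<in> carrier_mat n m \<Longrightarrow> mat_adjoint A \<in> carrier_mat m n"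
  by (auto simp: mat_adjoint_def mat_of_rows_def)

lemma dim_mat_adjoint [simp]:
  "dim_row (mat_adjoint A) = dim_col A" "dim_col (mat_adjoint A) = dim_row A"
  by (auto simp: mat_adjoint_def mat_of_rows_def)

lemma mat_adjoint_index:
  fixes A :: "complex mat"
  assumes "A \<in> carrier_mat n m" "i < m" "j < n"
  shows "mat_adjoint A $$ (i, j) = cnj (A $$ (j, i))"
  using assms by (auto simp: mat_adjoint_def mat_of_rows_def)

lemma mat_adjoint_mult:
  fixes A :: "complex mat"
  assumes "A \<in> carrier_mat n m" "B \<in> carrier_mat m p"
  shows "mat_adjoint (A * B) = mat_adjoint B * mat_adjoint A"
proof (rule eq_matI)
  have c: "A * B \<in> carrier_mat n p" "mat_adjoint A \<in> carrier_mat m n"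
    "mat_adjoint B \<in> carrier_mat p m"
    using assms by auto
  fix i j assume "i < dim_row (mat_adjoint B * mat_adjoint A)"
    "j < dim_col (mat_adjoint B * mat_adjoint A)"
  with c have ij: "i < p" "j < n" by auto
  show "mat_adjoint (A * B) $$ (i, j) = (mat_adjoint B * mat_adjoint A) $$ (i, j)"
    using ij assms
    by (simp add: mat_adjoint_index[OF c(1)] mult_mat_index[OF assms] mult_mat_index[OF c(3) c(2)]
        mat_adjoint_index[OF assms(1)] mat_adjoint_index[OF assms(2)] mult.commute)
qed (use assms in auto)

lemma mat_adjoint_adjoint:
  fixes A :: "complex mat"
  assumes "A \<in> carrier_mat n m"
  shows "mat_adjoint (mat_adjoint A) = A"
  using assms mat_adjoint_carrier[OF assms] mat_adjoint_carrier[OF mat_adjoint_carrier[OF assms]]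
  by (intro eq_matI) (auto simp: mat_adjoint_index[OF assms] mat_adjoint_index[OF mat_adjoint_carrier[OF assms]])

lemma mat_adjoint_smult:
  fixes A :: "complex mat"
  assumes "A \<in> carrier_mat n m"
  shows "mat_adjoint (c \<cdot>\<^sub>m A) = cnj c \<cdot>\<^sub>m mat_adjoint A"
  using assms mat_adjoint_carrier[OF assms] mat_adjoint_carrier[OF smult_carrier_mat[OF assms, of c]]
  by (intro eq_matI) (auto simp: mat_adjoint_index[OF assms] mat_adjoint_index[OF smult_carrier_mat[OF assms, of c]])

lemma mat_adjoint_one [simp]: "mat_adjoint (1\<^sub>m n :: complex mat) = 1\<^sub>m n"
  using mat_adjoint_carrier[OF one_carrier_mat[of n]]
  by (intro eq_matI) (auto simp: mat_adjoint_index[OF one_carrier_mat])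

lemma adjoint_conj_mult:
  fixes H :: "complex mat"
  assumes H: "H \<in> carrier_mat n n" and W: "W \<in> carrier_mat n n" and V: "V \<in> carrier_mat n n"
  shows "mat_adjoint (W * V) * H * (W * V) = mat_adjoint V * (mat_adjoint W * H * W * V)"
proof -
  note W' = mat_adjoint_carrier[OF W] and V' = mat_adjoint_carrier[OF V]
  have "mat_adjoint (W * V) * H * (W * V) = mat_adjoint V * mat_adjoint W * H * (W * V)"
    unfolding mat_adjoint_mult[OF W V] ..
  also have "\<dots> = mat_adjoint V * (mat_adjoint W * H) * (W * V)"
    unfolding assoc_mult_mat[OF V' W' H] ..
  also have "\<dots> = mat_adjoint V * (mat_adjoint W * H * (W * V))"
    by (rule assoc_mult_mat[OF V' mult_carrier_mat[OF W' H] mult_carrier_mat[OF W V]])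
  also have "mat_adjoint W * H * (W * V) = mat_adjoint W * H * W * V"
    by (rule assoc_mult_mat[OF mult_carrier_mat[OF W' H] W V, symmetric])
  finally show ?thesis .
qed

lemma adjoint_mult_self:
  fixes A :: "complex mat"
  assumes A: "A \<in> carrier_mat n n" and U: "U \<in> carrier_mat n n"
  shows "mat_adjoint (A * U) * (A * U) = mat_adjoint U * (mat_adjoint A * A) * U"
proof -
  note A' = mat_adjoint_carrier[OF A] and U' = mat_adjoint_carrier[OF U]
  have "mat_adjoint (A * U) * (A * U) = mat_adjoint (A * U) * 1\<^sub>m n * (A * U)"
    using right_mult_one_mat[OF mat_adjoint_carrier[OF mult_carrier_mat[OF A U]]] by simp
  also have "\<dots> = mat_adjoint U * (mat_adjoint A * 1\<^sub>m n * A * U)"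
    by (rule adjoint_conj_mult[OF one_carrier_mat A U])
  also have "\<dots> = mat_adjoint U * (mat_adjoint A * A) * U"
    unfolding right_mult_one_mat[OF A']
    by (rule assoc_mult_mat[OF U' mult_carrier_mat[OF A' A] U, symmetric])
  finally show ?thesis .
qed

lemma unitary_matD:
  assumes "unitary_mat d U"
  shows "U \<in> carrier_mat d d" "mat_adjoint U \<in> carrier_mat d d"
    "U * mat_adjoint U = 1\<^sub>m d" "mat_adjoint U * U = 1\<^sub>m d"
  using assms by (auto simp: unitary_mat_def)

lemma unitary_matI:
  assumes "U \<in> carrier_mat d d" "mat_adjoint U * U = 1\<^sub>m d"
  shows "unitary_mat d U"
  using assms mat_mult_left_right_inverse[OF mat_adjoint_carrier[OF assms(1)] assms(1)]
  by (auto simp: unitary_mat_def)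

lemma unitary_mat_mult:
  assumes "unitary_mat d U" "unitary_mat d V"
  shows "unitary_mat d (U * V)"
proof (rule unitary_matI)
  note U = unitary_matD[OF assms(1)] and V = unitary_matD[OF assms(2)]
  show "U * V \<in> carrier_mat d d" using U V by auto
  show "mat_adjoint (U * V) * (U * V) = 1\<^sub>m d"
    unfolding adjoint_mult_self[OF U(1) V(1)] U(4) right_mult_one_mat[OF V(2)] V(4) ..
qed

lemma unitary_mat_adjoint: "unitary_mat d U \<Longrightarrow> unitary_mat d (mat_adjoint U)"
  by (auto simp: unitary_mat_def mat_adjoint_adjoint)

lemma unitary_mat_one: "unitary_mat d (1\<^sub>m d)"
  by (simp add: unitary_mat_def)

lemma unitary_col_norm:
  assumes "unitary_mat d U" "j < d"
  shows "(\<Sum>i<d. (cmod (U $$ (i, j)))\<^sup>2) = 1"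
proof -
  note U = unitary_matD[OF assms(1)]
  have "complex_of_real (\<Sum>i<d. (cmod (U $$ (i, j)))\<^sup>2) = (mat_adjoint U * U) $$ (j, j)"
    unfolding of_real_sum_cmod_square using assms(2)
    by (simp add: mult_mat_index[OF U(2,1)] mat_adjoint_index[OF U(1)])
  also have "\<dots> = 1" using U(4) assms(2) by simp
  finally show ?thesis by (simp only: of_real_eq_1_iff)
qed

lemma unitary_entry_le_1:
  assumes "unitary_mat d U" "i < d" "j < d"
  shows "cmod (U $$ (i, j)) \<le> 1"
proof -
  have "(cmod (U $$ (i, j)))\<^sup>2 \<le> (\<Sum>i<d. (cmod (U $$ (i, j)))\<^sup>2)"
    using assms(2) by (intro member_le_sum) auto
  then show ?thesis
    using unitary_col_norm[OF assms(1,3)] by (simp add: abs_square_le_1)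
qed

section \<open>The trace norm\<close>

text \<open>Gram-Schmidt on a basis that starts with \<open>v\<close> keeps \<open>v\<close> in
  front and yields orthogonal vectors; dividing by their lengths makes the matrix unitary. The
  scalar \<open>r\<close> is left open because only the direction of an eigenvector matters
  later.\<close>

lemma unitary_with_first_col:
  fixes v :: "complex vec"
  assumes v: "v \<in> carrier_vec (Suc n)" and v0: "v \<noteq> 0\<^sub>v (Suc n)"
  shows "\<exists>W r. unitary_mat (Suc n) W \<and> (\<forall>i<(Suc n). W $$ (i, 0) = vec_index v i / r)"
proof -
  let ?N = "Suc n"
  define b where "b = basis_completion v"
  define ws where "ws = gram_schmidt ?N b"
  interpret cof_vec_space ?N "TYPE(complex)" .
  from basis_completion[OF v v0, folded b_def]
  have span_b: "span (set b) = carrier_vec ?N" and dist_b: "distinct b"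
    and indep: "\<not> lin_dep (set b)" and b: "set b \<subseteq> carrier_vec ?N" and hdb: "hd b = v"
    and len_b: "length b = ?N" by auto
  from hdb len_b obtain vs where bv: "b = v # vs" by (cases b) auto
  from gram_schmidt_result[OF b dist_b indep refl, folded ws_def]
  have ws: "set ws \<subseteq> carrier_vec ?N" "corthogonal ws" "length ws = ?N"
    by (auto simp: len_b)
  from gram_schmidt_hd[OF v, of vs, folded bv] have hdws: "hd ws = v" unfolding ws_def .
  have ws0: "ws ! 0 = v" using hdws ws(3) by (cases ws) auto
  have wsc: "ws ! j \<in> carrier_vec ?N" if "j < ?N" for j
    using ws that by auto
  \<comment> \<open>The Gram matrix of \<open>ws\<close>: corthogonality says that it vanishes off
    the diagonal and nowhere on it.\<close>
  define g where "g i j = (\<Sum>l<?N. cnj (vec_index (ws ! i) l) * vec_index (ws ! j) l)" for i j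
  have g_sp: "g i j = scalar_prod (ws ! j) (conjugate (ws ! i))" if "i < ?N" "j < ?N" for i j
    using wsc[OF that(1)] wsc[OF that(2)]
    by (auto simp: g_def scalar_prod_def atLeast0LessThan mult.commute intro!: sum.cong)
  have g0: "(g i j = 0) = (i \<noteq> j)" if "i < ?N" "j < ?N" for i j
    using g_sp[OF that] corthogonalD[OF ws(2), of j i] that ws(3) by auto
  define r where "r j = sqrt (\<Sum>l<?N. (cmod (vec_index (ws ! j) l))\<^sup>2)" for j
  have gr: "g j j = (complex_of_real (r j))\<^sup>2" for j
  proof -
    have "(complex_of_real (r j))\<^sup>2 = complex_of_real ((r j)\<^sup>2)" by simp
    also have "(r j)\<^sup>2 = (\<Sum>l<?N. (cmod (vec_index (ws ! j) l))\<^sup>2)"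
      unfolding r_def by (intro real_sqrt_pow2 sum_nonneg) auto
    also have "complex_of_real \<dots> = g j j"
      by (simp only: of_real_sum_cmod_square g_def)
    finally show ?thesis by (rule sym)
  qed
  have r0: "r j \<noteq> 0" if "j < ?N" for j
  proof
    assume "r j = 0"
    then have "g j j = 0" unfolding gr by simp
    then show False using g0[OF that that] by simp
  qed
  define W where "W = Matrix.mat ?N ?N (\<lambda>(i, j). vec_index (ws ! j) i / complex_of_real (r j))"
  have W: "W \<in> carrier_mat ?N ?N" by (simp add: W_def)
  note W' = mat_adjoint_carrier[OF W]
  have uW: "unitary_mat ?N W"
  proof (rule unitary_matI[OF W], rule eq_matI)
    fix i j assume "i < dim_row (1\<^sub>m ?N)" "j < dim_col (1\<^sub>m ?N)"
    then have ij: "i < ?N" "j < ?N" by auto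
    have "(mat_adjoint W * W) $$ (i, j) = (\<Sum>l<?N. cnj (W $$ (l, i)) * W $$ (l, j))"
      using ij by (simp add: mult_mat_index[OF W' W ij] mat_adjoint_index[OF W] del: sum.lessThan_Suc)
    also have "\<dots> = g i j / (complex_of_real (r i) * complex_of_real (r j))"
      using ij by (simp add: g_def W_def sum_divide_distrib del: sum.lessThan_Suc)
    also have "\<dots> = 1\<^sub>m ?N $$ (i, j)"
    proof (cases "i = j")
      case True
      then show ?thesis using r0[OF ij(1)] ij by (simp add: gr power2_eq_square)
    next
      case False
      then have "g i j = 0" using g0[OF ij] by simp
      then show ?thesis using False ij by simp
    qed
    finally show "(mat_adjoint W * W) $$ (i, j) = 1\<^sub>m ?N $$ (i, j)" .
  qed (use W W' in auto)
  have "\<forall>i<?N. W $$ (i, 0) = vec_index v i / complex_of_real (r 0)"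
    by (auto simp: W_def ws0)
  with uW show ?thesis by blast
qed

text \<open>Deflation: a unitary whose first column is an eigenvector brings \<open>H\<close> into
  block form, with the eigenvalue in the corner and a smaller Hermitian block to which the induction
  hypothesis applies.\<close>

lemma hermitian_diagonalization:
  fixes H :: "complex mat"
  assumes "H \<in> carrier_mat n n" "mat_adjoint H = H"
  shows "\<exists>U. unitary_mat n U \<and> (\<forall>i<n. \<forall>j<n. i \<noteq> j \<longrightarrow> (mat_adjoint U * H * U) $$ (i, j) = 0)"
  using assms
proof (induction n arbitrary: H)
  case 0
  then show ?case by (auto intro!: exI[of _ "1\<^sub>m 0"] unitary_mat_one)
next
  case (Suc n)
  let ?N = "Suc n"
  note H = Suc.prems
  have "degree (char_poly H) = ?N" using degree_monic_char_poly[OF H(1)] by simp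
  then have "\<not> constant (poly (char_poly H))" by (simp add: constant_degree)
  then obtain e where "poly (char_poly H) e = 0" using fundamental_theorem_of_algebra by blast
  then have "eigenvalue H e" using eigenvalue_root_char_poly[OF H(1)] by simp
  then obtain v where "eigenvector H v e" by (auto simp: eigenvalue_def)
  then have v: "v \<in> carrier_vec ?N" and v0: "v \<noteq> 0\<^sub>v ?N" and Hv: "H *\<^sub>v v = e \<cdot>\<^sub>v v"
    using H(1) by (auto simp: eigenvector_def)
  obtain W r where uW: "unitary_mat ?N W" and W0: "\<And>i. i < ?N \<Longrightarrow> W $$ (i, 0) = vec_index v i / r"
    using unitary_with_first_col[OF v v0] by blast
  note WW = unitary_matD[OF uW]
  note W = WW(1) and W' = WW(2)
  have HW0: "(H * W) $$ (i, 0) = e * W $$ (i, 0)" if "i < ?N" for i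
  proof -
    have "(H * W) $$ (i, 0) = (\<Sum>l<?N. H $$ (i, l) * vec_index v l) / r"
      using that mult_mat_index[OF H(1) W, of i 0]
      by (simp add: W0 sum_divide_distrib del: sum.lessThan_Suc)
    also have "(\<Sum>l<?N. H $$ (i, l) * vec_index v l) = vec_index (H *\<^sub>v v) i"
      using that H(1) v
      by (auto simp: scalar_prod_def atLeast0LessThan intro!: sum.cong simp del: sum.lessThan_Suc)
    also have "\<dots> = e * vec_index v i" unfolding Hv using that v by simp
    finally show ?thesis using that by (simp add: W0)
  qed
  define H' where "H' = mat_adjoint W * H * W"
  have H'c: "H' \<in> carrier_mat ?N ?N" using W W' H by (auto simp: H'_def)
  have H'eq: "H' = mat_adjoint W * (H * W)"
    unfolding H'_def by (rule assoc_mult_mat[OF W' H(1) W])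
  have H'adj: "mat_adjoint H' = H'"
    unfolding H'eq mat_adjoint_mult[OF W' mult_carrier_mat[OF H(1) W]] mat_adjoint_mult[OF H(1) W]
      mat_adjoint_adjoint[OF W] H(2)
    by (rule assoc_mult_mat[OF W' H(1) W])
  have H'0: "H' $$ (i, 0) = (if i = 0 then e else 0)" if "i < ?N" for i
  proof -
    have "H' $$ (i, 0) = (\<Sum>l<?N. mat_adjoint W $$ (i, l) * (H * W) $$ (l, 0))"
      unfolding H'eq using that by (subst mult_mat_index[of _ ?N ?N _ ?N]) (use W W' H in auto)
    also have "\<dots> = e * (\<Sum>l<?N. mat_adjoint W $$ (i, l) * W $$ (l, 0))"
      by (simp add: HW0 sum_distrib_left ac_simps del: sum.lessThan_Suc)
    also have "(\<Sum>l<?N. mat_adjoint W $$ (i, l) * W $$ (l, 0)) = (mat_adjoint W * W) $$ (i, 0)"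
      using that by (simp add: mult_mat_index[OF W' W] del: sum.lessThan_Suc)
    also have "\<dots> = (if i = 0 then 1 else 0)" using that WW(4) by simp
    finally show ?thesis by simp
  qed
  \<comment> \<open>This separates diagonalisation from triangularisation: by Hermiticity the first
    row vanishes along with the first column.\<close>
  have H'1: "H' $$ (0, i) = 0" if "i < ?N" "i \<noteq> 0" for i
    using mat_adjoint_index[OF H'c, of 0 i] H'adj H'0[OF that(1)] that by simp
  define H3 where "H3 = Matrix.mat n n (\<lambda>(i, j). H' $$ (Suc i, Suc j))"
  have H3: "H3 \<in> carrier_mat n n" by (simp add: H3_def)
  have "mat_adjoint H3 = H3"
  proof (rule eq_matI)
    fix i j assume "i < dim_row H3" "j < dim_col H3"
    then have ij: "i < n" "j < n" by (auto simp: H3_def)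
    then show "mat_adjoint H3 $$ (i, j) = H3 $$ (i, j)"
      using mat_adjoint_index[OF H'c, of "Suc i" "Suc j"] H'adj
      unfolding mat_adjoint_index[OF H3 ij] by (simp add: H3_def)
  qed (use H3 mat_adjoint_carrier[OF H3] in auto)
  from Suc.IH[OF H3 this] obtain U where U: "unitary_mat n U"
    and Ud: "\<And>i j. i < n \<Longrightarrow> j < n \<Longrightarrow> i \<noteq> j \<Longrightarrow> (mat_adjoint U * H3 * U) $$ (i, j) = 0" by blast
  note UU = unitary_matD[OF U]
  \<comment> \<open>The block matrix with 1 in the corner and \<open>U\<close> below it.\<close>
  define V where "V = Matrix.mat ?N ?N (\<lambda>(i, j). if i = 0 \<or> j = 0 then (if i = j then 1 else 0)
                                               else U $$ (i - 1, j - 1))"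
  have V: "V \<in> carrier_mat ?N ?N" by (simp add: V_def)
  note V' = mat_adjoint_carrier[OF V]
  have V0: "V $$ (0, j) = (if j = 0 then 1 else 0)" "V $$ (j, 0) = (if j = 0 then 1 else 0)"
    if "j < ?N" for j using that by (auto simp: V_def)
  have VS: "V $$ (Suc i, Suc j) = U $$ (i, j)" if "i < n" "j < n" for i j
    using that by (auto simp: V_def)
  have uV: "unitary_mat ?N V"
  proof (rule unitary_matI[OF V], rule eq_matI)
    fix i j assume "i < dim_row (1\<^sub>m ?N)" "j < dim_col (1\<^sub>m ?N)"
    then have ij: "i < ?N" "j < ?N" by auto
    have "(mat_adjoint V * V) $$ (i, j) = (\<Sum>l<?N. cnj (V $$ (l, i)) * V $$ (l, j))"
      using ij by (simp add: mult_mat_index[OF V' V ij] mat_adjoint_index[OF V] del: sum.lessThan_Suc)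
    also have "\<dots> = cnj (V $$ (0, i)) * V $$ (0, j)
       + (\<Sum>l<n. cnj (V $$ (Suc l, i)) * V $$ (Suc l, j))"
      by (simp add: sum.lessThan_Suc_shift del: sum.lessThan_Suc)
    also have "\<dots> = 1\<^sub>m ?N $$ (i, j)"
    proof (cases "i = 0 \<or> j = 0")
      case True
      then show ?thesis using ij by (auto simp: V0)
    next
      case False
      then obtain i' j' where s: "i = Suc i'" "j = Suc j'" by (auto simp: gr0_conv_Suc)
      then have ij': "i' < n" "j' < n" using ij by auto
      have "(\<Sum>l<n. cnj (V $$ (Suc l, i)) * V $$ (Suc l, j)) = (mat_adjoint U * U) $$ (i', j')"
        using ij' by (simp add: s VS mult_mat_index[OF UU(2,1)] mat_adjoint_index[OF UU(1)])
      then show ?thesis using ij' ij by (simp add: UU(4) s V0)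
    qed
    finally show "(mat_adjoint V * V) $$ (i, j) = 1\<^sub>m ?N $$ (i, j)" .
  qed (use V V' in auto)
  have off: "(mat_adjoint (W * V) * H * (W * V)) $$ (i, j) = 0" if ij: "i < ?N" "j < ?N" "i \<noteq> j" for i j
  proof -
    have e1: "mat_adjoint (W * V) * H * (W * V) = mat_adjoint V * (H' * V)"
      unfolding H'_def by (rule adjoint_conj_mult[OF H(1) W V])
    have "(mat_adjoint V * (H' * V)) $$ (i, j) =
        (\<Sum>a<?N. cnj (V $$ (a, i)) * (\<Sum>b<?N. H' $$ (a, b) * V $$ (b, j)))"
      using ij by (simp add: mult_mat_index[OF V' mult_carrier_mat[OF H'c V]]
          mult_mat_index[OF H'c V] mat_adjoint_index[OF V] del: sum.lessThan_Suc)
    also have "\<dots> = 0"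
    proof (cases "i = 0 \<or> j = 0")
      case True
      then show ?thesis
      proof
        assume "i = 0"
        with ij obtain j' where s: "j = Suc j'" "j' < n" by (auto simp: gr0_conv_Suc)
        show ?thesis using \<open>i = 0\<close> s ij
          by (simp add: sum.lessThan_Suc_shift V0 H'1 del: sum.lessThan_Suc)
      next
        assume "j = 0"
        with ij obtain i' where s: "i = Suc i'" "i' < n" by (auto simp: gr0_conv_Suc)
        show ?thesis using \<open>j = 0\<close> s ij
          by (simp add: sum.lessThan_Suc_shift V0 H'0 del: sum.lessThan_Suc)
      qed
    next
      case False
      then obtain i' j' where s: "i = Suc i'" "j = Suc j'" by (auto simp: gr0_conv_Suc)
      then have ij': "i' < n" "j' < n" "i' \<noteq> j'" using ij by auto
      have "(\<Sum>a<?N. cnj (V $$ (a, i)) * (\<Sum>b<?N. H' $$ (a, b) * V $$ (b, j)))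
          = (\<Sum>a<n. cnj (U $$ (a, i')) * (\<Sum>b<n. H3 $$ (a, b) * U $$ (b, j')))"
        using ij' by (simp add: sum.lessThan_Suc_shift V0 s VS H'0 H3_def del: sum.lessThan_Suc)
      also have "\<dots> = (mat_adjoint U * (H3 * U)) $$ (i', j')"
        using ij' by (simp add: mult_mat_index[OF UU(2) mult_carrier_mat[OF H3 UU(1)]]
          mult_mat_index[OF H3 UU(1)] mat_adjoint_index[OF UU(1)])
      also have "mat_adjoint U * (H3 * U) = mat_adjoint U * H3 * U"
        by (rule assoc_mult_mat[OF UU(2) H3 UU(1), symmetric])
      finally show ?thesis using Ud[OF ij'] by simp
    qed
    finally show ?thesis unfolding e1 .
  qed
  show ?case using unitary_mat_mult[OF uW uV] off by blast
qed

section \<open>The trace norm as a sum of column lengths\<close>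

lemma proots_linear_factors:
  fixes as :: "'a :: idom list"
  shows "proots (\<Prod>a\<leftarrow>as. [:- a, 1:]) = mset as"
proof (induction as)
  case (Cons a as)
  have "(\<Prod>a\<leftarrow>as. [:- a, 1:]) \<noteq> 0" by (auto simp: prod_list_zero_iff)
  with Cons show ?case by (simp add: proots_mult del: mult_pCons_left)
qed simp

text \<open>If U diagonalises A^\<dagger> A, then the columns of \<open>A * U\<close> are orthogonal
  and their squared lengths are the eigenvalues, so the singular values are column lengths. This
  takes the place of a singular value decomposition; the orthogonality is recorded for the rank one
  case.\<close>

lemma trace_norm_eq:
  assumes A: "A \<in> carrier_mat n n"
  shows "\<exists>U. unitary_mat n U \<and>
    (\<forall>i<n. \<forall>j<n. i \<noteq> j \<longrightarrow> (\<Sum>l<n. cnj ((A * U) $$ (l, i)) * (A * U) $$ (l, j)) = 0) \<and>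
    trace_norm A = (\<Sum>i<n. sqrt (\<Sum>l<n. (cmod ((A * U) $$ (l, i)))\<^sup>2))"
proof -
  let ?H = "mat_adjoint A * A"
  note A' = mat_adjoint_carrier[OF A]
  have H: "?H \<in> carrier_mat n n" using A A' by auto
  have "mat_adjoint ?H = ?H" unfolding mat_adjoint_mult[OF A' A] mat_adjoint_adjoint[OF A] ..
  from hermitian_diagonalization[OF H this] obtain U where U: "unitary_mat n U"
    and off: "\<And>i j. i < n \<Longrightarrow> j < n \<Longrightarrow> i \<noteq> j \<Longrightarrow> (mat_adjoint U * ?H * U) $$ (i, j) = 0" by blast
  note UU = unitary_matD[OF U]
  let ?B = "mat_adjoint U * ?H * U"
  have B: "?B \<in> carrier_mat n n" using UU H by auto
  have AU: "A * U \<in> carrier_mat n n" using A UU by auto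
  have Beq: "?B = mat_adjoint (A * U) * (A * U)"
    by (rule adjoint_mult_self[OF A UU(1), symmetric])
  have Bij: "?B $$ (i, j) = (\<Sum>l<n. cnj ((A * U) $$ (l, i)) * (A * U) $$ (l, j))"
    if "i < n" "j < n" for i j
    unfolding Beq using that
    by (subst mult_mat_index[OF mat_adjoint_carrier[OF AU] AU])
       (auto simp: mat_adjoint_index[OF AU])
  have Bii: "?B $$ (i, i) = complex_of_real (\<Sum>l<n. (cmod ((A * U) $$ (l, i)))\<^sup>2)" if "i < n" for i
    by (simp only: Bij[OF that that] of_real_sum_cmod_square)
  have "upper_triangular ?B"
    using off B by (auto simp: upper_triangular_def)
  from char_poly_upper_triangular[OF B this]
  have "char_poly ?B = (\<Prod>a\<leftarrow>diag_mat ?B. [:- a, 1:])" .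
  moreover have "similar_mat ?B ?H"
    using similar_mat_witI[OF UU(4,3) refl B H UU(2,1)] by (auto simp: similar_mat_def)
  ultimately have "char_poly ?H = (\<Prod>a\<leftarrow>diag_mat ?B. [:- a, 1:])"
    using char_poly_similar by metis
  then have "proots (char_poly ?H) = mset (diag_mat ?B)"
    by (simp add: proots_linear_factors)
  then have "trace_norm A = (\<Sum>e\<leftarrow>diag_mat ?B. sqrt (Re e))"
    by (simp add: trace_norm_def sum_mset_sum_list flip: mset_map)
  also have "\<dots> = (\<Sum>i<n. sqrt (Re (?B $$ (i, i))))"
    using carrier_matD(1)[OF B] unfolding diag_mat_def by (simp add: interv_sum_list_conv_sum_set_nat o_def atLeast0LessThan)
  also have "\<dots> = (\<Sum>i<n. sqrt (\<Sum>l<n. (cmod ((A * U) $$ (l, i)))\<^sup>2))"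
    by (rule sum.cong) (auto simp: Bii)
  finally have "trace_norm A = (\<Sum>i<n. sqrt (\<Sum>l<n. (cmod ((A * U) $$ (l, i)))\<^sup>2))" .
  moreover have "\<forall>i<n. \<forall>j<n. i \<noteq> j \<longrightarrow> (\<Sum>l<n. cnj ((A * U) $$ (l, i)) * (A * U) $$ (l, j)) = 0"
    using off by (simp add: Bij)
  ultimately show ?thesis using U by blast
qed

text \<open>One half of the duality with the operator norm, for diagonal observables: writing A = (A
  U) U^\<dagger> turns the trace into a sum over columns, and Cauchy-Schwarz bounds each of them
  because the columns of U have length 1.\<close>

lemma trace_norm_ge_diag:
  assumes A: "A \<in> carrier_mat n n" and y: "\<And>i. i < n \<Longrightarrow> cmod (y i) \<le> 1"
  shows "cmod (\<Sum>i<n. y i * A $$ (i, i)) \<le> trace_norm A"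
proof -
  obtain U where U: "unitary_mat n U"
    and tn: "trace_norm A = (\<Sum>i<n. sqrt (\<Sum>l<n. (cmod ((A * U) $$ (l, i)))\<^sup>2))"
    using trace_norm_eq[OF A] by blast
  note UU = unitary_matD[OF U]
  have AU: "A * U \<in> carrier_mat n n" using A UU by auto
  have "A = A * U * mat_adjoint U" unfolding assoc_mult_mat[OF A UU(1,2)] UU(3) using A by simp
  then have "A $$ (l, l) = (\<Sum>i<n. (A * U) $$ (l, i) * cnj (U $$ (l, i)))" if "l < n" for l
    using that mult_mat_index[OF AU UU(2), of l l] mat_adjoint_index[OF UU(1)] by simp
  then have "(\<Sum>l<n. y l * A $$ (l, l)) = (\<Sum>l<n. \<Sum>i<n. y l * ((A * U) $$ (l, i) * cnj (U $$ (l, i))))"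
    by (simp add: sum_distrib_left)
  also have "\<dots> = (\<Sum>i<n. \<Sum>l<n. y l * ((A * U) $$ (l, i) * cnj (U $$ (l, i))))"
    by (rule sum.swap)
  also have "cmod \<dots> \<le> (\<Sum>i<n. sqrt (\<Sum>l<n. (cmod ((A * U) $$ (l, i)))\<^sup>2))"
  proof (rule sum_norm_le)
    fix i assume "i \<in> {..<n}"
    then have i: "i < n" by simp
    have "cmod (\<Sum>l<n. y l * ((A * U) $$ (l, i) * cnj (U $$ (l, i))))
        \<le> (\<Sum>l<n. cmod ((A * U) $$ (l, i)) * cmod (U $$ (l, i)))"
    proof (rule sum_norm_le)
      fix l assume "l \<in> {..<n}"
      then have "cmod (y l) \<le> 1" using y by simp
      then have "cmod (y l) * (cmod ((A * U) $$ (l, i)) * cmod (U $$ (l, i)))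
          \<le> 1 * (cmod ((A * U) $$ (l, i)) * cmod (U $$ (l, i)))"
        by (intro mult_right_mono) auto
      then show "cmod (y l * ((A * U) $$ (l, i) * cnj (U $$ (l, i))))
         \<le> cmod ((A * U) $$ (l, i)) * cmod (U $$ (l, i))"
        by (simp add: norm_mult)
    qed
    also have "\<dots> \<le> sqrt (\<Sum>l<n. (cmod ((A * U) $$ (l, i)))\<^sup>2)"
    proof (rule real_le_rsqrt)
      show "(\<Sum>l<n. cmod ((A * U) $$ (l, i)) * cmod (U $$ (l, i)))\<^sup>2 \<le> (\<Sum>l<n. (cmod ((A * U) $$ (l, i)))\<^sup>2)"
        using Cauchy_Schwarz_ineq_sum[of "\<lambda>l. cmod ((A * U) $$ (l, i))" "\<lambda>l. cmod (U $$ (l, i))" "{..<n}"]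
          unitary_col_norm[OF U i] by simp
    qed
    finally show "cmod (\<Sum>l<n. y l * ((A * U) $$ (l, i) * cnj (U $$ (l, i))))
      \<le> sqrt (\<Sum>l<n. (cmod ((A * U) $$ (l, i)))\<^sup>2)" .
  qed
  finally show ?thesis using tn by simp
qed

text \<open>All columns of \<open>A * U\<close> are multiples of \<psi>, so their orthogonality
  leaves at most one nonzero coefficient \<open>c i\<close>. Hence the square of the sum of the
  moduli is the sum of their squares, which is the squared length of \<psi>.\<close>

lemma trace_norm_rank_one:
  assumes \<psi>: "(\<Sum>i<n. (cmod (\<psi> i))\<^sup>2) = 1"
  shows "trace_norm (Matrix.mat n n (\<lambda>(i, j). \<psi> i * cnj (\<psi> j))) \<le> 1"
proof -
  define A where "A = Matrix.mat n n (\<lambda>(i, j). \<psi> i * cnj (\<psi> j))"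
  have A: "A \<in> carrier_mat n n" by (simp add: A_def)
  obtain U where U: "unitary_mat n U"
    and off: "\<And>i j. i < n \<Longrightarrow> j < n \<Longrightarrow> i \<noteq> j \<Longrightarrow>
       (\<Sum>l<n. cnj ((A * U) $$ (l, i)) * (A * U) $$ (l, j)) = 0"
    and tn: "trace_norm A = (\<Sum>i<n. sqrt (\<Sum>l<n. (cmod ((A * U) $$ (l, i)))\<^sup>2))"
    using trace_norm_eq[OF A] by blast
  note UU = unitary_matD[OF U]
  define c where "c i = (\<Sum>j<n. cnj (\<psi> j) * U $$ (j, i))" for i
  have AU: "(A * U) $$ (l, i) = \<psi> l * c i" if "l < n" "i < n" for l i
    using that unfolding mult_mat_index[OF A UU(1) that]
    by (simp add: A_def c_def sum_distrib_left mult.assoc)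
  have "(\<Sum>l<n. cnj (\<psi> l) * \<psi> l) = complex_of_real (\<Sum>i<n. (cmod (\<psi> i))\<^sup>2)"
    by (simp only: of_real_sum_cmod_square)
  then have one: "(\<Sum>l<n. cnj (\<psi> l) * \<psi> l) = 1" unfolding \<psi> by simp
  have cc: "c i = 0 \<or> c j = 0" if "i < n" "j < n" "i \<noteq> j" for i j
  proof -
    have "0 = (\<Sum>l<n. cnj ((A * U) $$ (l, i)) * (A * U) $$ (l, j))" using off[OF that] by simp
    also have "\<dots> = (\<Sum>l<n. (cnj (\<psi> l) * \<psi> l) * (cnj (c i) * c j))"
      using that by (intro sum.cong) (auto simp: AU algebra_simps)
    also have "\<dots> = cnj (c i) * c j" using one by (simp flip: sum_distrib_right)
    finally show ?thesis by auto
  qed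
  have "sqrt (\<Sum>l<n. (cmod ((A * U) $$ (l, i)))\<^sup>2) = cmod (c i)" if "i < n" for i
  proof -
    have "(\<Sum>l<n. (cmod ((A * U) $$ (l, i)))\<^sup>2) = (\<Sum>l<n. (cmod (\<psi> l))\<^sup>2 * (cmod (c i))\<^sup>2)"
      using that by (intro sum.cong) (auto simp: AU norm_mult power_mult_distrib)
    then show ?thesis by (simp add: \<psi> flip: sum_distrib_right)
  qed
  then have tn': "trace_norm A = (\<Sum>i<n. cmod (c i))" using tn by simp
  have "(\<Sum>i<n. cmod (c i))\<^sup>2 = (\<Sum>i<n. (cmod (c i))\<^sup>2)"
  proof -
    have "(\<Sum>i<n. cmod (c i))\<^sup>2 = (\<Sum>i<n. \<Sum>j<n. cmod (c i) * cmod (c j))"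
      by (simp add: power2_eq_square sum_product)
    also have "\<dots> = (\<Sum>i<n. \<Sum>j<n. if j = i then (cmod (c i))\<^sup>2 else 0)"
      using cc by (intro sum.cong refl) (auto simp: power2_eq_square)
    finally show ?thesis by simp
  qed
  \<comment> \<open>The sum of squares is \<psi>^\<dagger> U U^\<dagger> \<psi>; the sums are
    reordered until U U^\<dagger> = 1 can be inserted.\<close>
  also have "complex_of_real \<dots> = (\<Sum>i<n. (\<Sum>j<n. cnj (\<psi> j) * U $$ (j, i)) * (\<Sum>j<n. \<psi> j * cnj (U $$ (j, i))))"
    unfolding of_real_sum_cmod_square by (simp add: c_def mult.commute)
  also have "\<dots> = (\<Sum>i<n. \<Sum>j<n. \<Sum>l<n. cnj (\<psi> j) * \<psi> l * (U $$ (j, i) * cnj (U $$ (l, i))))"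
    unfolding sum_product by (intro sum.cong refl) (simp add: algebra_simps)
  also have "\<dots> = (\<Sum>j<n. \<Sum>i<n. \<Sum>l<n. cnj (\<psi> j) * \<psi> l * (U $$ (j, i) * cnj (U $$ (l, i))))"
    by (rule sum.swap)
  also have "\<dots> = (\<Sum>j<n. \<Sum>l<n. \<Sum>i<n. cnj (\<psi> j) * \<psi> l * (U $$ (j, i) * cnj (U $$ (l, i))))"
    by (intro sum.cong refl sum.swap)
  also have "\<dots> = (\<Sum>j<n. \<Sum>l<n. cnj (\<psi> j) * \<psi> l * (U * mat_adjoint U) $$ (j, l))"
    by (intro sum.cong refl) (auto simp: mult_mat_index[OF UU(1,2)] mat_adjoint_index[OF UU(1)]
        sum_distrib_left)
  also have "\<dots> = (\<Sum>j<n. \<Sum>l<n. if l = j then cnj (\<psi> j) * \<psi> j else 0)"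
    by (intro sum.cong refl) (auto simp: UU(3))
  also have "\<dots> = 1" using one by simp
  finally have "(\<Sum>i<n. cmod (c i))\<^sup>2 = 1" by (simp only: of_real_eq_1_iff)
  then have "(\<Sum>i<n. cmod (c i)) \<le> 1" by (auto simp: power2_eq_1_iff)
  then show ?thesis using tn' by (simp add: A_def)
qed

section \<open>Tensor products\<close>

lemma sum_lessThan_mult:
  fixes f :: "nat \<Rightarrow> 'a::comm_monoid_add"
  shows "(\<Sum>x<k * b. f x) = (\<Sum>l<b. \<Sum>y<k. f (y + l * k))"
proof (induction b)
  case (Suc b)
  have "(\<Sum>x<k * Suc b. f x) = (\<Sum>x\<in>{0..<k * b + k}. f x)"
    by (simp add: atLeast0LessThan add.commute)
  also have "\<dots> = (\<Sum>x\<in>{0..<k * b}. f x) + (\<Sum>x\<in>{k * b..<k * b + k}. f x)"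
    by (rule sum.atLeastLessThan_concat[symmetric]) auto
  also have "(\<Sum>x\<in>{k * b..<k * b + k}. f x) = (\<Sum>y<k. f (y + b * k))"
    using sum.shift_bounds_nat_ivl[of f 0 "k * b" k]
    by (simp add: atLeast0LessThan ac_simps)
  finally show ?case using Suc by (simp add: atLeast0LessThan)
qed simp

lemma digit_less: "b > 0 \<Longrightarrow> digit b t x < b"
  by (simp add: digit_def)

lemma digit_add_low:
  assumes "t < m" "b > 0"
  shows "digit b t (y + l * b ^ m) = digit b t y"
proof -
  have "l * b ^ m = b ^ t * (b * (l * b ^ (m - Suc t)))"
    using assms(1) by (metis Suc_diff_Suc add_diff_inverse_nat less_imp_le_nat mult.left_commute
        not_less power_Suc power_add)
  moreover have "(y + b ^ t * c) div b ^ t = c + y div b ^ t" for c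
    using assms(2) by simp
  ultimately have "(y + l * b ^ m) div b ^ t = b * (l * b ^ (m - Suc t)) + y div b ^ t"
    by (simp only:)
  then show ?thesis by (simp add: digit_def)
qed

lemma digit_add_top:
  assumes "y < b ^ m" "l < b"
  shows "digit b m (y + l * b ^ m) = l"
  using assms by (simp add: digit_def)

text \<open>The index x runs through all tuples of digits, so this is the distributive law. Every
  factorisation over tensor factors rests on it: matrix products, sums of squared entries, and
  conjugated observables.\<close>

lemma sum_prod_digits:
  fixes f :: "nat \<Rightarrow> nat \<Rightarrow> 'a::comm_semiring_1"
  assumes "b > 0"
  shows "(\<Sum>x<b ^ m. \<Prod>t<m. f t (digit b t x)) = (\<Prod>t<m. \<Sum>l<b. f t l)"
proof (induction m)
  case (Suc m)
  have "(\<Sum>x<b ^ Suc m. \<Prod>t<Suc m. f t (digit b t x))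
      = (\<Sum>l<b. \<Sum>y<b ^ m. \<Prod>t<Suc m. f t (digit b t (y + l * b ^ m)))"
    using sum_lessThan_mult[of _ "b ^ m" b] by (simp add: mult.commute)
  also have "\<dots> = (\<Sum>l<b. \<Sum>y<b ^ m. (\<Prod>t<m. f t (digit b t y)) * f m l)"
    using assms by (intro sum.cong refl) (simp add: digit_add_low digit_add_top mult.commute)
  also have "\<dots> = (\<Prod>t<Suc m. \<Sum>l<b. f t l)"
    by (simp add: Suc flip: sum_distrib_right sum_distrib_left)
  finally show ?case .
qed simp

lemma digit_eqI:
  assumes "x < b ^ m" "y < b ^ m" "\<And>t. t < m \<Longrightarrow> digit b t x = digit b t y"
  shows "x = y"
  using assms
proof (induction m arbitrary: x y)
  case (Suc m)
  have b: "b > 0" using Suc.prems(1) by (cases b) auto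
  have "x div b < b ^ m" "y div b < b ^ m"
    using Suc.prems(1,2) b by (auto simp: less_mult_imp_div_less mult.commute)
  moreover have "digit b t (x div b) = digit b t (y div b)" if "t < m" for t
    using Suc.prems(3)[of "Suc t"] that by (simp add: digit_def div_mult2_eq)
  ultimately have "x div b = y div b" by (rule Suc.IH)
  moreover have "x mod b = y mod b" using Suc.prems(3)[of 0] by (simp add: digit_def)
  ultimately show ?case by (metis mult_div_mod_eq)
qed simp

lemma tensor_prod_carrier [simp]: "tensor_prod b m A \<in> carrier_mat (b ^ m) (b ^ m)"
  by (simp add: tensor_prod_def)

lemma dim_tensor_prod [simp]:
  "dim_row (tensor_prod b m A) = b ^ m" "dim_col (tensor_prod b m A) = b ^ m"
  by (simp_all add: tensor_prod_def)

lemma tensor_prod_index: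
  "i < b ^ m \<Longrightarrow> j < b ^ m \<Longrightarrow>
     tensor_prod b m A $$ (i, j) = (\<Prod>t<m. A t $$ (digit b t i, digit b t j))"
  by (simp add: tensor_prod_def)

lemma tensor_prod_cong:
  "(\<And>t. t < m \<Longrightarrow> A t = B t) \<Longrightarrow> tensor_prod b m A = tensor_prod b m B"
  by (auto simp: tensor_prod_def intro!: cong_mat)

lemma tensor_prod_mult:
  assumes "b > 0" "\<And>t. t < m \<Longrightarrow> A t \<in> carrier_mat b b" "\<And>t. t < m \<Longrightarrow> B t \<in> carrier_mat b b"
  shows "tensor_prod b m A * tensor_prod b m B = tensor_prod b m (\<lambda>t. A t * B t)"
proof (rule eq_matI)
  fix i j assume "i < dim_row (tensor_prod b m (\<lambda>t. A t * B t))"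
    "j < dim_col (tensor_prod b m (\<lambda>t. A t * B t))"
  then have ij: "i < b ^ m" "j < b ^ m" by auto
  have "(tensor_prod b m A * tensor_prod b m B) $$ (i, j)
      = (\<Sum>l<b ^ m. \<Prod>t<m. A t $$ (digit b t i, digit b t l) * B t $$ (digit b t l, digit b t j))"
    using ij by (simp add: mult_mat_index[OF tensor_prod_carrier tensor_prod_carrier ij]
        tensor_prod_index prod.distrib)
  also have "\<dots> = (\<Prod>t<m. \<Sum>l<b. A t $$ (digit b t i, l) * B t $$ (l, digit b t j))"
    by (rule sum_prod_digits[OF assms(1)])
  also have "\<dots> = (\<Prod>t<m. (A t * B t) $$ (digit b t i, digit b t j))"
    using mult_mat_index[OF assms(2,3)] digit_less[OF assms(1)] by (intro prod.cong refl) auto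
  finally show "(tensor_prod b m A * tensor_prod b m B) $$ (i, j) = tensor_prod b m (\<lambda>t. A t * B t) $$ (i, j)"
    using ij by (simp add: tensor_prod_index)
qed auto

lemma tensor_prod_adjoint:
  fixes A :: "nat \<Rightarrow> complex mat"
  assumes "b > 0" "\<And>t. t < m \<Longrightarrow> A t \<in> carrier_mat b b"
  shows "mat_adjoint (tensor_prod b m A) = tensor_prod b m (\<lambda>t. mat_adjoint (A t))"
proof (rule eq_matI)
  fix i j assume "i < dim_row (tensor_prod b m (\<lambda>t. mat_adjoint (A t)))"
    "j < dim_col (tensor_prod b m (\<lambda>t. mat_adjoint (A t)))"
  then have ij: "i < b ^ m" "j < b ^ m" by auto
  show "mat_adjoint (tensor_prod b m A) $$ (i, j) = tensor_prod b m (\<lambda>t. mat_adjoint (A t)) $$ (i, j)"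
    using ij mat_adjoint_index[OF assms(2)] digit_less[OF assms(1)]
    by (simp add: mat_adjoint_index[OF tensor_prod_carrier] tensor_prod_index)
qed auto

lemma tensor_prod_one:
  assumes "b > 0"
  shows "tensor_prod b m (\<lambda>_. 1\<^sub>m b) = 1\<^sub>m (b ^ m)"
proof (rule eq_matI)
  fix i j assume "i < dim_row (1\<^sub>m (b ^ m) :: complex mat)" "j < dim_col (1\<^sub>m (b ^ m) :: complex mat)"
  then have ij: "i < b ^ m" "j < b ^ m" by auto
  have "(\<Prod>t<m. 1\<^sub>m b $$ (digit b t i, digit b t j) :: complex)
      = (\<Prod>t<m. if digit b t i = digit b t j then 1 else 0)"
    using digit_less[OF assms] by (intro prod.cong refl) auto
  also have "\<dots> = (if i = j then 1 else 0)"
    using digit_eqI[OF ij] by (auto simp: prod_zero_iff)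
  finally show "tensor_prod b m (\<lambda>_. 1\<^sub>m b) $$ (i, j) = (1\<^sub>m (b ^ m) :: complex mat) $$ (i, j)"
    using ij by (simp add: tensor_prod_index)
qed auto

lemma tensor_prod_smult:
  assumes "b > 0" "\<And>t. t < m \<Longrightarrow> A t \<in> carrier_mat b b"
  shows "tensor_prod b m (\<lambda>t. c t \<cdot>\<^sub>m A t) = (\<Prod>t<m. c t) \<cdot>\<^sub>m tensor_prod b m A"
proof (rule eq_matI)
  fix i j assume "i < dim_row ((\<Prod>t<m. c t) \<cdot>\<^sub>m tensor_prod b m A)"
    "j < dim_col ((\<Prod>t<m. c t) \<cdot>\<^sub>m tensor_prod b m A)"
  then have ij: "i < b ^ m" "j < b ^ m" by auto
  have "(c t \<cdot>\<^sub>m A t) $$ (digit b t i, digit b t j) = c t * A t $$ (digit b t i, digit b t j)"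
    if "t < m" for t
    using assms(2)[OF that] digit_less[OF assms(1)] by (subst index_smult_mat) auto
  then show "tensor_prod b m (\<lambda>t. c t \<cdot>\<^sub>m A t) $$ (i, j) = ((\<Prod>t<m. c t) \<cdot>\<^sub>m tensor_prod b m A) $$ (i, j)"
    using ij by (simp add: tensor_prod_index prod.distrib)
qed auto

section \<open>Commutation signs\<close>

text \<open>Every pair that does not commute receives -1, so this is a genuine exchange sign only
  for operators that either commute or anticommute, as Pauli operators do. It is real so that it can
  be averaged and compared.\<close>

definition com :: "complex mat \<Rightarrow> complex mat \<Rightarrow> real" where
  "com A B = (if A * B = B * A then 1 else - 1)"

lemma com_cases: "com A B = 1 \<or> com A B = - 1"
  by (simp add: com_def)

lemma smult_mat_one [simp]: "(1 :: complex) \<cdot>\<^sub>m A = A"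
  by (rule eq_matI) auto

lemma smult_smult_mat: "a \<cdot>\<^sub>m (b \<cdot>\<^sub>m A) = (a * b :: complex) \<cdot>\<^sub>m A"
  by (rule eq_matI) auto

text \<open>A product of involutions is invertible and, as d > 0, nonzero. So AB cannot equal both
  BA and -BA, and the exchange relation determines the sign.\<close>

lemma com_eqI:
  assumes "A \<in> carrier_mat d d" "B \<in> carrier_mat d d" "A * A = 1\<^sub>m d" "B * B = 1\<^sub>m d" "d > 0"
    and "\<sigma> = 1 \<or> \<sigma> = - 1" "A * B = complex_of_real \<sigma> \<cdot>\<^sub>m (B * A)"
  shows "com A B = \<sigma>"
proof (cases "\<sigma> = 1")
  case True
  then show ?thesis using assms(7) by (simp add: com_def)
next
  case False
  then have \<sigma>: "\<sigma> = - 1" using assms(6) by simp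
  have BA: "B * A \<in> carrier_mat d d" and AB: "A * B \<in> carrier_mat d d" using assms(1,2) by auto
  have "A * B \<noteq> B * A"
  proof
    assume eq: "A * B = B * A"
    have z: "B * A = 0\<^sub>m d d"
    proof (rule eq_matI)
      fix i j assume "i < dim_row (0\<^sub>m d d :: complex mat)" "j < dim_col (0\<^sub>m d d :: complex mat)"
      then have ij: "i < d" "j < d" by auto
      have "(B * A) $$ (i, j) = - (B * A) $$ (i, j)"
        using arg_cong[OF assms(7), of "\<lambda>M. M $$ (i, j)"] ij carrier_matD[OF assms(1)] carrier_matD[OF assms(2)]
        unfolding eq \<sigma> by simp
      then show "(B * A) $$ (i, j) = (0\<^sub>m d d :: complex mat) $$ (i, j)" using ij by simp
    qed (use BA in auto)
    have "A = B * (B * A)" unfolding assoc_mult_mat[OF assms(2,2,1), symmetric] assms(4) using assms(1) by simp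
    also have "\<dots> = 0\<^sub>m d d" unfolding z using assms(2) by simp
    finally have "1\<^sub>m d = (0\<^sub>m d d :: complex mat)" using assms(1,3) by simp
    then have "(1\<^sub>m d :: complex mat) $$ (0, 0) = 0\<^sub>m d d $$ (0, 0)" by simp
    then show False using assms(5) by simp
  qed
  then show ?thesis by (simp add: com_def \<sigma>)
qed

lemma com_smult:
  assumes "A \<in> carrier_mat d d" "B \<in> carrier_mat d d" "c \<noteq> 0"
  shows "com (c \<cdot>\<^sub>m A) B = com A B"
proof -
  have "(c \<cdot>\<^sub>m A) * B = c \<cdot>\<^sub>m (A * B)" "B * (c \<cdot>\<^sub>m A) = c \<cdot>\<^sub>m (B * A)"
    using assms by (auto simp: mult_smult_distrib[of B d d A d] mult_smult_assoc_mat[of A d d B d])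
  moreover have "c \<cdot>\<^sub>m (A * B) = c \<cdot>\<^sub>m (B * A) \<longleftrightarrow> A * B = B * A"
  proof
    assume "c \<cdot>\<^sub>m (A * B) = c \<cdot>\<^sub>m (B * A)"
    then have "inverse c \<cdot>\<^sub>m (c \<cdot>\<^sub>m (A * B)) = inverse c \<cdot>\<^sub>m (c \<cdot>\<^sub>m (B * A))" by simp
    then show "A * B = B * A" using assms(3) by (simp add: smult_smult_mat)
  qed simp
  ultimately show ?thesis by (simp add: com_def)
qed

lemma unitary_conj_conj_mult:
  assumes "unitary_mat d U" "A \<in> carrier_mat d d" "B \<in> carrier_mat d d"
  shows "(U * A * mat_adjoint U) * (U * B * mat_adjoint U) = U * (A * B) * mat_adjoint U"
proof -
  note U = unitary_matD[OF assms(1)]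
  note A = assms(2) and B = assms(3)
  have "(U * A * mat_adjoint U) * (U * B * mat_adjoint U) = U * A * (mat_adjoint U * (U * B * mat_adjoint U))"
    by (rule assoc_mult_mat[OF mult_carrier_mat[OF U(1) A] U(2) mult_carrier_mat[OF mult_carrier_mat[OF U(1) B] U(2)]])
  also have "\<dots> = U * A * (mat_adjoint U * (U * (B * mat_adjoint U)))"
    unfolding assoc_mult_mat[OF U(1) B U(2)] ..
  also have "mat_adjoint U * (U * (B * mat_adjoint U)) = mat_adjoint U * U * (B * mat_adjoint U)"
    by (rule assoc_mult_mat[OF U(2,1) mult_carrier_mat[OF B U(2)], symmetric])
  also have "\<dots> = B * mat_adjoint U"
    unfolding U(4) by (rule left_mult_one_mat[OF mult_carrier_mat[OF B U(2)]])
  also have "U * A * (B * mat_adjoint U) = U * A * B * mat_adjoint U"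
    by (rule assoc_mult_mat[OF mult_carrier_mat[OF U(1) A] B U(2), symmetric])
  also have "U * A * B = U * (A * B)"
    by (rule assoc_mult_mat[OF U(1) A B])
  finally show ?thesis .
qed

lemma unitary_conj_cancel:
  assumes "unitary_mat d U" "A \<in> carrier_mat d d"
  shows "mat_adjoint U * (U * A * mat_adjoint U) * U = A"
proof -
  note U = unitary_matD[OF assms(1)]
  note A = assms(2)
  have "mat_adjoint U * (U * A * mat_adjoint U) * U = mat_adjoint U * (U * A * mat_adjoint U * U)"
    by (rule assoc_mult_mat[OF U(2) mult_carrier_mat[OF mult_carrier_mat[OF U(1) A] U(2)] U(1)])
  also have "U * A * mat_adjoint U * U = U * A"
    unfolding assoc_mult_mat[OF mult_carrier_mat[OF U(1) A] U(2,1)] U(4)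
    by (rule right_mult_one_mat[OF mult_carrier_mat[OF U(1) A]])
  also have "mat_adjoint U * (U * A) = A"
    unfolding assoc_mult_mat[OF U(2,1) A, symmetric] U(4) by (rule left_mult_one_mat[OF A])
  finally show ?thesis .
qed

lemma unitary_conj_cancel':
  assumes "unitary_mat d U" "A \<in> carrier_mat d d"
  shows "U * (mat_adjoint U * A * U) * mat_adjoint U = A"
  using unitary_conj_cancel[OF unitary_mat_adjoint[OF assms(1)] assms(2)]
  by (simp add: mat_adjoint_adjoint[OF unitary_matD(1)[OF assms(1)]])

lemma com_unitary_conj:
  assumes "unitary_mat d U" "A \<in> carrier_mat d d" "B \<in> carrier_mat d d"
  shows "com (U * A * mat_adjoint U) (U * B * mat_adjoint U) = com A B"
proof -
  note U = unitary_matD[OF assms(1)]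
  have "U * (A * B) * mat_adjoint U = U * (B * A) * mat_adjoint U \<longleftrightarrow> A * B = B * A"
    using unitary_conj_cancel[OF assms(1)] assms(2,3) by (metis mult_carrier_mat)
  then show ?thesis
    unfolding com_def unitary_conj_conj_mult[OF assms] unitary_conj_conj_mult[OF assms(1,3,2)] by simp
qed

text \<open>The test measures U^\<dagger> Z_j U against Z_q, while the lightcone controls Z_j
  against U Z_q U^\<dagger>. Invariance of \<open>com\<close> under simultaneous conjugation
  translates one into the other.\<close>

lemma com_unitary_shift:
  assumes "unitary_mat d U" "A \<in> carrier_mat d d" "B \<in> carrier_mat d d"
  shows "com (mat_adjoint U * A * U) B = com A (U * B * mat_adjoint U)"
proof -
  note U = unitary_matD[OF assms(1)]
  have "com (mat_adjoint U * A * U) B = com (U * (mat_adjoint U * A * U) * mat_adjoint U) (U * B * mat_adjoint U)"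
    by (rule com_unitary_conj[symmetric]) (use assms U in auto)
  then show ?thesis by (simp add: unitary_conj_cancel'[OF assms(1,2)])
qed

section \<open>Pauli operators\<close>

abbreviation pauli_X :: "complex mat" where "pauli_X \<equiv> mat_of_rows_list 2 [[0, 1], [1, 0]]"
abbreviation pauli_Y :: "complex mat" where "pauli_Y \<equiv> mat_of_rows_list 2 [[0, - \<i>], [\<i>, 0]]"
abbreviation pauli_Z :: "complex mat" where "pauli_Z \<equiv> mat_of_rows_list 2 [[1, 0], [0, - 1]]"

lemma mat22_carrier [simp]: "mat_of_rows_list 2 [[a, b], [c, d]] \<in> carrier_mat 2 2"
  by (rule carrier_matI) (simp_all add: mat_of_rows_list_def)

lemma mat22_index:
  "mat_of_rows_list 2 [[a, b], [c, d]] $$ (0, 0) = a" "mat_of_rows_list 2 [[a, b], [c, d]] $$ (0, 1) = b"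
  "mat_of_rows_list 2 [[a, b], [c, d]] $$ (1, 0) = c" "mat_of_rows_list 2 [[a, b], [c, d]] $$ (1, 1) = d"
  by (simp_all add: mat_of_rows_list_def)

lemma mat22_eqI:
  assumes "A \<in> carrier_mat 2 2" "A $$ (0, 0) = a" "A $$ (0, 1) = b" "A $$ (1, 0) = c" "A $$ (1, 1) = d"
  shows "A = mat_of_rows_list 2 [[a, b], [c, d]]"
proof (rule eq_matI)
  fix i j assume "i < dim_row (mat_of_rows_list 2 [[a, b], [c, d]])"
    "j < dim_col (mat_of_rows_list 2 [[a, b], [c, d]])"
  then have "i < 2" "j < 2" by (simp_all add: mat_of_rows_list_def)
  then have "(i = 0 \<or> i = 1) \<and> (j = 0 \<or> j = 1)" by auto
  then show "A $$ (i, j) = mat_of_rows_list 2 [[a, b], [c, d]] $$ (i, j)"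
    using assms(2-) mat22_index[of a b c d] by metis
qed (use assms(1) in \<open>simp_all add: mat_of_rows_list_def\<close>)

lemma mat22_eq_iff:
  "mat_of_rows_list 2 [[a, b], [c, d]] = mat_of_rows_list 2 [[a', b'], [c', d']]
     \<longleftrightarrow> a = a' \<and> b = b' \<and> c = c' \<and> d = d'"
  using mat22_index[of a b c d] mat22_index[of a' b' c' d'] by metis

lemma mat22_mult:
  "mat_of_rows_list 2 [[a, b], [c, d]] * mat_of_rows_list 2 [[a', b'], [c', d']]
     = (mat_of_rows_list 2 [[a * a' + b * c', a * b' + b * d'], [c * a' + d * c', c * b' + d * d']] :: complex mat)"
  by (rule mat22_eqI)
     (simp_all add: mult_mat_index[OF mat22_carrier mat22_carrier] mat22_index numeral_2_eq_2[symmetric]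
        mult_carrier_mat[OF mat22_carrier mat22_carrier] sum.lessThan_Suc[of _ 1, simplified]
        mat22_index[unfolded One_nat_def] lessThan_nat_numeral)

lemma mat22_smult:
  "k \<cdot>\<^sub>m mat_of_rows_list 2 [[a, b], [c, d]]
     = (mat_of_rows_list 2 [[k * a, k * b], [k * c, k * d]] :: complex mat)"
  by (rule mat22_eqI, rule smult_carrier_mat[OF mat22_carrier]) (simp_all add: mat_of_rows_list_def)

lemma mat22_adjoint:
  "mat_adjoint (mat_of_rows_list 2 [[a, b], [c, d]])
     = (mat_of_rows_list 2 [[cnj a, cnj c], [cnj b, cnj d]] :: complex mat)"
  by (rule mat22_eqI) (simp_all add: mat_adjoint_index[OF mat22_carrier] mat22_index mat22_index[unfolded One_nat_def])

lemma mat22_one: "1\<^sub>m 2 = (mat_of_rows_list 2 [[1, 0], [0, 1]] :: complex mat)"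
  by (rule mat22_eqI) simp_all

text \<open>Reduces computations with 2 x 2 matrices to equations between entries, so that facts
  about single-qubit Pauli matrices become finite case checks.\<close>

lemmas mat22_simps = mat22_eq_iff mat22_mult mat22_smult mat22_adjoint mat22_one

lemma pauli_cases:
  assumes "A \<in> pauli_matrices"
  obtains "A = 1\<^sub>m 2" | "A = pauli_X" | "A = pauli_Y" | "A = pauli_Z"
  using assms by (auto simp: pauli_matrices_def)

lemma pauli_carrier: "A \<in> pauli_matrices \<Longrightarrow> A \<in> carrier_mat 2 2"
  by (erule pauli_cases) (simp_all add: mat22_carrier)

lemma pauli_square: "A \<in> pauli_matrices \<Longrightarrow> A * A = 1\<^sub>m 2"
  by (erule pauli_cases) (simp_all add: mat22_simps)

lemma pauli_hermitian: "A \<in> pauli_matrices \<Longrightarrow> mat_adjoint A = A"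
  by (erule pauli_cases) (simp_all add: mat22_simps del: mat_adjoint_one)

lemma pauli_com:
  assumes "A \<in> pauli_matrices" "B \<in> pauli_matrices"
  shows "A * B = complex_of_real (com A B) \<cdot>\<^sub>m (B * A)"
  using assms(1)
  by (rule pauli_cases; use assms(2) in \<open>rule pauli_cases\<close>) (simp_all add: com_def mat22_simps)

lemma pauli_mult_closed:
  assumes "A \<in> pauli_matrices" "B \<in> pauli_matrices"
  shows "\<exists>c\<in>{1, - 1, \<i>, - \<i>}. \<exists>C\<in>pauli_matrices. A * B = c \<cdot>\<^sub>m C"
  using assms(1)
  by (rule pauli_cases; use assms(2) in \<open>rule pauli_cases\<close>)
     (simp_all add: pauli_matrices_def mat22_simps)

text \<open>The inner double sum is tr (A A^T), which is 2 for the identity, X and Z, but -2 for Y;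
  the outer square removes this sign.\<close>

lemma pauli_sum_squares:
  assumes "A \<in> pauli_matrices"
  shows "(\<Sum>x<2. \<Sum>y<2. (A $$ (x, y))\<^sup>2)\<^sup>2 = 4"
  using assms
  by (rule pauli_cases)
     (simp_all add: mat22_one numeral_2_eq_2 mat_of_rows_list_def power2_eq_square)

lemma pauli_sum_com:
  assumes "A \<in> pauli_matrices"
  shows "(\<Sum>B\<in>pauli_matrices. com A B) = (if A = 1\<^sub>m 2 then 4 else 0)"
  using assms
  by (rule pauli_cases) (simp_all add: pauli_matrices_def com_def mat22_simps)

text \<open>X and Y each commute with one of the two matrices and anticommute with the other, which
  gives 0; Z anticommutes with both and gives -2.\<close>

lemma pauli_sum_com_XY:
  assumes "A \<in> pauli_matrices" "A \<noteq> 1\<^sub>m 2"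
  shows "(\<Sum>B\<in>{pauli_X, pauli_Y}. com A B) \<le> 0"
  using assms(1)
  by (rule pauli_cases) (use assms(2) in \<open>simp_all add: com_def mat22_simps\<close>)

lemma finite_pauli_matrices: "finite pauli_matrices"
  by (simp add: pauli_matrices_def)

lemma one_pauli: "1\<^sub>m 2 \<in> pauli_matrices"
  by (simp add: pauli_matrices_def)

section \<open>Pauli strings and the Pauli group\<close>

definition pauli_string :: "nat \<Rightarrow> (nat \<Rightarrow> complex mat) \<Rightarrow> bool" where
  "pauli_string n P \<longleftrightarrow> (\<forall>q<n. P q \<in> pauli_matrices)"

lemma pauli_stringD: "pauli_string n P \<Longrightarrow> q < n \<Longrightarrow> P q \<in> pauli_matrices"
  by (simp add: pauli_string_def)

lemma pauli_group_iff:
  "R \<in> pauli_group n \<longleftrightarrow>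
     (\<exists>c P. R = c \<cdot>\<^sub>m tensor_prod 2 n P \<and> c \<in> {1, - 1, \<i>, - \<i>} \<and> pauli_string n P)"
  by (auto simp: pauli_group_def pauli_string_def)

lemma tensor_prod_pauli_group: "pauli_string n P \<Longrightarrow> tensor_prod 2 n P \<in> pauli_group n"
  unfolding pauli_group_iff by (intro exI[of _ 1] exI[of _ P]) simp

lemma pauli_group_carrier: "R \<in> pauli_group n \<Longrightarrow> R \<in> carrier_mat (2 ^ n) (2 ^ n)"
  by (auto simp: pauli_group_iff)

lemma pauli_phase_mult:
  "c \<in> {1, - 1, \<i>, - \<i>} \<Longrightarrow> c' \<in> {1, - 1, \<i>, - \<i>} \<Longrightarrow> c * c' \<in> {1, - 1, \<i>, - \<i>}"
  by auto

lemma pauli_phase_prod: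
  "(\<And>t. t < (n::nat) \<Longrightarrow> c t \<in> {1, - 1, \<i>, - \<i>}) \<Longrightarrow> (\<Prod>t<n. c t) \<in> {1, - 1, \<i>, - \<i>}"
proof (induction n)
  case (Suc n)
  then show ?case using pauli_phase_mult[of "\<Prod>t<n. c t" "c n"] by simp
qed simp

lemma tensor_pauli_mult:
  assumes "pauli_string n P" "pauli_string n Q"
  shows "tensor_prod 2 n P * tensor_prod 2 n Q = tensor_prod 2 n (\<lambda>t. P t * Q t)"
  using assms by (intro tensor_prod_mult) (auto intro: pauli_carrier dest: pauli_stringD)

lemma tensor_pauli_square:
  assumes "pauli_string n P"
  shows "tensor_prod 2 n P * tensor_prod 2 n P = 1\<^sub>m (2 ^ n)"
proof -
  have "tensor_prod 2 n P * tensor_prod 2 n P = tensor_prod 2 n (\<lambda>_. 1\<^sub>m 2)"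
    unfolding tensor_pauli_mult[OF assms assms]
    by (intro tensor_prod_cong pauli_square pauli_stringD[OF assms])
  then show ?thesis by (simp add: tensor_prod_one)
qed

lemma tensor_pauli_hermitian:
  assumes "pauli_string n P"
  shows "mat_adjoint (tensor_prod 2 n P) = tensor_prod 2 n P"
proof -
  have "mat_adjoint (tensor_prod 2 n P) = tensor_prod 2 n (\<lambda>t. mat_adjoint (P t))"
    by (intro tensor_prod_adjoint) (auto intro: pauli_carrier pauli_stringD[OF assms])
  also have "\<dots> = tensor_prod 2 n P"
    by (intro tensor_prod_cong pauli_hermitian pauli_stringD[OF assms])
  finally show ?thesis .
qed

text \<open>Interchanging the factors qubit by qubit produces one sign per qubit. The product of
  these signs fulfils the exchange relation of two involutions, which identifies it with
  \<open>com\<close>.\<close>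

lemma tensor_pauli_com:
  assumes P: "pauli_string n P" and Q: "pauli_string n Q"
  shows "com (tensor_prod 2 n P) (tensor_prod 2 n Q) = (\<Prod>t<n. com (P t) (Q t))"
    and "tensor_prod 2 n P * tensor_prod 2 n Q
      = complex_of_real (com (tensor_prod 2 n P) (tensor_prod 2 n Q)) \<cdot>\<^sub>m (tensor_prod 2 n Q * tensor_prod 2 n P)"
proof -
  have "tensor_prod 2 n P * tensor_prod 2 n Q = tensor_prod 2 n (\<lambda>t. P t * Q t)"
    by (rule tensor_pauli_mult[OF P Q])
  also have "\<dots> = tensor_prod 2 n (\<lambda>t. complex_of_real (com (P t) (Q t)) \<cdot>\<^sub>m (Q t * P t))"
    by (intro tensor_prod_cong pauli_com pauli_stringD[OF P] pauli_stringD[OF Q])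
  also have "\<dots> = (\<Prod>t<n. complex_of_real (com (P t) (Q t))) \<cdot>\<^sub>m tensor_prod 2 n (\<lambda>t. Q t * P t)"
    by (intro tensor_prod_smult mult_carrier_mat[of _ 2 2])
       (auto intro: pauli_carrier pauli_stringD[OF P] pauli_stringD[OF Q])
  also have "tensor_prod 2 n (\<lambda>t. Q t * P t) = tensor_prod 2 n Q * tensor_prod 2 n P"
    by (rule tensor_pauli_mult[OF Q P, symmetric])
  finally have eq: "tensor_prod 2 n P * tensor_prod 2 n Q
      = complex_of_real (\<Prod>t<n. com (P t) (Q t)) \<cdot>\<^sub>m (tensor_prod 2 n Q * tensor_prod 2 n P)"
    by simp
  have "(\<Prod>t<n. com (P t) (Q t)) = 1 \<or> (\<Prod>t<n. com (P t) (Q t)) = - 1"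
    using com_cases by (induction n) (auto, metis+)
  from com_eqI[OF tensor_prod_carrier tensor_prod_carrier tensor_pauli_square[OF P] tensor_pauli_square[OF Q] _ this eq]
  show c: "com (tensor_prod 2 n P) (tensor_prod 2 n Q) = (\<Prod>t<n. com (P t) (Q t))" by simp
  show "tensor_prod 2 n P * tensor_prod 2 n Q
      = complex_of_real (com (tensor_prod 2 n P) (tensor_prod 2 n Q)) \<cdot>\<^sub>m (tensor_prod 2 n Q * tensor_prod 2 n P)"
    using eq unfolding c .
qed

lemma pauli_group_com:
  assumes "R \<in> pauli_group n" "pauli_string n Q"
  shows "R * tensor_prod 2 n Q = complex_of_real (com R (tensor_prod 2 n Q)) \<cdot>\<^sub>m (tensor_prod 2 n Q * R)"
proof -
  obtain c P where R: "R = c \<cdot>\<^sub>m tensor_prod 2 n P" and c: "c \<in> {1, - 1, \<i>, - \<i>}" and P: "pauli_string n P"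
    using assms(1) unfolding pauli_group_iff by blast
  have "c \<noteq> 0" using c by auto
  then have com: "com R (tensor_prod 2 n Q) = com (tensor_prod 2 n P) (tensor_prod 2 n Q)"
    unfolding R by (rule com_smult[OF tensor_prod_carrier tensor_prod_carrier])
  have "R * tensor_prod 2 n Q = c \<cdot>\<^sub>m (tensor_prod 2 n P * tensor_prod 2 n Q)"
    unfolding R by (rule mult_smult_assoc_mat[OF tensor_prod_carrier tensor_prod_carrier])
  also have "\<dots> = complex_of_real (com R (tensor_prod 2 n Q)) \<cdot>\<^sub>m (c \<cdot>\<^sub>m (tensor_prod 2 n Q * tensor_prod 2 n P))"
    unfolding com using tensor_pauli_com(2)[OF P assms(2)] by (simp add: smult_smult_mat mult.commute)
  also have "c \<cdot>\<^sub>m (tensor_prod 2 n Q * tensor_prod 2 n P) = tensor_prod 2 n Q * R"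
    unfolding R by (rule mult_smult_distrib[OF tensor_prod_carrier tensor_prod_carrier, symmetric])
  finally show ?thesis .
qed

lemma pauli_group_smult:
  assumes "R \<in> pauli_group n" "c \<in> {1, - 1, \<i>, - \<i>}"
  shows "c \<cdot>\<^sub>m R \<in> pauli_group n"
proof -
  obtain c' P where R: "R = c' \<cdot>\<^sub>m tensor_prod 2 n P" and c': "c' \<in> {1, - 1, \<i>, - \<i>}" and P: "pauli_string n P"
    using assms(1) unfolding pauli_group_iff by blast
  have "c \<cdot>\<^sub>m R = (c * c') \<cdot>\<^sub>m tensor_prod 2 n P" unfolding R smult_smult_mat ..
  with pauli_phase_mult[OF assms(2) c'] P show ?thesis unfolding pauli_group_iff by blast
qed

lemma pauli_group_mult:
  assumes "R \<in> pauli_group n" "S \<in> pauli_group n"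
  shows "R * S \<in> pauli_group n"
proof -
  obtain c P where R: "R = c \<cdot>\<^sub>m tensor_prod 2 n P" and c: "c \<in> {1, - 1, \<i>, - \<i>}" and P: "pauli_string n P"
    using assms(1) unfolding pauli_group_iff by blast
  obtain c' Q where S: "S = c' \<cdot>\<^sub>m tensor_prod 2 n Q" and c': "c' \<in> {1, - 1, \<i>, - \<i>}" and Q: "pauli_string n Q"
    using assms(2) unfolding pauli_group_iff by blast
  have "\<forall>t. \<exists>k C. t < n \<longrightarrow> k \<in> {1, - 1, \<i>, - \<i>} \<and> C \<in> pauli_matrices \<and> P t * Q t = k \<cdot>\<^sub>m C"
    using pauli_mult_closed[OF pauli_stringD[OF P] pauli_stringD[OF Q]] by blast
  then obtain k C where kC: "\<And>t. t < n \<Longrightarrow> k t \<in> {1, - 1, \<i>, - \<i>} \<and> C t \<in> pauli_matrices \<and> P t * Q t = k t \<cdot>\<^sub>m C t"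
    by metis
  have "R * S = (c * c') \<cdot>\<^sub>m (tensor_prod 2 n P * tensor_prod 2 n Q)"
    unfolding R S mult_smult_assoc_mat[OF tensor_prod_carrier smult_carrier_mat[OF tensor_prod_carrier]]
      mult_smult_distrib[OF tensor_prod_carrier tensor_prod_carrier] smult_smult_mat ..
  also have "tensor_prod 2 n P * tensor_prod 2 n Q = tensor_prod 2 n (\<lambda>t. k t \<cdot>\<^sub>m C t)"
    unfolding tensor_pauli_mult[OF P Q] using kC by (intro tensor_prod_cong) blast
  also have "\<dots> = (\<Prod>t<n. k t) \<cdot>\<^sub>m tensor_prod 2 n C"
    using kC by (intro tensor_prod_smult) (auto intro: pauli_carrier)
  also have "(c * c') \<cdot>\<^sub>m \<dots> \<in> pauli_group n"
    using kC by (intro pauli_group_smult tensor_prod_pauli_group pauli_phase_mult pauli_phase_prod c c')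
      (auto simp: pauli_string_def)
  finally show ?thesis .
qed

text \<open>The inner double sum is tr (R R^T), which factorises into the squared phase and a factor
  2 or -2 per qubit. Squaring removes all these signs at once; in the test state the second
  entangled pair does this.\<close>

lemma pauli_group_sum_squares:
  assumes "R \<in> pauli_group n"
  shows "(\<Sum>x<2 ^ n. \<Sum>y<2 ^ n. (R $$ (x, y))\<^sup>2)\<^sup>2 = (2 ^ n)\<^sup>2"
proof -
  obtain c P where R: "R = c \<cdot>\<^sub>m tensor_prod 2 n P" and c: "c \<in> {1, - 1, \<i>, - \<i>}" and P: "pauli_string n P"
    using assms unfolding pauli_group_iff by blast
  have "(\<Sum>x<2 ^ n. \<Sum>y<2 ^ n. (R $$ (x, y))\<^sup>2)
     = (\<Sum>x<2 ^ n. \<Sum>y<2 ^ n. c\<^sup>2 * (\<Prod>t<n. (P t $$ (digit 2 t x, digit 2 t y))\<^sup>2))"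
    by (intro sum.cong refl) (simp add: R tensor_prod_index power_mult_distrib prod_power_distrib)
  also have "\<dots> = c\<^sup>2 * (\<Sum>x<2 ^ n. \<Sum>y<2 ^ n. \<Prod>t<n. (P t $$ (digit 2 t x, digit 2 t y))\<^sup>2)"
    by (simp only: sum_distrib_left)
  also have "\<dots> = c\<^sup>2 * (\<Sum>x<2 ^ n. \<Prod>t<n. \<Sum>y<2. (P t $$ (digit 2 t x, y))\<^sup>2)"
    by (subst sum_prod_digits) auto
  also have "\<dots> = c\<^sup>2 * (\<Prod>t<n. \<Sum>x<2. \<Sum>y<2. (P t $$ (x, y))\<^sup>2)"
    by (subst sum_prod_digits[of 2 "\<lambda>t x. \<Sum>y<2. (P t $$ (x, y))\<^sup>2"]) auto
  finally have "(\<Sum>x<2 ^ n. \<Sum>y<2 ^ n. (R $$ (x, y))\<^sup>2)\<^sup>2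
     = c ^ 4 * (\<Prod>t<n. (\<Sum>x<2. \<Sum>y<2. (P t $$ (x, y))\<^sup>2)\<^sup>2)"
    by (simp add: power_mult_distrib prod_power_distrib)
  also have "(\<Prod>t<n. (\<Sum>x<2. \<Sum>y<2. (P t $$ (x, y))\<^sup>2)\<^sup>2) = (\<Prod>t<n. 4)"
    by (intro prod.cong refl pauli_sum_squares pauli_stringD[OF P]) simp
  also have "c ^ 4 * (\<Prod>t<n. 4) = ((2 ^ n)\<^sup>2 :: complex)"
    using c by (auto simp: power2_eq_square simp flip: power_mult_distrib)
  finally show ?thesis .
qed

definition single_site :: "nat \<Rightarrow> complex mat \<Rightarrow> nat \<Rightarrow> complex mat" where
  "single_site q A t = (if t = q then A else 1\<^sub>m 2)"

lemma single_site_string: "A \<in> pauli_matrices \<Longrightarrow> pauli_string n (single_site q A)"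
  by (simp add: pauli_string_def single_site_def one_pauli)

abbreviation site_Z :: "nat \<Rightarrow> nat \<Rightarrow> complex mat" where
  "site_Z n q \<equiv> tensor_prod 2 n (single_site q pauli_Z)"

abbreviation site_X :: "nat \<Rightarrow> nat \<Rightarrow> complex mat" where
  "site_X n q \<equiv> tensor_prod 2 n (single_site q pauli_X)"

lemma pauli_X [simp]: "pauli_X \<in> pauli_matrices" and pauli_Z [simp]: "pauli_Z \<in> pauli_matrices"
  and pauli_Y [simp]: "pauli_Y \<in> pauli_matrices"
  by (simp_all add: pauli_matrices_def)

lemma com_one: "A \<in> carrier_mat d d \<Longrightarrow> com (1\<^sub>m d) A = 1"
  by (simp add: com_def)

lemma com_single_site:
  assumes "pauli_string n P" "q < n" "A \<in> pauli_matrices"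
  shows "com (tensor_prod 2 n (single_site q A)) (tensor_prod 2 n P) = com A (P q)"
proof -
  have "com (tensor_prod 2 n (single_site q A)) (tensor_prod 2 n P) = (\<Prod>t<n. com (single_site q A t) (P t))"
    by (rule tensor_pauli_com(1)[OF single_site_string[OF assms(3)] assms(1)])
  also have "\<dots> = (\<Prod>t<n. if t = q then com A (P q) else 1)"
    using pauli_carrier[OF pauli_stringD[OF assms(1)]]
    by (intro prod.cong refl) (auto simp: single_site_def com_one)
  also have "\<dots> = com A (P q)" using assms(2) by simp
  finally show ?thesis .
qed

text \<open>The index set consists of the Pauli strings that anticommute with Z_q, and the sum
  factorises over the sites. A non-identity factor of P away from q meets all four Pauli matrices,
  two commuting and two anticommuting, and contributes 0. Otherwise P is nontrivial at q only, and
  the factor at q decides the sign.\<close>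

lemma sum_com_anticommuting_strings:
  assumes P: "pauli_string n P" and q: "q < n" and ne: "t < n" "P t \<noteq> 1\<^sub>m 2"
  shows "(\<Sum>Q\<in>PiE {..<n} (\<lambda>s. if s = q then {pauli_X, pauli_Y} else pauli_matrices).
           com (tensor_prod 2 n P) (tensor_prod 2 n Q)) \<le> 0"
proof -
  let ?S = "\<lambda>s. if s = q then {pauli_X, pauli_Y} else pauli_matrices"
  have str: "pauli_string n Q" if "Q \<in> PiE {..<n} ?S" for Q
    unfolding pauli_string_def
  proof (intro allI impI)
    fix s assume "s < n"
    then have "Q s \<in> ?S s" using PiE_mem[OF that, of s] by simp
    then show "Q s \<in> pauli_matrices"
      by (cases "s = q") (simp_all, elim disjE, simp_all only: pauli_X pauli_Y)
  qed
  have "(\<Sum>Q\<in>PiE {..<n} ?S. com (tensor_prod 2 n P) (tensor_prod 2 n Q))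
      = (\<Sum>Q\<in>PiE {..<n} ?S. \<Prod>s<n. com (P s) (Q s))"
    by (intro sum.cong refl tensor_pauli_com(1) P str)
  also have "\<dots> = (\<Prod>s<n. \<Sum>B\<in>?S s. com (P s) B)"
    by (rule prod_sum_PiE[symmetric]) (auto simp: finite_pauli_matrices)
  also have "\<dots> \<le> 0"
  proof (cases "\<exists>s<n. s \<noteq> q \<and> P s \<noteq> 1\<^sub>m 2")
    case True
    then obtain s where "s < n" "s \<noteq> q" "P s \<noteq> 1\<^sub>m 2" by blast
    then have "\<exists>s\<in>{..<n}. (\<Sum>B\<in>?S s. com (P s) B) = 0"
      using pauli_sum_com[OF pauli_stringD[OF P]] by (intro bexI[of _ s]) auto
    then show ?thesis by (simp add: prod_zero)
  next
    case False
    then have Pq: "P q \<noteq> 1\<^sub>m 2" using ne by metis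
    have "(\<Prod>s<n. \<Sum>B\<in>?S s. com (P s) B)
        = (\<Sum>B\<in>?S q. com (P q) B) * (\<Prod>s\<in>{..<n} - {q}. \<Sum>B\<in>?S s. com (P s) B)"
      using q by (subst prod.remove[of _ q]) auto
    also have "(\<Prod>s\<in>{..<n} - {q}. \<Sum>B\<in>?S s. com (P s) B) = (\<Prod>s\<in>{..<n} - {q}. 4)"
    proof (intro prod.cong refl)
      fix s assume "s \<in> {..<n} - {q}"
      then show "(\<Sum>B\<in>?S s. com (P s) B) = 4"
        using False pauli_sum_com[OF pauli_stringD[OF P], of s] by auto
    qed
    also have "(\<Sum>B\<in>?S q. com (P q) B) * (\<Prod>s\<in>{..<n} - {q}. 4) \<le> 0"
      using pauli_sum_com_XY[OF pauli_stringD[OF P q] Pq]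
      by (intro mult_nonpos_nonneg) (auto intro: prod_nonneg)
    finally show ?thesis .
  qed
  finally show ?thesis .
qed

section \<open>The Clifford group\<close>

lemma conj_mult:
  fixes P :: "complex mat"
  assumes U: "U \<in> carrier_mat d d" and V: "V \<in> carrier_mat d d" and P: "P \<in> carrier_mat d d"
  shows "(U * V) * P * mat_adjoint (U * V) = U * (V * P * mat_adjoint V) * mat_adjoint U"
proof -
  note U' = mat_adjoint_carrier[OF U] and V' = mat_adjoint_carrier[OF V]
  have "(U * V) * P * mat_adjoint (U * V) = U * (V * P * mat_adjoint V * mat_adjoint U)"
    using adjoint_conj_mult[OF P V' U']
    unfolding mat_adjoint_mult[OF V' U'] mat_adjoint_adjoint[OF U] mat_adjoint_adjoint[OF V]
      mat_adjoint_mult[OF U V] .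
  also have "\<dots> = U * (V * P * mat_adjoint V) * mat_adjoint U"
    by (rule assoc_mult_mat[OF U mult_carrier_mat[OF mult_carrier_mat[OF V P] V'] U', symmetric])
  finally show ?thesis .
qed

lemma conj_phase:
  fixes P :: "complex mat"
  assumes U: "U \<in> carrier_mat d d" and P: "P \<in> carrier_mat d d" and z: "cmod z = 1"
  shows "(z \<cdot>\<^sub>m U) * P * mat_adjoint (z \<cdot>\<^sub>m U) = U * P * mat_adjoint U"
    and "mat_adjoint (z \<cdot>\<^sub>m U) * P * (z \<cdot>\<^sub>m U) = mat_adjoint U * P * U"
proof -
  note U' = mat_adjoint_carrier[OF U]
  have zz: "z * cnj z = 1" "cnj z * z = 1" using z
    by (simp_all add: complex_norm_square[symmetric] mult.commute)
  show "(z \<cdot>\<^sub>m U) * P * mat_adjoint (z \<cdot>\<^sub>m U) = U * P * mat_adjoint U"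
    unfolding mat_adjoint_smult[OF U] mult_smult_assoc_mat[OF U P]
      mult_smult_assoc_mat[OF mult_carrier_mat[OF U P] smult_carrier_mat[OF U']]
      mult_smult_distrib[OF mult_carrier_mat[OF U P] U'] smult_smult_mat zz smult_mat_one ..
  show "mat_adjoint (z \<cdot>\<^sub>m U) * P * (z \<cdot>\<^sub>m U) = mat_adjoint U * P * U"
    unfolding mat_adjoint_smult[OF U] mult_smult_assoc_mat[OF U' P]
      mult_smult_assoc_mat[OF mult_carrier_mat[OF U' P] smult_carrier_mat[OF U]]
      mult_smult_distrib[OF mult_carrier_mat[OF U' P] U] smult_smult_mat zz smult_mat_one ..
qed

lemma clifford_groupD:
  assumes "U \<in> clifford_group n"
  shows "unitary_mat (2 ^ n) U"
    and "P \<in> pauli_group n \<Longrightarrow> U * P * mat_adjoint U \<in> pauli_group n"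
    and "P \<in> pauli_group n \<Longrightarrow> mat_adjoint U * P * U \<in> pauli_group n"
proof -
  show u: "unitary_mat (2 ^ n) U" using assms by (simp add: clifford_group_def)
  have im: "(\<lambda>P. U * P * mat_adjoint U) ` pauli_group n = pauli_group n"
    using assms by (simp add: clifford_group_def)
  then show "U * P * mat_adjoint U \<in> pauli_group n" if "P \<in> pauli_group n"
    using that by blast
  show "mat_adjoint U * P * U \<in> pauli_group n" if P: "P \<in> pauli_group n"
  proof -
    obtain Q where "Q \<in> pauli_group n" "P = U * Q * mat_adjoint U" using P im by blast
    then show ?thesis using unitary_conj_cancel[OF u pauli_group_carrier] by metis
  qed
qed

lemma clifford_carrier: "U \<in> clifford_group n \<Longrightarrow> U \<in> carrier_mat (2 ^ n) (2 ^ n)"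
  using clifford_groupD(1) unitary_matD(1) by blast

lemma clifford_group_mult:
  assumes "U \<in> clifford_group n" "V \<in> clifford_group n"
  shows "U * V \<in> clifford_group n"
proof -
  note u = clifford_carrier[OF assms(1)] and v = clifford_carrier[OF assms(2)]
  have "(\<lambda>P. (U * V) * P * mat_adjoint (U * V)) ` pauli_group n
      = (\<lambda>P. U * P * mat_adjoint U) ` (\<lambda>P. V * P * mat_adjoint V) ` pauli_group n"
    unfolding image_image by (intro image_cong refl conj_mult[OF u v pauli_group_carrier])
  also have "\<dots> = pauli_group n"
    using assms by (simp add: clifford_group_def)
  finally show ?thesis
    using unitary_mat_mult[OF clifford_groupD(1)[OF assms(1)] clifford_groupD(1)[OF assms(2)]]
    by (simp add: clifford_group_def)
qed

lemma clifford_group_phase: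
  assumes "U \<in> clifford_group n" "cmod z = 1"
  shows "z \<cdot>\<^sub>m U \<in> clifford_group n"
proof -
  note u = clifford_carrier[OF assms(1)] and uu = unitary_matD[OF clifford_groupD(1)[OF assms(1)]]
  have "(\<lambda>P. (z \<cdot>\<^sub>m U) * P * mat_adjoint (z \<cdot>\<^sub>m U)) ` pauli_group n = (\<lambda>P. U * P * mat_adjoint U) ` pauli_group n"
    by (intro image_cong refl conj_phase(1)[OF u pauli_group_carrier assms(2)])
  moreover have "unitary_mat (2 ^ n) (z \<cdot>\<^sub>m U)"
  proof (rule unitary_matI)
    have "mat_adjoint (z \<cdot>\<^sub>m U) * (z \<cdot>\<^sub>m U) = mat_adjoint (z \<cdot>\<^sub>m U) * 1\<^sub>m (2 ^ n) * (z \<cdot>\<^sub>m U)"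
      using u by (simp add: right_mult_one_mat[OF mat_adjoint_carrier[OF smult_carrier_mat[OF u]]])
    also have "\<dots> = mat_adjoint U * 1\<^sub>m (2 ^ n) * U"
      by (rule conj_phase(2)[OF u one_carrier_mat assms(2)])
    finally show "mat_adjoint (z \<cdot>\<^sub>m U) * (z \<cdot>\<^sub>m U) = 1\<^sub>m (2 ^ n)"
      unfolding right_mult_one_mat[OF uu(2)] uu(4) .
  qed (use u in simp)
  ultimately show ?thesis using assms(1) by (simp add: clifford_group_def)
qed

section \<open>Translation invariance of sums over phase classes\<close>

lemma equiv_phase_rel: "equiv (clifford_group n) (phase_rel n)"
proof (rule equivI)
  show "phase_rel n \<subseteq> clifford_group n \<times> clifford_group n" by (auto simp: phase_rel_def)
  show "refl_on (clifford_group n) (phase_rel n)"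
    by (auto simp: refl_on_def phase_rel_def intro!: exI[of _ 1])
  show "sym (phase_rel n)"
  proof (rule symI)
    fix U V assume "(U, V) \<in> phase_rel n"
    then obtain z where z: "U \<in> clifford_group n" "V \<in> clifford_group n" "cmod z = 1" "V = z \<cdot>\<^sub>m U"
      by (auto simp: phase_rel_def)
    then have "z \<noteq> 0" by auto
    then have "U = inverse z \<cdot>\<^sub>m V" using z(4) by (simp add: smult_smult_mat)
    moreover have "cmod (inverse z) = 1" using z(3) by (simp add: norm_inverse)
    ultimately show "(V, U) \<in> phase_rel n" using z(1,2) unfolding phase_rel_def by blast
  qed
  show "trans (phase_rel n)"
  proof (rule transI)
    fix U V W assume "(U, V) \<in> phase_rel n" "(V, W) \<in> phase_rel n"
    then obtain z w where "U \<in> clifford_group n" "W \<in> clifford_group n" "cmod z = 1" "V = z \<cdot>\<^sub>m U"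
      "cmod w = 1" "W = w \<cdot>\<^sub>m V"
      by (auto simp: phase_rel_def)
    then have "W = (w * z) \<cdot>\<^sub>m U" "cmod (w * z) = 1" by (simp_all add: smult_smult_mat norm_mult)
    then show "(U, W) \<in> phase_rel n"
      using \<open>U \<in> clifford_group n\<close> \<open>W \<in> clifford_group n\<close> unfolding phase_rel_def by blast
  qed
qed

lemma clifford_rep:
  assumes "K \<in> clifford_group n // phase_rel n"
  shows "(SOME U. U \<in> K) \<in> K" "(SOME U. U \<in> K) \<in> clifford_group n"
proof -
  have "K \<noteq> {}" using in_quotient_imp_non_empty[OF equiv_phase_rel assms] .
  then show *: "(SOME U. U \<in> K) \<in> K" by (simp add: some_in_eq)
  show "(SOME U. U \<in> K) \<in> clifford_group n"
    using in_quotient_imp_subset[OF equiv_phase_rel assms] * by blast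
qed

text \<open>Invariance of the Haar measure in its finite form: right multiplication by
  \<open>V\<close> permutes the phase classes and, as \<open>V\<close> is an involution, is its own
  inverse. The function must ignore phases because the representatives picked by \<open>SOME\<close>
  are not compatible with multiplication.\<close>

lemma clifford_quotient_sum_shift:
  fixes g :: "complex mat \<Rightarrow> real"
  assumes V: "V \<in> clifford_group n" "V * V = 1\<^sub>m (2 ^ n)"
    and g: "\<And>U z. U \<in> clifford_group n \<Longrightarrow> cmod z = 1 \<Longrightarrow> g (z \<cdot>\<^sub>m U) = g U"
  shows "(\<Sum>K\<in>clifford_group n // phase_rel n. g (SOME U. U \<in> K))
       = (\<Sum>K\<in>clifford_group n // phase_rel n. g ((SOME U. U \<in> K) * V))"
proof -
  let ?Q = "clifford_group n // phase_rel n" and ?\<phi> = "\<lambda>K. (\<lambda>U. U * V) ` K"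
  note v = clifford_carrier[OF V(1)]
  have sub: "K \<subseteq> clifford_group n" if "K \<in> ?Q" for K
    by (rule in_quotient_imp_subset[OF equiv_phase_rel that])
  have VV: "U * V * V = U" if "U \<in> clifford_group n" for U
    unfolding assoc_mult_mat[OF clifford_carrier[OF that] v v] V(2)
    by (rule right_mult_one_mat[OF clifford_carrier[OF that]])
  have maps: "?\<phi> K \<in> ?Q" if K: "K \<in> ?Q" for K
  proof -
    obtain U where U: "U \<in> clifford_group n" "K = phase_rel n `` {U}" using K by (auto elim: quotientE)
    note u = clifford_carrier[OF U(1)]
    have "?\<phi> K = phase_rel n `` {U * V}"
    proof (intro equalityI subsetI)
      fix W assume "W \<in> ?\<phi> K"
      then obtain z where "cmod z = 1" "W = (z \<cdot>\<^sub>m U) * V" "z \<cdot>\<^sub>m U \<in> clifford_group n"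
        unfolding U(2) phase_rel_def by auto
      moreover from this have "W \<in> clifford_group n" using clifford_group_mult[OF _ V(1)] by simp
      ultimately show "W \<in> phase_rel n `` {U * V}"
        using clifford_group_mult[OF U(1) V(1)] mult_smult_assoc_mat[OF u v]
        unfolding phase_rel_def by auto
    next
      fix W assume "W \<in> phase_rel n `` {U * V}"
      then obtain z where z: "cmod z = 1" "W = z \<cdot>\<^sub>m (U * V)" unfolding phase_rel_def by auto
      then have "W = (z \<cdot>\<^sub>m U) * V" using mult_smult_assoc_mat[OF u v] by simp
      moreover have "z \<cdot>\<^sub>m U \<in> K"
        using U(1) clifford_group_phase[OF U(1) z(1)] z(1) unfolding U(2) phase_rel_def by auto
      ultimately show "W \<in> ?\<phi> K" by blast
    qed
    then show ?thesis using quotientI[OF clifford_group_mult[OF U(1) V(1)]] by simp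
  qed
  have inv: "?\<phi> (?\<phi> K) = K" if "K \<in> ?Q" for K
  proof -
    have "?\<phi> (?\<phi> K) = (\<lambda>U. U) ` K"
      unfolding image_image using sub[OF that] VV by (intro image_cong refl) blast
    then show ?thesis by simp
  qed
  have "(\<Sum>K\<in>?Q. g (SOME U. U \<in> K)) = (\<Sum>K\<in>?Q. g (SOME U. U \<in> ?\<phi> K))"
    by (rule sum.reindex_bij_witness[of _ ?\<phi> ?\<phi>]) (simp_all add: maps inv)
  also have "\<dots> = (\<Sum>K\<in>?Q. g ((SOME U. U \<in> K) * V))"
  proof (rule sum.cong[OF refl])
    fix K assume K: "K \<in> ?Q"
    let ?U = "SOME U. U \<in> K"
    note U = clifford_rep[OF K]
    \<comment> \<open>The representative of the translated class has the form \<open>U' * V\<close>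
      with \<open>U'\<close> in \<open>K\<close>, and agrees with \<open>?U * V\<close> only up to a
      phase.\<close>
    obtain U' where U': "U' \<in> K" "(SOME U. U \<in> ?\<phi> K) = U' * V"
      using clifford_rep(1)[OF maps[OF K]] by blast
    have "(?U, U') \<in> phase_rel n"
      using quotient_eq_iff[OF equiv_phase_rel K K U(1) U'(1)] by simp
    then obtain z where z: "cmod z = 1" "U' = z \<cdot>\<^sub>m ?U" by (auto simp: phase_rel_def)
    have "U' * V = z \<cdot>\<^sub>m (?U * V)"
      unfolding z(2) by (rule mult_smult_assoc_mat[OF clifford_carrier[OF U(2)] v])
    then show "g (SOME U. U \<in> ?\<phi> K) = g (?U * V)"
      unfolding U'(2) using g[OF clifford_group_mult[OF U(2) V(1)] z(1)] by simp
  qed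
  finally show ?thesis .
qed

text \<open>For anticommuting Hermitian Pauli operators \<open>A\<close> and \<open>B\<close>, the operator \<open>(A + B) / \<surd>2\<close>
  generalises the Hadamard gate: it is a Clifford involution exchanging \<open>A\<close> and \<open>B\<close>.\<close>

lemma clifford_exchange:
  assumes P: "pauli_string n P" and Q: "pauli_string n Q"
    and anti: "com (tensor_prod 2 n P) (tensor_prod 2 n Q) = - 1"
  shows "\<exists>V\<in>clifford_group n. V * V = 1\<^sub>m (2 ^ n) \<and> V * tensor_prod 2 n P * mat_adjoint V = tensor_prod 2 n Q"
proof -
  define d where "d = (2 ^ n :: nat)"
  define A where "A = tensor_prod 2 n P"
  define B where "B = tensor_prod 2 n Q"
  have A: "A \<in> carrier_mat d d" and B: "B \<in> carrier_mat d d" by (simp_all add: A_def B_def d_def)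
  have AA: "A * A = 1\<^sub>m d" and BB: "B * B = 1\<^sub>m d"
    using tensor_pauli_square[OF P] tensor_pauli_square[OF Q] by (simp_all add: A_def B_def d_def)
  have AB: "A * B = (- 1) \<cdot>\<^sub>m (B * A)"
    using tensor_pauli_com(2)[OF P Q] unfolding anti by (simp add: A_def B_def)
  note c = A B mult_carrier_mat[OF A B] mult_carrier_mat[OF B A]
  define W where "W = A + B"
  have W: "W \<in> carrier_mat d d" using A B by (simp add: W_def)
  \<comment> \<open>The cross terms AB and BA cancel, so that dividing W by sqrt 2 gives an
    involution.\<close>
  have WW: "W * W = 2 \<cdot>\<^sub>m 1\<^sub>m d"
  proof -
    have "W * W = (A * A + A * B) + (B * A + B * B)"
      unfolding W_def add_mult_distrib_mat[OF A B add_carrier_mat[OF B]]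
        mult_add_distrib_mat[OF A A B] mult_add_distrib_mat[OF B A B] ..
    also have "\<dots> = 2 \<cdot>\<^sub>m 1\<^sub>m d"
      unfolding AA BB AB using c by (intro eq_matI) auto
    finally show ?thesis .
  qed
  have WD: "W * (A - B) = 2 \<cdot>\<^sub>m (B * A)"
  proof -
    have "W * (A - B) = (A * A - A * B) + (B * A - B * B)"
      unfolding W_def add_mult_distrib_mat[OF A B minus_carrier_mat[OF B]]
        mult_minus_distrib_mat[OF A A B] mult_minus_distrib_mat[OF B A B] ..
    also have "\<dots> = 2 \<cdot>\<^sub>m (B * A)"
      unfolding AA BB AB using c by (intro eq_matI) auto
    finally show ?thesis .
  qed
  define s where "s = complex_of_real (1 / sqrt 2)"
  have ss: "s * s = 1 / 2" "s * s * 2 = 1"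
    by (simp_all add: s_def flip: of_real_mult)
  define V where "V = s \<cdot>\<^sub>m W"
  have V: "V \<in> carrier_mat d d" using W by (simp add: V_def)
  have Vadj: "mat_adjoint V = V"
  proof -
    have "mat_adjoint A = A" "mat_adjoint B = B"
      using tensor_pauli_hermitian[OF P] tensor_pauli_hermitian[OF Q] by (simp_all add: A_def B_def)
    then have h: "cnj (A $$ (j, i)) = A $$ (i, j)" "cnj (B $$ (j, i)) = B $$ (i, j)" if "i < d" "j < d" for i j
      using mat_adjoint_index[OF A that] mat_adjoint_index[OF B that] by simp_all
    show ?thesis
    proof (rule eq_matI)
      fix i j assume "i < dim_row V" "j < dim_col V"
      then have ij: "i < d" "j < d" using V by auto
      show "mat_adjoint V $$ (i, j) = V $$ (i, j)"
        unfolding mat_adjoint_index[OF V ij] using ij A B by (simp add: V_def W_def s_def h)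
    qed (use V in auto)
  qed
  have conj: "V * R * mat_adjoint V = (s * s) \<cdot>\<^sub>m (W * (R * W))" if R: "R \<in> carrier_mat d d" for R
  proof -
    have "V * R * mat_adjoint V = (s * s) \<cdot>\<^sub>m (W * R * W)"
      unfolding Vadj unfolding V_def mult_smult_assoc_mat[OF W R]
        mult_smult_assoc_mat[OF mult_carrier_mat[OF W R] smult_carrier_mat[OF W]]
        mult_smult_distrib[OF mult_carrier_mat[OF W R] W] smult_smult_mat ..
    then show ?thesis unfolding assoc_mult_mat[OF W R W] .
  qed
  have VV: "V * V = 1\<^sub>m d"
  proof -
    have "V * V = (s * s) \<cdot>\<^sub>m (W * W)"
      unfolding V_def mult_smult_assoc_mat[OF W smult_carrier_mat[OF W]]
        mult_smult_distrib[OF W W] smult_smult_mat ..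
    then show ?thesis unfolding WW smult_smult_mat ss(2) smult_mat_one .
  qed
  have uV: "unitary_mat d V" using V VV Vadj by (simp add: unitary_mat_def)
  \<comment> \<open>When R has the same sign against A and B, it passes through W as a whole, and W
    W = 2 finishes the computation.\<close>
  have same: "V * R * mat_adjoint V = k \<cdot>\<^sub>m R"
    if R: "R \<in> carrier_mat d d" and "R * A = k \<cdot>\<^sub>m (A * R)" "R * B = k \<cdot>\<^sub>m (B * R)" for R k
  proof -
    have "R * W = k \<cdot>\<^sub>m (A * R) + k \<cdot>\<^sub>m (B * R)"
      unfolding W_def mult_add_distrib_mat[OF R A B] that(2,3) ..
    also have "\<dots> = k \<cdot>\<^sub>m (W * R)"
      unfolding W_def add_mult_distrib_mat[OF A B R]
      by (rule add_smult_distrib_left_mat[OF mult_carrier_mat[OF A R] mult_carrier_mat[OF B R], symmetric])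
    finally have RW: "R * W = k \<cdot>\<^sub>m (W * R)" .
    have "W * (R * W) = (k * 2) \<cdot>\<^sub>m R"
      unfolding RW mult_smult_distrib[OF W mult_carrier_mat[OF W R]] assoc_mult_mat[OF W W R, symmetric]
        WW mult_smult_assoc_mat[OF one_carrier_mat R] left_mult_one_mat[OF R] smult_smult_mat ..
    then show ?thesis unfolding conj[OF R] using ss by (simp add: smult_smult_mat algebra_simps)
  qed
  \<comment> \<open>When R has opposite signs against A and B, moving it through W turns A + B into
    A - B. By \<open>WD\<close> the result is a sign times BAR, which is a Pauli operator if R is
    one.\<close>
  have opp: "V * R * mat_adjoint V = k \<cdot>\<^sub>m (B * A * R)"
    if R: "R \<in> carrier_mat d d" and "R * A = k \<cdot>\<^sub>m (A * R)" "R * B = (- k) \<cdot>\<^sub>m (B * R)" for R k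
  proof -
    have "R * W = k \<cdot>\<^sub>m (A * R) + (- k) \<cdot>\<^sub>m (B * R)"
      unfolding W_def mult_add_distrib_mat[OF R A B] that(2,3) ..
    also have "\<dots> = k \<cdot>\<^sub>m (A * R - B * R)"
      using A B R by (intro eq_matI) (auto simp: right_diff_distrib)
    also have "A * R - B * R = (A - B) * R"
      by (rule minus_mult_distrib_mat[OF A B R, symmetric])
    finally have RW: "R * W = k \<cdot>\<^sub>m ((A - B) * R)" .
    note AmB = minus_carrier_mat[OF B, of A]
    have "W * (R * W) = (k * 2) \<cdot>\<^sub>m (B * A * R)"
      unfolding RW mult_smult_distrib[OF W mult_carrier_mat[OF AmB R]] assoc_mult_mat[OF W AmB R, symmetric]
        WD mult_smult_assoc_mat[OF mult_carrier_mat[OF B A] R] smult_smult_mat ..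
    then show ?thesis unfolding conj[OF R] using ss by (simp add: smult_smult_mat algebra_simps)
  qed
  have in_group: "V * R * mat_adjoint V \<in> pauli_group n" if R: "R \<in> pauli_group n" for R
  proof -
    have Rc: "R \<in> carrier_mat d d" using pauli_group_carrier[OF R] by (simp add: d_def)
    have Ag: "A \<in> pauli_group n" and Bg: "B \<in> pauli_group n"
      using tensor_prod_pauli_group P Q by (auto simp: A_def B_def)
    define \<alpha> \<beta> where "\<alpha> = com R A" and "\<beta> = com R B"
    have RA: "R * A = complex_of_real \<alpha> \<cdot>\<^sub>m (A * R)" and RB: "R * B = complex_of_real \<beta> \<cdot>\<^sub>m (B * R)"
      using pauli_group_com[OF R P] pauli_group_com[OF R Q] by (simp_all add: \<alpha>_def \<beta>_def A_def B_def)
    have \<alpha>: "\<alpha> = 1 \<or> \<alpha> = - 1" and \<beta>: "\<beta> = 1 \<or> \<beta> = - 1"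
      using com_cases by (auto simp: \<alpha>_def \<beta>_def)
    have ph: "complex_of_real \<alpha> \<in> {1, - 1, \<i>, - \<i>}" using \<alpha> by auto
    show ?thesis
    proof (cases "\<beta> = \<alpha>")
      case True
      then show ?thesis using same[OF Rc RA] RB pauli_group_smult[OF R ph] by simp
    next
      case False
      then have "\<beta> = - \<alpha>" using \<alpha> \<beta> by auto
      then show ?thesis
        using opp[OF Rc RA] RB pauli_group_smult[OF pauli_group_mult[OF pauli_group_mult[OF Bg Ag] R] ph] by simp
    qed
  qed
  \<comment> \<open>Conjugation by an involution is its own inverse, so mapping the Pauli group into
    itself already means mapping it onto itself.\<close>
  have "(\<lambda>P. V * P * mat_adjoint V) ` pauli_group n = pauli_group n"
  proof (intro equalityI subsetI)
    fix R assume R: "R \<in> pauli_group n"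
    then have "V * (V * R * mat_adjoint V) * mat_adjoint V = R"
      using unitary_conj_cancel[OF uV] pauli_group_carrier[OF R] by (simp add: Vadj d_def)
    then show "R \<in> (\<lambda>P. V * P * mat_adjoint V) ` pauli_group n"
      using in_group[OF R] by (metis image_eqI)
  qed (use in_group in blast)
  then have "V \<in> clifford_group n" using uV by (simp add: clifford_group_def d_def)
  \<comment> \<open>The operator \<open>A\<close> commutes with itself and anticommutes with
    \<open>B\<close>, so \<open>opp\<close> applies with k = 1 and yields B A A = B.\<close>
  moreover have "V * A * mat_adjoint V = B"
  proof -
    have "A * B = (- 1) \<cdot>\<^sub>m (B * A)" by (rule AB)
    then have "V * A * mat_adjoint V = 1 \<cdot>\<^sub>m (B * A * A)"
      by (intro opp[OF A]) simp_all
    also have "B * A * A = B" unfolding assoc_mult_mat[OF B A A] AA by (rule right_mult_one_mat[OF B])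
    finally show ?thesis by simp
  qed
  ultimately show ?thesis using VV unfolding A_def B_def d_def by blast
qed

lemma com_conj_phase:
  assumes "U \<in> clifford_group n" "cmod z = 1" "A \<in> carrier_mat (2 ^ n) (2 ^ n)"
  shows "com (mat_adjoint (z \<cdot>\<^sub>m U) * A * (z \<cdot>\<^sub>m U)) B = com (mat_adjoint U * A * U) B"
  unfolding conj_phase(2)[OF clifford_carrier[OF assms(1)] assms(3,2)] ..

text \<open>Translation by a Clifford operator that exchanges Z_q with an anticommuting string Q
  does not change the sum. Summing over all such Q therefore multiplies it by their number, and
  after interchanging the sums the inner sum over Q is nonpositive for each single U.\<close>

lemma clifford_sum_com_nonpos:
  assumes q: "q < n" and j: "j < n"
  shows "(\<Sum>K\<in>clifford_group n // phase_rel n.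
            com (mat_adjoint (SOME U. U \<in> K) * site_Z n j * (SOME U. U \<in> K)) (site_Z n q)) \<le> 0"
proof -
  let ?G = "clifford_group n // phase_rel n"
  let ?rep = "\<lambda>K :: complex mat set. SOME U. U \<in> K"
  let ?R = "\<lambda>U. mat_adjoint U * site_Z n j * U"
  let ?S = "PiE {..<n} (\<lambda>s. if s = q then {pauli_X, pauli_Y} else pauli_matrices)"
  have Zj: "site_Z n j \<in> pauli_group n"
    by (intro tensor_prod_pauli_group single_site_string) simp
  have str: "pauli_string n Q" and Qq: "Q q \<in> {pauli_X, pauli_Y}" if "Q \<in> ?S" for Q
  proof -
    show "Q q \<in> {pauli_X, pauli_Y}" using PiE_mem[OF that, of q] q by simp
    show "pauli_string n Q" unfolding pauli_string_def
    proof (intro allI impI)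
      fix s assume "s < n"
      then have "Q s \<in> (if s = q then {pauli_X, pauli_Y} else pauli_matrices)"
        using PiE_mem[OF that, of s] by simp
      then show "Q s \<in> pauli_matrices"
        by (cases "s = q") (simp_all, elim disjE, simp_all only: pauli_X pauli_Y)
    qed
  qed
  have shift: "(\<Sum>K\<in>?G. com (?R (?rep K)) (site_Z n q)) = (\<Sum>K\<in>?G. com (?R (?rep K)) (tensor_prod 2 n Q))"
    if Q: "Q \<in> ?S" for Q
  proof -
    have "com (site_Z n q) (tensor_prod 2 n Q) = com pauli_Z (Q q)"
      by (rule com_single_site[OF str[OF Q] q]) simp
    also have "\<dots> = - 1" using Qq[OF Q] by (auto simp: com_def mat22_simps)
    finally obtain V where V: "V \<in> clifford_group n" "V * V = 1\<^sub>m (2 ^ n)"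
      "V * site_Z n q * mat_adjoint V = tensor_prod 2 n Q"
      using clifford_exchange[OF single_site_string str[OF Q]] pauli_Z by metis
    have "(\<Sum>K\<in>?G. com (?R (?rep K)) (site_Z n q)) = (\<Sum>K\<in>?G. com (?R (?rep K * V)) (site_Z n q))"
      by (rule clifford_quotient_sum_shift[OF V(1,2)]) (rule com_conj_phase, auto)
    also have "\<dots> = (\<Sum>K\<in>?G. com (?R (?rep K)) (tensor_prod 2 n Q))"
    proof (rule sum.cong[OF refl])
      fix K assume K: "K \<in> ?G"
      let ?U = "?rep K"
      note u = clifford_carrier[OF clifford_rep(2)[OF K]] and v = clifford_carrier[OF V(1)]
      have R: "?R ?U \<in> carrier_mat (2 ^ n) (2 ^ n)"
        by (intro mult_carrier_mat[OF mult_carrier_mat[OF mat_adjoint_carrier[OF u] tensor_prod_carrier] u])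
      have "?R (?U * V) = mat_adjoint V * (?R ?U * V)"
        by (rule adjoint_conj_mult[OF tensor_prod_carrier u v])
      also have "\<dots> = mat_adjoint V * ?R ?U * V"
        by (rule assoc_mult_mat[OF mat_adjoint_carrier[OF v] R v, symmetric])
      finally have "com (?R (?U * V)) (site_Z n q) = com (?R ?U) (V * site_Z n q * mat_adjoint V)"
        using com_unitary_shift[OF clifford_groupD(1)[OF V(1)] R tensor_prod_carrier] by simp
      then show "com (?R (?U * V)) (site_Z n q) = com (?R ?U) (tensor_prod 2 n Q)" unfolding V(3) .
    qed
    finally show ?thesis .
  qed
  have neg: "(\<Sum>Q\<in>?S. com (?R U) (tensor_prod 2 n Q)) \<le> 0" if U: "U \<in> clifford_group n" for U
  proof -
    have R: "?R U \<in> pauli_group n" by (rule clifford_groupD(3)[OF U Zj])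
    then obtain c P where cP: "?R U = c \<cdot>\<^sub>m tensor_prod 2 n P" "c \<in> {1, - 1, \<i>, - \<i>}" "pauli_string n P"
      unfolding pauli_group_iff by blast
    have c0: "c \<noteq> 0" using cP(2) by auto
    have cR: "com (?R U) B = com (tensor_prod 2 n P) B" if "B \<in> carrier_mat (2 ^ n) (2 ^ n)" for B
      unfolding cP(1) by (rule com_smult[OF tensor_prod_carrier that c0])
    \<comment> \<open>U^\<dagger> Z_j U is not a multiple of the identity because it anticommutes
      with U^\<dagger> X_j U.\<close>
    have "\<exists>t<n. P t \<noteq> 1\<^sub>m 2"
    proof (rule ccontr)
      assume "\<not> (\<exists>t<n. P t \<noteq> 1\<^sub>m 2)"
      then have "tensor_prod 2 n P = tensor_prod 2 n (\<lambda>_. 1\<^sub>m 2)" by (intro tensor_prod_cong) auto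
      then have one: "tensor_prod 2 n P = 1\<^sub>m (2 ^ n)" by (simp add: tensor_prod_one)
      let ?X = "mat_adjoint U * site_X n j * U"
      note uu = clifford_groupD(1)[OF U]
      note u = unitary_matD[OF uu]
      have X: "?X \<in> carrier_mat (2 ^ n) (2 ^ n)"
        by (intro mult_carrier_mat[OF mult_carrier_mat[OF u(2) tensor_prod_carrier] u(1)])
      have "com (?R U) ?X = com (site_Z n j) (site_X n j)"
        using com_unitary_shift[OF uu tensor_prod_carrier X]
        unfolding unitary_conj_cancel'[OF uu tensor_prod_carrier] .
      also have "\<dots> = com pauli_Z (single_site j pauli_X j)"
        by (rule com_single_site[OF single_site_string j]) simp_all
      also have "\<dots> = - 1" by (simp add: single_site_def com_def mat22_simps)
      finally show False using cR[OF X] com_one[OF X] unfolding one by simp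
    qed
    then obtain t where "t < n" "P t \<noteq> 1\<^sub>m 2" by blast
    from sum_com_anticommuting_strings[OF cP(3) q this] show ?thesis
      by (simp add: cR)
  qed
  have fin: "finite ?S" by (intro finite_PiE) (auto simp: finite_pauli_matrices)
  have "?S \<noteq> {}" by (auto simp: PiE_eq_empty_iff pauli_matrices_def split: if_splits)
  then have card: "real (card ?S) > 0" using fin by (simp add: card_gt_0_iff)
  have "real (card ?S) * (\<Sum>K\<in>?G. com (?R (?rep K)) (site_Z n q))
      = (\<Sum>Q\<in>?S. \<Sum>K\<in>?G. com (?R (?rep K)) (site_Z n q))"
    by (rule sum_constant[symmetric])
  also have "\<dots> = (\<Sum>Q\<in>?S. \<Sum>K\<in>?G. com (?R (?rep K)) (tensor_prod 2 n Q))"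
    by (intro sum.cong[OF refl] shift)
  also have "\<dots> = (\<Sum>K\<in>?G. \<Sum>Q\<in>?S. com (?R (?rep K)) (tensor_prod 2 n Q))"
    by (rule sum.swap)
  also have "\<dots> \<le> 0"
    by (rule sum_nonpos, rule neg, erule clifford_rep(2))
  finally have "real (card ?S) * (\<Sum>K\<in>?G. com (?R (?rep K)) (site_Z n q)) \<le> real (card ?S) * 0"
    by (simp only: mult_zero_right)
  then show ?thesis by (simp only: mult_le_cancel_left_pos[OF card])
qed

section \<open>Lightcones\<close>

lemma digits_exist:
  assumes "\<And>t. t < m \<Longrightarrow> f t < b"
  shows "\<exists>x<b ^ m. \<forall>t<m. digit b t x = f t"
  using assms
proof (induction m)
  case (Suc m)
  then obtain x where x: "x < b ^ m" "\<And>t. t < m \<Longrightarrow> digit b t x = f t" by force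
  have fm: "f m < b" using Suc.prems by simp
  then have "x + f m * b ^ m < b ^ m + f m * b ^ m" using x(1) by simp
  also have "\<dots> = Suc (f m) * b ^ m" by simp
  also have "\<dots> \<le> b * b ^ m" using fm by (intro mult_right_mono) auto
  finally have "x + f m * b ^ m < b ^ Suc m" by simp
  moreover have "digit b t (x + f m * b ^ m) = f t" if "t < Suc m" for t
    using that x fm digit_add_low[of t m b x "f m"] digit_add_top[OF x(1) fm] by (cases "t = m") auto
  ultimately show ?case by blast
qed simp

text \<open>In the sum over intermediate basis states only one term survives: the state with the
  bits of y on S and those of x elsewhere. The resulting formula is symmetric in the two operators,
  which is how commutation follows.\<close>

lemma acts_on_mult_disjoint:
  assumes A: "A \<in> carrier_mat (2 ^ n) (2 ^ n)"
    and wA: "\<And>x y. x < 2 ^ n \<Longrightarrow> y < 2 ^ n \<Longrightarrow> A $$ (x, y) =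
          (if \<forall>q\<in>{..<n} - S. digit 2 q x = digit 2 q y
           then w {q\<in>S. digit 2 q x = 1} {q\<in>S. digit 2 q y = 1} else 0)"
    and B: "B \<in> carrier_mat (2 ^ n) (2 ^ n)"
    and wB: "\<And>x y. x < 2 ^ n \<Longrightarrow> y < 2 ^ n \<Longrightarrow> B $$ (x, y) =
          (if \<forall>q\<in>{..<n} - T. digit 2 q x = digit 2 q y
           then v {q\<in>T. digit 2 q x = 1} {q\<in>T. digit 2 q y = 1} else 0)"
    and ST: "S \<subseteq> {..<n}" "T \<subseteq> {..<n}" "S \<inter> T = {}"
    and xy: "x < 2 ^ n" "y < 2 ^ n"
  shows "(A * B) $$ (x, y) = (if \<forall>q\<in>{..<n} - (S \<union> T). digit 2 q x = digit 2 q y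
           then w {q\<in>S. digit 2 q x = 1} {q\<in>S. digit 2 q y = 1} *
                v {q\<in>T. digit 2 q x = 1} {q\<in>T. digit 2 q y = 1} else 0)"
proof -
  have "\<exists>l<2 ^ n. \<forall>q<n. digit 2 q l = (if q \<in> S then digit 2 q y else digit 2 q x)"
    by (rule digits_exist) (simp add: digit_less)
  then obtain l where l: "l < 2 ^ n" "\<And>q. q < n \<Longrightarrow> digit 2 q l = (if q \<in> S then digit 2 q y else digit 2 q x)"
    by blast
  have z: "A $$ (x, m) * B $$ (m, y) = 0" if "m < 2 ^ n" "m \<noteq> l" for m
  proof (rule ccontr)
    assume "A $$ (x, m) * B $$ (m, y) \<noteq> 0"
    then have "\<forall>q\<in>{..<n} - S. digit 2 q x = digit 2 q m" "\<forall>q\<in>{..<n} - T. digit 2 q m = digit 2 q y"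
      using wA[OF xy(1) that(1)] wB[OF that(1) xy(2)] by (auto split: if_splits)
    then have "digit 2 q m = digit 2 q l" if "q < n" for q
      using l(2)[OF that] that ST(3) by (cases "q \<in> S") auto
    then show False using digit_eqI[OF that(1) l(1)] that(2) by blast
  qed
  have "(A * B) $$ (x, y) = (\<Sum>m<2 ^ n. A $$ (x, m) * B $$ (m, y))"
    by (rule mult_mat_index[OF A B xy])
  also have "\<dots> = (\<Sum>m\<in>{l}. A $$ (x, m) * B $$ (m, y))"
    using z l(1) by (intro sum.mono_neutral_right) auto
  also have "\<dots> = A $$ (x, l) * B $$ (l, y)" by simp
  also have "A $$ (x, l) = w {q\<in>S. digit 2 q x = 1} {q\<in>S. digit 2 q y = 1}"
  proof -
    have "{q\<in>S. digit 2 q l = 1} = {q\<in>S. digit 2 q y = 1}" using l(2) ST(1) by auto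
    moreover have "\<forall>q\<in>{..<n} - S. digit 2 q x = digit 2 q l" using l(2) by auto
    ultimately show ?thesis using wA[OF xy(1) l(1)] by simp
  qed
  also have "B $$ (l, y) = (if \<forall>q\<in>{..<n} - (S \<union> T). digit 2 q x = digit 2 q y
     then v {q\<in>T. digit 2 q x = 1} {q\<in>T. digit 2 q y = 1} else 0)"
  proof -
    have "digit 2 q l = digit 2 q x" if "q \<in> T" for q
    proof -
      have "q < n" "q \<notin> S" using that ST by auto
      then show ?thesis using l(2) by simp
    qed
    then have "{q\<in>T. digit 2 q l = 1} = {q\<in>T. digit 2 q x = 1}" by auto
    moreover have "(\<forall>q\<in>{..<n} - T. digit 2 q l = digit 2 q y) \<longleftrightarrow> (\<forall>q\<in>{..<n} - (S \<union> T). digit 2 q x = digit 2 q y)"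
      using l(2) by auto
    ultimately show ?thesis using wB[OF l(1) xy(2)] by simp
  qed
  finally show ?thesis by simp
qed

lemma acts_on_disjoint_commute:
  assumes A: "acts_on n S A" and B: "acts_on n T B"
    and ST: "S \<subseteq> {..<n}" "T \<subseteq> {..<n}" "S \<inter> T = {}"
  shows "A * B = B * A"
proof -
  note c = A[unfolded acts_on_def, THEN conjunct1] B[unfolded acts_on_def, THEN conjunct1]
  obtain w where w: "\<And>x y. x < 2 ^ n \<Longrightarrow> y < 2 ^ n \<Longrightarrow> A $$ (x, y) =
          (if \<forall>q\<in>{..<n} - S. digit 2 q x = digit 2 q y
           then w {q\<in>S. digit 2 q x = 1} {q\<in>S. digit 2 q y = 1} else 0)"
    using A unfolding acts_on_def by blast
  obtain v where v: "\<And>x y. x < 2 ^ n \<Longrightarrow> y < 2 ^ n \<Longrightarrow> B $$ (x, y) =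
          (if \<forall>q\<in>{..<n} - T. digit 2 q x = digit 2 q y
           then v {q\<in>T. digit 2 q x = 1} {q\<in>T. digit 2 q y = 1} else 0)"
    using B unfolding acts_on_def by blast
  have TS: "T \<inter> S = {}" using ST(3) by blast
  show ?thesis
  proof (rule eq_matI)
    fix x y assume "x < dim_row (B * A)" "y < dim_col (B * A)"
    then have xy: "x < 2 ^ n" "y < 2 ^ n" using c by auto
    show "(A * B) $$ (x, y) = (B * A) $$ (x, y)"
      using acts_on_mult_disjoint[where w = w and v = v, OF c(1) w c(2) v ST xy]
        acts_on_mult_disjoint[where w = v and v = w, OF c(2) v c(1) w ST(2,1) TS xy]
      by (simp add: Un_commute mult.commute)
  qed (use c in auto)
qed

definition bit_sign :: "nat \<Rightarrow> nat \<Rightarrow> complex" where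
  "bit_sign q x = (if digit 2 q x = 1 then - 1 else 1)"

lemma site_Z_index:
  assumes "q < n" "x < 2 ^ n" "y < 2 ^ n"
  shows "site_Z n q $$ (x, y) = (if x = y then bit_sign q x else 0)"
proof -
  have e: "pauli_Z $$ (a, b) = (if a = b then (if a = 1 then - 1 else 1) else 0)" if "a < 2" "b < 2" for a b
    using that mat22_index[of "1 :: complex" 0 0 "- 1"] by (cases "a = 0"; cases "b = 0") (auto simp: less_2_cases_iff)
  have d: "digit 2 t z < 2" for t z by (simp add: digit_less)
  have "site_Z n q $$ (x, y) = (\<Prod>t<n. if digit 2 t x = digit 2 t y then (if t = q then bit_sign q x else 1) else 0)"
    unfolding tensor_prod_index[OF assms(2,3)]
    by (intro prod.cong refl) (simp add: single_site_def e d bit_sign_def)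
  also have "\<dots> = (if x = y then bit_sign q x else 0)"
  proof (cases "x = y")
    case True
    then show ?thesis using assms(1) by simp
  next
    case False
    then obtain t where "t < n" "digit 2 t x \<noteq> digit 2 t y" using digit_eqI[OF assms(2,3)] by blast
    then have "\<exists>t\<in>{..<n}. (if digit 2 t x = digit 2 t y then (if t = q then bit_sign q x else 1) else 0) = 0"
      by auto
    then show ?thesis using False by (simp add: prod_zero)
  qed
  finally show ?thesis .
qed

lemma acts_on_site_Z:
  assumes "q < n"
  shows "acts_on n {q} (site_Z n q)"
proof -
  \<comment> \<open>Subsets of \<open>{q}\<close> label the states of the qubit: \<open>{}\<close>
    is state 0 and \<open>{q}\<close> is state 1.\<close>
  let ?w = "\<lambda>a b :: nat set. if a = b then (if a = {} then 1 else - 1 :: complex) else 0"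
  have "site_Z n q $$ (x, y) =
      (if \<forall>t\<in>{..<n} - {q}. digit 2 t x = digit 2 t y
       then ?w {t\<in>{q}. digit 2 t x = 1} {t\<in>{q}. digit 2 t y = 1} else 0)"
    if xy: "x < 2 ^ n" "y < 2 ^ n" for x y
  proof -
    have 01: "digit 2 q z = 0 \<or> digit 2 q z = 1" for z using digit_less[of 2 q z] by auto
    have S: "{t\<in>{q}. digit 2 t z = 1} = (if digit 2 q z = 1 then {q} else {})" for z by auto
    have "x = y \<longleftrightarrow> (\<forall>t\<in>{..<n} - {q}. digit 2 t x = digit 2 t y) \<and> digit 2 q x = digit 2 q y"
      using digit_eqI[OF xy] by blast
    then show ?thesis
      unfolding site_Z_index[OF assms xy] S bit_sign_def using 01[of x] 01[of y] by auto
  qed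
  then show ?thesis unfolding acts_on_def by (intro conjI exI[of _ ?w]) simp_all
qed

text \<open>Support is expressed through the commutant rather than by a tensor factorisation:
  conjugation by gates is easy to follow through commutation relations, and commuting with Z_j is
  what is wanted in the end.\<close>

definition supported :: "nat \<Rightarrow> nat set \<Rightarrow> complex mat \<Rightarrow> bool" where
  "supported n S P \<longleftrightarrow> P \<in> carrier_mat (2 ^ n) (2 ^ n) \<and>
     (\<forall>T B. T \<subseteq> {..<n} \<longrightarrow> T \<inter> S = {} \<longrightarrow> acts_on n T B \<longrightarrow> P * B = B * P)"

lemma supportedD:
  assumes "supported n S P"
  shows "P \<in> carrier_mat (2 ^ n) (2 ^ n)"
    and "T \<subseteq> {..<n} \<Longrightarrow> T \<inter> S = {} \<Longrightarrow> acts_on n T B \<Longrightarrow> P * B = B * P"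
  using assms unfolding supported_def by blast+

text \<open>A gate that misses the support commutes with the operator and cancels against its own
  adjoint. This is why such gates do not enlarge the lightcone.\<close>

lemma supported_conj_disjoint:
  assumes "supported n S P" "unitary_mat (2 ^ n) g" "acts_on n T g" "T \<subseteq> {..<n}" "T \<inter> S = {}"
  shows "g * P * mat_adjoint g = P"
proof -
  note g = unitary_matD[OF assms(2)]
  note P = supportedD(1)[OF assms(1)]
  have "g * P = P * g" by (rule supportedD(2)[OF assms(1,4,5,3), symmetric])
  then have "g * P * mat_adjoint g = P * (g * mat_adjoint g)"
    by (simp only: assoc_mult_mat[OF P g(1,2)])
  then show ?thesis unfolding g(3) right_mult_one_mat[OF P] .
qed

lemma commute_conj:
  fixes g P B :: "complex mat"
  assumes g: "unitary_mat d g" and P: "P \<in> carrier_mat d d" and B: "B \<in> carrier_mat d d"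
    and gB: "g * B = B * g" and PB: "P * B = B * P"
  shows "(g * P * mat_adjoint g) * B = B * (g * P * mat_adjoint g)"
proof -
  note g = unitary_matD[OF g]
  note gP = mult_carrier_mat[OF g(1) P]
  have Bg: "B = g * B * mat_adjoint g"
    unfolding gB assoc_mult_mat[OF B g(1,2)] g(3) by (rule right_mult_one_mat[OF B, symmetric])
  have "mat_adjoint g * B = mat_adjoint g * (g * (B * mat_adjoint g))"
    by (subst Bg) (simp only: assoc_mult_mat[OF g(1) B g(2)])
  also have "\<dots> = B * mat_adjoint g"
    unfolding assoc_mult_mat[OF g(2,1) mult_carrier_mat[OF B g(2)], symmetric] g(4)
    by (rule left_mult_one_mat[OF mult_carrier_mat[OF B g(2)]])
  finally have g'B: "mat_adjoint g * B = B * mat_adjoint g" .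
  have "(g * P * mat_adjoint g) * B = g * P * (B * mat_adjoint g)"
    unfolding assoc_mult_mat[OF gP g(2) B] g'B ..
  also have "\<dots> = g * (P * B) * mat_adjoint g"
    unfolding assoc_mult_mat[OF gP B g(2), symmetric] assoc_mult_mat[OF g(1) P B] ..
  also have "\<dots> = B * (g * P) * mat_adjoint g"
    unfolding PB assoc_mult_mat[OF g(1) B P, symmetric] gB assoc_mult_mat[OF B g(1) P] ..
  also have "\<dots> = B * (g * P * mat_adjoint g)"
    by (rule assoc_mult_mat[OF B gP g(2)])
  finally show ?thesis .
qed

lemma supported_conj:
  assumes P: "supported n S P" and g: "unitary_mat (2 ^ n) g" "acts_on n T g" "T \<subseteq> {..<n}"
  shows "supported n (S \<union> T) (g * P * mat_adjoint g)"
  unfolding supported_def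
proof (intro conjI allI impI)
  note Pc = supportedD(1)[OF P]
  show "g * P * mat_adjoint g \<in> carrier_mat (2 ^ n) (2 ^ n)"
    using unitary_matD[OF g(1)] Pc by (intro mult_carrier_mat)
  fix R B assume R: "R \<subseteq> {..<n}" "R \<inter> (S \<union> T) = {}" and B: "acts_on n R B"
  have RS: "R \<inter> S = {}" and TR: "T \<inter> R = {}" using R(2) by blast+
  have "P * B = B * P" by (rule supportedD(2)[OF P R(1) RS B])
  moreover have "g * B = B * g" by (rule acts_on_disjoint_commute[OF g(2) B g(3) R(1) TR])
  moreover have "B \<in> carrier_mat (2 ^ n) (2 ^ n)" using B by (simp add: acts_on_def)
  ultimately show "(g * P * mat_adjoint g) * B = B * (g * P * mat_adjoint g)"
    using commute_conj[OF g(1) Pc] by blast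
qed

text \<open>Here \<open>S\<close> is the lightcone before the layer, \<open>M\<close> the support
  reached so far, and \<open>A\<close> the accumulator of the fold. The lightcone tests gates
  against \<open>S\<close> although the support grows within the layer. The last assumption makes
  testing against \<open>M\<close> equivalent, and it survives each step because the remaining gates
  are disjoint from the one just applied.\<close>

lemma supported_layer:
  assumes "\<forall>g\<in>set L. valid_gate n r G g" "sorted_wrt (\<lambda>g h. fst g \<inter> fst h = {}) L"
    and "unitary_mat (2 ^ n) A" "P \<in> carrier_mat (2 ^ n) (2 ^ n)"
    and "supported n M (A * P * mat_adjoint A)" "\<And>g. g \<in> set L \<Longrightarrow> fst g \<inter> M = fst g \<inter> S"
  shows "unitary_mat (2 ^ n) (fold (\<lambda>g A. snd g * A) L A) \<and>
    supported n (M \<union> \<Union>{fst g | g. g \<in> set L \<and> fst g \<inter> S \<noteq> {}})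
      (fold (\<lambda>g A. snd g * A) L A * P * mat_adjoint (fold (\<lambda>g A. snd g * A) L A))"
  using assms
proof (induction L arbitrary: A M)
  case (Cons g L)
  have g: "unitary_mat (2 ^ n) (snd g)" "acts_on n (fst g) (snd g)" "fst g \<subseteq> {..<n}"
    using Cons.prems(1) by (auto simp: valid_gate_def)
  have disj: "fst g \<inter> fst h = {}" if "h \<in> set L" for h using Cons.prems(2) that by simp
  note u = unitary_mat_mult[OF g(1) Cons.prems(3)]
  have eq: "snd g * A * P * mat_adjoint (snd g * A) = snd g * (A * P * mat_adjoint A) * mat_adjoint (snd g)"
    by (rule conj_mult[OF unitary_matD(1)[OF g(1)] unitary_matD(1)[OF Cons.prems(3)] Cons.prems(4)])
  show ?case
  proof (cases "fst g \<inter> S = {}")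
    case True
    then have "fst g \<inter> M = {}" using Cons.prems(6)[of g] by simp
    then have "supported n M (snd g * A * P * mat_adjoint (snd g * A))"
      unfolding eq using supported_conj_disjoint[OF Cons.prems(5) g] Cons.prems(5) by simp
    from Cons.IH[OF _ _ u Cons.prems(4) this]
    have IH: "unitary_mat (2 ^ n) (fold (\<lambda>g A. snd g * A) L (snd g * A)) \<and>
      supported n (M \<union> \<Union>{fst g | g. g \<in> set L \<and> fst g \<inter> S \<noteq> {}})
      (fold (\<lambda>g A. snd g * A) L (snd g * A) * P * mat_adjoint (fold (\<lambda>g A. snd g * A) L (snd g * A)))"
      using Cons.prems(1,2,6) by simp
    have "{fst g' | g'. g' \<in> set (g # L) \<and> fst g' \<inter> S \<noteq> {}} = {fst g | g. g \<in> set L \<and> fst g \<inter> S \<noteq> {}}"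
      using True by auto
    then show ?thesis using IH by simp
  next
    case False
    have "supported n (M \<union> fst g) (snd g * A * P * mat_adjoint (snd g * A))"
      unfolding eq by (rule supported_conj[OF Cons.prems(5) g])
    from Cons.IH[OF _ _ u Cons.prems(4) this]
    have IH: "unitary_mat (2 ^ n) (fold (\<lambda>g A. snd g * A) L (snd g * A)) \<and>
      supported n ((M \<union> fst g) \<union> \<Union>{fst g | g. g \<in> set L \<and> fst g \<inter> S \<noteq> {}})
      (fold (\<lambda>g A. snd g * A) L (snd g * A) * P * mat_adjoint (fold (\<lambda>g A. snd g * A) L (snd g * A)))"
      using Cons.prems(1,2,6) disj by (simp add: Int_Un_distrib Int_commute)
    have "{fst g' | g'. g' \<in> set (g # L) \<and> fst g' \<inter> S \<noteq> {}}
        = insert (fst g) {fst g | g. g \<in> set L \<and> fst g \<inter> S \<noteq> {}}"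
      unfolding list.set using False by blast
    then show ?thesis using IH by (simp add: Un_assoc)
  qed
qed simp

lemma supported_circuit:
  assumes "\<forall>L\<in>set C. valid_layer n r G L"
    and "unitary_mat (2 ^ n) A" "P \<in> carrier_mat (2 ^ n) (2 ^ n)" "supported n S (A * P * mat_adjoint A)"
  shows "unitary_mat (2 ^ n) (fold (\<lambda>L A. layer_unitary n L * A) C A) \<and>
    supported n (fold (\<lambda>L S. S \<union> \<Union>{fst g | g. g \<in> set L \<and> fst g \<inter> S \<noteq> {}}) C S)
      (fold (\<lambda>L A. layer_unitary n L * A) C A * P * mat_adjoint (fold (\<lambda>L A. layer_unitary n L * A) C A))"
  using assms
proof (induction C arbitrary: A S)
  case (Cons L C)
  let ?Q = "A * P * mat_adjoint A"
  have L: "\<forall>g\<in>set L. valid_gate n r G g" "sorted_wrt (\<lambda>g h. fst g \<inter> fst h = {}) L"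
    using Cons.prems(1) by (auto simp: valid_layer_def)
  have Q: "?Q \<in> carrier_mat (2 ^ n) (2 ^ n)" using Cons.prems(4) by (simp add: supported_def)
  then have "supported n S (1\<^sub>m (2 ^ n) * ?Q * mat_adjoint (1\<^sub>m (2 ^ n)))"
    using Cons.prems(4) by (simp add: left_mult_one_mat[OF Q] right_mult_one_mat[OF Q])
  \<comment> \<open>The unitary of the layer is a fold starting from the identity, so the already
    evolved operator \<open>?Q\<close> takes the role of the initial operator.\<close>
  from supported_layer[OF L unitary_mat_one Q this]
  have s: "unitary_mat (2 ^ n) (layer_unitary n L)"
    "supported n (S \<union> \<Union>{fst g | g. g \<in> set L \<and> fst g \<inter> S \<noteq> {}})
      (layer_unitary n L * ?Q * mat_adjoint (layer_unitary n L))"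
    unfolding layer_unitary_def by blast+
  have "layer_unitary n L * A * P * mat_adjoint (layer_unitary n L * A)
      = layer_unitary n L * ?Q * mat_adjoint (layer_unitary n L)"
    by (rule conj_mult[OF unitary_matD(1)[OF s(1)] unitary_matD(1)[OF Cons.prems(2)] Cons.prems(3)])
  with s have s2: "supported n (S \<union> \<Union>{fst g | g. g \<in> set L \<and> fst g \<inter> S \<noteq> {}})
      (layer_unitary n L * A * P * mat_adjoint (layer_unitary n L * A))" by simp
  show ?case
    using Cons.IH[OF _ unitary_mat_mult[OF s(1) Cons.prems(2)] Cons.prems(3) s2] Cons.prems(1) by simp
qed simp

text \<open>U Z_q U^\<dagger> is supported on the lightcone of q and hence commutes with Z_j; the
  conjugation is then moved over to Z_j, where the test sees it.\<close>

lemma com_outside_lightcone: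
  assumes C: "valid_circuit n r G C" and q: "q < n" and j: "j < n" "j \<notin> lightcone q C"
  shows "com (mat_adjoint (circuit_unitary n C) * site_Z n j * circuit_unitary n C) (site_Z n q) = 1"
proof -
  let ?U = "circuit_unitary n C"
  have "supported n {q} (site_Z n q)"
    unfolding supported_def
  proof (intro conjI allI impI)
    fix T B assume "T \<subseteq> {..<n}" "T \<inter> {q} = {}" "acts_on n T B"
    then show "site_Z n q * B = B * site_Z n q"
      using q by (intro acts_on_disjoint_commute[OF acts_on_site_Z[OF q]]) auto
  qed simp
  then have "supported n {q} (1\<^sub>m (2 ^ n) * site_Z n q * mat_adjoint (1\<^sub>m (2 ^ n)))"
    by (simp add: left_mult_one_mat[OF tensor_prod_carrier] right_mult_one_mat[OF tensor_prod_carrier])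
  from supported_circuit[OF C[unfolded valid_circuit_def] unitary_mat_one tensor_prod_carrier this]
  have U: "unitary_mat (2 ^ n) ?U" and s: "supported n (lightcone q C) (?U * site_Z n q * mat_adjoint ?U)"
    unfolding circuit_unitary_def lightcone_def by blast+
  have "?U * site_Z n q * mat_adjoint ?U * site_Z n j = site_Z n j * (?U * site_Z n q * mat_adjoint ?U)"
    by (rule supportedD(2)[OF s _ _ acts_on_site_Z[OF j(1)]]) (use j in auto)
  then have "com (site_Z n j) (?U * site_Z n q * mat_adjoint ?U) = 1" by (simp add: com_def)
  then show ?thesis using com_unitary_shift[OF U tensor_prod_carrier tensor_prod_carrier] by simp
qed

section \<open>Growth of the lightcone with the depth\<close>

lemma lightcone_subset:
  assumes "valid_circuit n r G C" "q < n"
  shows "lightcone q C \<subseteq> {..<n}"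
proof -
  have "fold (\<lambda>L S. S \<union> \<Union>{fst g | g. g \<in> set L \<and> fst g \<inter> S \<noteq> {}}) C S \<subseteq> {..<n}"
    if "\<forall>L\<in>set C. valid_layer n r G L" "S \<subseteq> {..<n}" for S
    using that
  proof (induction C arbitrary: S)
    case (Cons L C)
    have "S \<union> \<Union>{fst g | g. g \<in> set L \<and> fst g \<inter> S \<noteq> {}} \<subseteq> {..<n}"
    proof -
      have "fst g \<subseteq> {..<n}" if "g \<in> set L" for g
        using Cons.prems(1) that by (auto simp: valid_layer_def valid_gate_def)
      then show ?thesis using Cons.prems(2) by blast
    qed
    then show ?case using Cons.IH Cons.prems(1) by simp
  qed simp
  then show ?thesis using assms by (simp add: lightcone_def valid_circuit_def)
qed

lemma lightcone_snoc:
  "lightcone q (C @ [L]) = lightcone q C \<union> \<Union>{fst g | g. g \<in> set L \<and> fst g \<inter> lightcone q C \<noteq> {}}"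
  by (simp add: lightcone_def)

text \<open>The gates of a layer are disjoint, so each qubit of the cone meets at most one of them
  and brings in at most r qubits. Together with the old cone this gives the factor r + 1 per
  layer.\<close>

lemma card_lightcone_le_power:
  assumes "valid_circuit n r G C" "q < n"
  shows "card (lightcone q C) \<le> (r + 1) ^ depth C"
  using assms(1)
proof (induction C rule: rev_induct)
  case Nil
  then show ?case by (simp add: lightcone_def depth_def)
next
  case (snoc L C)
  let ?S = "lightcone q C"
  have vC: "valid_circuit n r G C" and vL: "valid_layer n r G L"
    using snoc.prems by (auto simp: valid_circuit_def)
  have fin: "finite ?S" using lightcone_subset[OF vC assms(2)] finite_subset by blast
  have disj: "g = h \<or> fst g \<inter> fst h = {}" if "g \<in> set L" "h \<in> set L" for g h
  proof -
    from in_set_conv_nth[THEN iffD1, OF that(1)] obtain i where i: "i < length L" "L ! i = g" by (elim exE conjE)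
    from in_set_conv_nth[THEN iffD1, OF that(2)] obtain k where k: "k < length L" "L ! k = h" by (elim exE conjE)
    have "sorted_wrt (\<lambda>g h. fst g \<inter> fst h = {}) L"
      by (rule vL[unfolded valid_layer_def, THEN conjunct2])
    note sw = sorted_wrt_nth_less[OF this]
    consider "i < k" | "i = k" | "k < i" by linarith
    then show ?thesis
      by cases (use sw[of i k] sw[of k i] i k in \<open>auto simp: Int_commute\<close>)
  qed
  define T where "T x = \<Union>{fst g | g. g \<in> set L \<and> x \<in> fst g}" for x
  have T: "card (T x) \<le> r" for x
  proof (cases "\<exists>g\<in>set L. x \<in> fst g")
    case True
    then obtain g where g: "g \<in> set L" "x \<in> fst g" by blast
    then have "{fst h | h. h \<in> set L \<and> x \<in> fst h} = {fst g}" using disj[OF g(1)] by blast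
    then have "T x = fst g" by (simp add: T_def)
    then show ?thesis using vL g(1) by (simp add: valid_layer_def valid_gate_def)
  next
    case False
    then have "T x = {}" unfolding T_def by blast
    then show ?thesis by simp
  qed
  have "lightcone q (C @ [L]) = ?S \<union> (\<Union>x\<in>?S. T x)"
    unfolding lightcone_snoc T_def by blast
  then have "card (lightcone q (C @ [L])) \<le> card ?S + card (\<Union>x\<in>?S. T x)"
    by (simp add: card_Un_le)
  also have "card (\<Union>x\<in>?S. T x) \<le> (\<Sum>x\<in>?S. card (T x))" by (rule card_UN_le[OF fin])
  also have "\<dots> \<le> (\<Sum>x\<in>?S. r)" by (intro sum_mono T)
  finally have "card (lightcone q (C @ [L])) \<le> (r + 1) * card ?S" by (simp add: mult.commute)
  also have "\<dots> \<le> (r + 1) * (r + 1) ^ depth C" using snoc.IH[OF vC] by (intro mult_left_mono) auto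
  finally show ?case by (simp add: depth_def)
qed

lemma one_dimensional_cycle_graph:
  assumes "one_dimensional n G"
  shows "\<exists>p. p permutes {..<n} \<and> G \<subseteq> map_prod p p ` cycle_graph n"
proof -
  have "path_graph n \<subseteq> cycle_graph n" by (auto simp: path_graph_def cycle_graph_def)
  then show ?thesis using assms unfolding one_dimensional_def by blast
qed

text \<open>The cone stays in a ball around q along the cycle. A connected gate that meets the ball
  of radius m lies in the ball of radius m + r * r, so each layer adds r * r to the radius, and a
  ball of radius m has at most 2 * m + 1 points.\<close>

lemma card_lightcone_one_dimensional:
  assumes C: "valid_circuit n r G C" and q: "q < n"
    and p: "p permutes {..<n}" and G: "G \<subseteq> map_prod p p ` cycle_graph n"
  shows "card (lightcone q C) \<le> 2 * (r * r) * depth C + 1"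
proof -
  obtain i\<^sub>0 where i0: "i\<^sub>0 < n" "q = p i\<^sub>0"
    using q permutes_image[OF p] by (metis imageE lessThan_iff)
  \<comment> \<open>The ball of radius m, described by integer offsets from the position of q.
    Reducing them modulo n takes care of wrapping around the cycle, even when offsets
    coincide.\<close>
  define B where "B m = (\<lambda>s. p (nat ((int i\<^sub>0 + s) mod int n))) ` {- int m..int m}" for m
  have n: "0 < n" using q by simp
  have B_mono: "B m \<subseteq> B m'" if "m \<le> m'" for m m'
    unfolding B_def using that by (intro image_mono) auto
  have B_step: "y \<in> B (Suc m)" if x: "x \<in> B m" and xy: "(x, y) \<in> G" for x y m
  proof -
    obtain i j where ij: "x = p i" "y = p j" "i < n" "j < n" "j = Suc i mod n \<or> i = Suc j mod n"
      using G xy by (auto simp: cycle_graph_def)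
    obtain s where s: "- int m \<le> s" "s \<le> int m" "x = p (nat ((int i\<^sub>0 + s) mod int n))"
      using x by (auto simp: B_def)
    have "i = nat ((int i\<^sub>0 + s) mod int n)"
      using s(3) ij(1) permutes_inj[OF p] by (simp add: inj_def)
    then have i: "int i = (int i\<^sub>0 + s) mod int n" using n by simp
    have "\<exists>s'. - int (Suc m) \<le> s' \<and> s' \<le> int (Suc m) \<and> int j = (int i\<^sub>0 + s') mod int n"
      using ij(5)
    proof
      assume "j = Suc i mod n"
      then have "int j = (int i + 1) mod int n" by (simp add: of_nat_mod add.commute)
      also have "\<dots> = (int i\<^sub>0 + (s + 1)) mod int n" unfolding i by (simp add: mod_simps add.assoc)
      finally show ?thesis using s by (intro exI[of _ "s + 1"]) auto
    next
      assume "i = Suc j mod n"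
      then have "int i = (int j + 1) mod int n" by (simp add: of_nat_mod add.commute)
      then have "(int i - 1) mod int n = int j mod int n" by (simp add: mod_simps)
      then have "int j = (int i - 1) mod int n" using ij(4) by simp
      also have "\<dots> = (int i\<^sub>0 + (s - 1)) mod int n" unfolding i by (simp add: mod_simps algebra_simps)
      finally show ?thesis using s by (intro exI[of _ "s - 1"]) auto
    qed
    then obtain s' where s': "- int (Suc m) \<le> s'" "s' \<le> int (Suc m)" "int j = (int i\<^sub>0 + s') mod int n"
      by blast
    then have "y = p (nat ((int i\<^sub>0 + s') mod int n))" using ij(2) by (metis nat_int)
    then show ?thesis unfolding B_def using s'(1,2) by (intro image_eqI[of _ _ s']) auto
  qed
  have B_relpow: "y \<in> B (m + l)" if "x \<in> B m" "(x, y) \<in> R ^^ l" "R \<subseteq> G" for x y m l R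
    using that(2)
  proof (induction l arbitrary: y)
    case 0
    then show ?case using that(1) by simp
  next
    case (Suc l)
    then obtain z where z: "(x, z) \<in> R ^^ l" "(z, y) \<in> R" by auto
    then show ?case using B_step[OF Suc.IH[OF z(1)]] that(3) by auto
  qed
  have B_gate: "fst g \<subseteq> B (m + r * r)" if g: "valid_gate n r G g" "fst g \<inter> B m \<noteq> {}" for g m
  proof
    fix y assume y: "y \<in> fst g"
    obtain x where x: "x \<in> fst g" "x \<in> B m" using g(2) by blast
    let ?R = "G \<inter> fst g \<times> fst g"
    have finT: "finite (fst g)" using g(1) finite_subset[of "fst g" "{..<n}"] by (auto simp: valid_gate_def)
    then have fin: "finite ?R" by simp
    have "card ?R \<le> card (fst g \<times> fst g)" using finT by (intro card_mono) auto
    also have "\<dots> \<le> r * r" using g(1) by (simp add: card_cartesian_product valid_gate_def mult_le_mono)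
    finally have cR: "card ?R \<le> r * r" .
    have "(x, y) \<in> ?R\<^sup>*" using g(1) x y by (simp add: valid_gate_def connected_in_def)
    \<comment> \<open>A path inside the gate can be chosen no longer than the number of pairs in
      \<open>?R\<close>, hence the increment r * r of the radius.\<close>
    then obtain l where l: "l \<le> card ?R" "(x, y) \<in> ?R ^^ l"
      unfolding rtrancl_finite_eq_relpow[OF fin] by auto
    have "y \<in> B (m + l)" by (rule B_relpow[OF x(2) l(2)]) blast
    then show "y \<in> B (m + r * r)" using B_mono[of "m + l" "m + r * r"] l(1) cR by auto
  qed
  have "lightcone q C \<subseteq> B (r * r * depth C)" using C
  proof (induction C rule: rev_induct)
    case Nil
    have "q \<in> B 0" using i0 by (simp add: B_def)
    then show ?case by (simp add: lightcone_def depth_def)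
  next
    case (snoc L C)
    have IH: "lightcone q C \<subseteq> B (r * r * depth C)" and vL: "valid_layer n r G L"
      using snoc by (auto simp: valid_circuit_def)
    have d: "r * r * depth (C @ [L]) = r * r * depth C + r * r" by (simp add: depth_def)
    show ?case unfolding lightcone_snoc d
    proof (intro Un_least Union_least)
      show "lightcone q C \<subseteq> B (r * r * depth C + r * r)"
        by (rule order_trans[OF IH B_mono]) simp
      fix T assume "T \<in> {fst g | g. g \<in> set L \<and> fst g \<inter> lightcone q C \<noteq> {}}"
      then obtain g where g: "T = fst g" "g \<in> set L" "fst g \<inter> lightcone q C \<noteq> {}" by blast
      have "valid_gate n r G g" using vL g(2) by (simp add: valid_layer_def)
      moreover have "fst g \<inter> B (r * r * depth C) \<noteq> {}" using g(3) IH by blast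
      ultimately show "T \<subseteq> B (r * r * depth C + r * r)" unfolding g(1) by (rule B_gate)
    qed
  qed
  moreover have "finite (B m)" for m by (simp add: B_def)
  ultimately have "card (lightcone q C) \<le> card (B (r * r * depth C))" by (intro card_mono)
  also have "\<dots> \<le> card {- int (r * r * depth C)..int (r * r * depth C)}"
    unfolding B_def by (rule card_image_le) simp
  also have "card {- int m..int m} = 2 * m + 1" for m by simp
  finally show ?thesis by (simp add: mult.assoc)
qed

section \<open>The test state and observable\<close>

lemma tensor_pow_index:
  "i < d ^ k \<Longrightarrow> j < d ^ k \<Longrightarrow> tensor_pow d k U $$ (i, j) = (\<Prod>t<k. U $$ (digit d t i, digit d t j))"
  by (simp add: tensor_pow_def tensor_prod_index)

lemma tensor_pow_carrier [simp]: "tensor_pow d k U \<in> carrier_mat (d ^ k) (d ^ k)"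
  by (simp add: tensor_pow_def)

lemma tensor_pow_conj_index:
  assumes A: "A \<in> carrier_mat (d ^ k) (d ^ k)" and ij: "i < d ^ k" "j < d ^ k"
  shows "(tensor_pow d k U * A * tensor_pow d k V) $$ (i, j) =
    (\<Sum>m<d ^ k. \<Sum>l<d ^ k. tensor_pow d k U $$ (i, l) * A $$ (l, m) * tensor_pow d k V $$ (m, j))"
  unfolding mult_mat_index[OF mult_carrier_mat[OF tensor_pow_carrier A] tensor_pow_carrier ij]
  by (intro sum.cong refl) (simp add: mult_mat_index[OF tensor_pow_carrier A ij(1)] sum_distrib_right)

text \<open>The diagonal of \<open>Z\<^sub>j\<close> on the first four copies, tensored with the identity.\<close>

definition test_sign :: "nat \<Rightarrow> nat \<Rightarrow> nat \<Rightarrow> complex" where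
  "test_sign n j x = (\<Prod>t<4. bit_sign j (digit (2 ^ n) t x))"

lemma bit_sign_square: "bit_sign q x * bit_sign q x = 1"
  by (simp add: bit_sign_def)

lemma cnj_bit_sign [simp]: "cnj (bit_sign q x) = bit_sign q x"
  by (simp add: bit_sign_def)

lemma norm_bit_sign [simp]: "cmod (bit_sign q x) = 1"
  by (simp add: bit_sign_def)

lemma norm_test_sign: "cmod (test_sign n j x) = 1"
  by (simp add: test_sign_def flip: prod_norm)

lemma conj_site_Z_index:
  assumes u: "unitary_mat (2 ^ n) U" and j: "j < n" and ab: "a < 2 ^ n" "b < 2 ^ n"
  shows "(mat_adjoint U * site_Z n j * U) $$ (a, b)
    = (\<Sum>x<2 ^ n. mat_adjoint U $$ (a, x) * bit_sign j x * U $$ (x, b))"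
proof -
  note U = unitary_matD[OF u]
  have "(mat_adjoint U * site_Z n j) $$ (a, x) = mat_adjoint U $$ (a, x) * bit_sign j x" if x: "x < 2 ^ n" for x
  proof -
    have "(mat_adjoint U * site_Z n j) $$ (a, x)
        = (\<Sum>l<2 ^ n. mat_adjoint U $$ (a, l) * site_Z n j $$ (l, x))"
      by (rule mult_mat_index[OF U(2) tensor_prod_carrier ab(1) x])
    also have "\<dots> = (\<Sum>l<2 ^ n. if l = x then mat_adjoint U $$ (a, x) * bit_sign j x else 0)"
      using x by (intro sum.cong refl) (auto simp: site_Z_index[OF j])
    finally show ?thesis using x by simp
  qed
  then show ?thesis
    unfolding mult_mat_index[OF mult_carrier_mat[OF U(2) tensor_prod_carrier] U(1) ab]
    by (intro sum.cong refl) simp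
qed

text \<open>Cyclicity of the trace in coordinates: the conjugation is moved from the state to the
  diagonal observable, which then factorises into four copies of U^\<dagger> Z_j U and identities on
  the other copies.\<close>

lemma test_observable:
  assumes u: "unitary_mat (2 ^ n) U" and j: "j < n" and k: "k \<ge> 4"
    and X: "X \<in> carrier_mat ((2 ^ n) ^ k) ((2 ^ n) ^ k)"
  shows "(\<Sum>i<(2 ^ n) ^ k. test_sign n j i * (tensor_pow (2 ^ n) k U * X * tensor_pow (2 ^ n) k (mat_adjoint U)) $$ (i, i))
    = (\<Sum>l<(2 ^ n) ^ k. \<Sum>m<(2 ^ n) ^ k. X $$ (l, m) *
        (\<Prod>t<k. if t < 4 then (mat_adjoint U * site_Z n j * U) $$ (digit (2 ^ n) t m, digit (2 ^ n) t l)
                else 1\<^sub>m (2 ^ n) $$ (digit (2 ^ n) t m, digit (2 ^ n) t l)))"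
proof -
  define d where "d = (2 ^ n :: nat)"
  have d: "d > 0" by (simp add: d_def)
  note U = unitary_matD[OF u, folded d_def]
  note X = X[folded d_def]
  let ?W = "tensor_pow d k U" and ?W' = "tensor_pow d k (mat_adjoint U)"
  \<comment> \<open>Extends the signs by 1 beyond the fourth copy, so that the observable is a
    product over all k copies.\<close>
  define s where "s t x = (if t < 4 then bit_sign j x else 1)" for t x :: nat
  have ts: "test_sign n j i = (\<Prod>t<k. s t (digit d t i))" for i
  proof -
    have "(\<Prod>t<k. s t (digit d t i)) = (\<Prod>t<4. s t (digit d t i))"
      using k by (intro prod.mono_neutral_right) (auto simp: s_def)
    also have "\<dots> = test_sign n j i" unfolding test_sign_def by (intro prod.cong refl) (simp add: s_def d_def)
    finally show ?thesis ..
  qed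
  have inner: "(\<Sum>i<d ^ k. ?W' $$ (m, i) * test_sign n j i * ?W $$ (i, l))
     = (\<Prod>t<k. if t < 4 then (mat_adjoint U * site_Z n j * U) $$ (digit d t m, digit d t l)
                else 1\<^sub>m d $$ (digit d t m, digit d t l))"
    if ml: "m < d ^ k" "l < d ^ k" for m l
  proof -
    have "(\<Sum>i<d ^ k. ?W' $$ (m, i) * test_sign n j i * ?W $$ (i, l))
       = (\<Sum>i<d ^ k. \<Prod>t<k. mat_adjoint U $$ (digit d t m, digit d t i) * s t (digit d t i) * U $$ (digit d t i, digit d t l))"
      using ml by (intro sum.cong refl) (simp add: tensor_pow_index ts prod.distrib)
    also have "\<dots> = (\<Prod>t<k. \<Sum>x<d. mat_adjoint U $$ (digit d t m, x) * s t x * U $$ (x, digit d t l))"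
      by (rule sum_prod_digits[OF d])
    also have "\<dots> = (\<Prod>t<k. if t < 4 then (mat_adjoint U * site_Z n j * U) $$ (digit d t m, digit d t l)
                else 1\<^sub>m d $$ (digit d t m, digit d t l))"
    proof (intro prod.cong refl)
      fix t
      have dd: "digit d t m < d" "digit d t l < d" using d by (simp_all add: digit_less)
      show "(\<Sum>x<d. mat_adjoint U $$ (digit d t m, x) * s t x * U $$ (x, digit d t l))
        = (if t < 4 then (mat_adjoint U * site_Z n j * U) $$ (digit d t m, digit d t l)
                else 1\<^sub>m d $$ (digit d t m, digit d t l))"
      proof (cases "t < 4")
        case True
        then show ?thesis
          using conj_site_Z_index[OF u j dd[unfolded d_def]] by (simp add: s_def d_def)
      next
        case False
        then show ?thesis
          using mult_mat_index[OF U(2,1) dd] unfolding U(4) by (simp add: s_def)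
      qed
    qed
    finally show ?thesis .
  qed
  have "(\<Sum>i<d ^ k. test_sign n j i * (?W * X * ?W') $$ (i, i))
      = (\<Sum>i<d ^ k. \<Sum>m<d ^ k. \<Sum>l<d ^ k. X $$ (l, m) * (?W' $$ (m, i) * test_sign n j i * ?W $$ (i, l)))"
    by (intro sum.cong refl) (simp add: tensor_pow_conj_index[OF X] sum_distrib_left ac_simps)
  also have "\<dots> = (\<Sum>m<d ^ k. \<Sum>i<d ^ k. \<Sum>l<d ^ k. X $$ (l, m) * (?W' $$ (m, i) * test_sign n j i * ?W $$ (i, l)))"
    by (rule sum.swap)
  also have "\<dots> = (\<Sum>m<d ^ k. \<Sum>l<d ^ k. \<Sum>i<d ^ k. X $$ (l, m) * (?W' $$ (m, i) * test_sign n j i * ?W $$ (i, l)))"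
    by (intro sum.cong refl sum.swap)
  also have "\<dots> = (\<Sum>l<d ^ k. \<Sum>m<d ^ k. \<Sum>i<d ^ k. X $$ (l, m) * (?W' $$ (m, i) * test_sign n j i * ?W $$ (i, l)))"
    by (rule sum.swap)
  also have "\<dots> = (\<Sum>l<d ^ k. \<Sum>m<d ^ k. X $$ (l, m) *
        (\<Prod>t<k. if t < 4 then (mat_adjoint U * site_Z n j * U) $$ (digit d t m, digit d t l)
                else 1\<^sub>m d $$ (digit d t m, digit d t l)))"
    by (intro sum.cong refl) (simp add: inner flip: sum_distrib_left)
  finally show ?thesis unfolding d_def .
qed

text \<open>
  The test state consists of two maximally entangled pairs on the first four copies, with \<open>Z\<^sub>q\<close>
  applied to the first copy, and of \<open>|0\<rangle>\<close> on the remaining copies. Four copies of a Pauli operator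
  \<open>R\<close> have expectation value \<open>\<plusminus>1\<close> in this state, with a sign that does not depend on the phase
  of \<open>R\<close> and records whether \<open>R\<close> commutes with \<open>Z\<^sub>q\<close>.
\<close>

lemma exists_test_state:
  assumes q: "q < n" and k: "k \<ge> 4"
  shows "\<exists>X\<in>carrier_mat ((2 ^ n) ^ k) ((2 ^ n) ^ k). trace_norm X \<le> 1 \<and>
    (\<forall>U\<in>clifford_group n. \<forall>j<n.
      (\<Sum>i<(2 ^ n) ^ k. test_sign n j i * (tensor_pow (2 ^ n) k U * X * tensor_pow (2 ^ n) k (mat_adjoint U)) $$ (i, i))
      = complex_of_real (com (mat_adjoint U * site_Z n j * U) (site_Z n q)))"
proof -
  define d where "d = (2 ^ n :: nat)"
  have d: "d > 0" by (simp add: d_def)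
  \<comment> \<open>The entangled pairs are copies 0, 1 with common state a and copies 2, 3 with
    common state c. The index \<open>idx a c\<close> is the basis state with these digits.\<close>
  let ?f = "\<lambda>a c t :: nat. if t < 2 then a else if t < 4 then c else 0"
  define idx where "idx a c = (SOME x. x < d ^ k \<and> (\<forall>t<k. digit d t x = ?f a c t))" for a c
  have idx_dig: "idx a c < d ^ k \<and> (\<forall>t<k. digit d t (idx a c) = ?f a c t)" if "a < d" "c < d" for a c
  proof -
    have "\<exists>x<d ^ k. \<forall>t<k. digit d t x = ?f a c t"
      by (rule digits_exist) (simp add: that d)
    from someI_ex[OF this] show ?thesis unfolding idx_def .
  qed
  have idx: "idx a c < d ^ k" if "a < d" "c < d" for a c
    using idx_dig[OF that] by (rule conjunct1)
  have dig: "digit d t (idx a c) = ?f a c t" if "a < d" "c < d" "t < k" for a c t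
    using idx_dig[OF that(1,2)] that(3) by simp
  have idx_inj: "idx a c = idx a' c' \<longleftrightarrow> a = a' \<and> c = c'"
    if "a < d" "c < d" "a' < d" "c' < d" for a c a' c'
  proof -
    have "0 < k" "2 < k" using k by auto
    then show ?thesis using dig[OF that(1,2), of 0] dig[OF that(3,4), of 0] dig[OF that(1,2), of 2] dig[OF that(3,4), of 2]
      by auto
  qed
  \<comment> \<open>Each of the two pairs contributes 1 / sqrt d to the amplitude, and
    \<open>bit_sign q a\<close> is the effect of Z_q on the first copy.\<close>
  define \<psi> where "\<psi> x = (\<Sum>a<d. \<Sum>c<d. if x = idx a c then bit_sign q a / of_nat d else 0)" for x
  have sum_\<psi>: "(\<Sum>x<d ^ k. \<psi> x * f x) = (\<Sum>a<d. \<Sum>c<d. bit_sign q a / of_nat d * f (idx a c))" for f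
  proof -
    have "(\<Sum>x<d ^ k. \<psi> x * f x)
       = (\<Sum>x<d ^ k. \<Sum>a<d. \<Sum>c<d. if x = idx a c then bit_sign q a / of_nat d * f (idx a c) else 0)"
      unfolding \<psi>_def sum_distrib_right by (intro sum.cong refl) auto
    also have "\<dots> = (\<Sum>a<d. \<Sum>x<d ^ k. \<Sum>c<d. if x = idx a c then bit_sign q a / of_nat d * f (idx a c) else 0)"
      by (rule sum.swap)
    also have "\<dots> = (\<Sum>a<d. \<Sum>c<d. \<Sum>x<d ^ k. if x = idx a c then bit_sign q a / of_nat d * f (idx a c) else 0)"
      by (intro sum.cong refl sum.swap)
    also have "\<dots> = (\<Sum>a<d. \<Sum>c<d. bit_sign q a / of_nat d * f (idx a c))"
      using idx by (intro sum.cong refl) simp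
    finally show ?thesis .
  qed
  have \<psi>_idx: "\<psi> (idx a c) = bit_sign q a / of_nat d" if "a < d" "c < d" for a c
  proof -
    have "\<psi> (idx a c) = (\<Sum>a'<d. \<Sum>c'<d. if c' = c then if a' = a then bit_sign q a / of_nat d else 0 else 0)"
      unfolding \<psi>_def using idx_inj[OF that] by (intro sum.cong refl) auto
    then show ?thesis using that by simp
  qed
  have \<psi>_cnj: "cnj (\<psi> x) = \<psi> x" for x
    unfolding \<psi>_def cnj_sum by (intro sum.cong refl) auto
  have norm: "(\<Sum>x<d ^ k. (cmod (\<psi> x))\<^sup>2) = 1"
  proof -
    have "complex_of_real (\<Sum>x<d ^ k. (cmod (\<psi> x))\<^sup>2) = (\<Sum>x<d ^ k. \<psi> x * \<psi> x)"
      unfolding of_real_sum_cmod_square \<psi>_cnj ..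
    also have "\<dots> = (\<Sum>a<d. \<Sum>c<d. bit_sign q a / of_nat d * \<psi> (idx a c))" by (rule sum_\<psi>)
    also have "\<dots> = (\<Sum>a<d. \<Sum>c<d. 1 / (of_nat d * of_nat d))"
      by (intro sum.cong refl) (simp add: \<psi>_idx bit_sign_square)
    also have "\<dots> = 1" using d by simp
    finally show ?thesis by (simp only: of_real_eq_1_iff)
  qed
  define X where "X = Matrix.mat (d ^ k) (d ^ k) (\<lambda>(i, j). \<psi> i * cnj (\<psi> j))"
  have X: "X \<in> carrier_mat (d ^ k) (d ^ k)" by (simp add: X_def)
  have tn: "trace_norm X \<le> 1" unfolding X_def by (rule trace_norm_rank_one[OF norm])
  have val: "(\<Sum>i<d ^ k. test_sign n j i * (tensor_pow d k U * X * tensor_pow d k (mat_adjoint U)) $$ (i, i))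
      = complex_of_real (com (mat_adjoint U * site_Z n j * U) (site_Z n q))"
    if U: "U \<in> clifford_group n" and j: "j < n" for U j
  proof -
    define R where "R = mat_adjoint U * site_Z n j * U"
    define \<sigma> where "\<sigma> = complex_of_real (com R (site_Z n q))"
    have Rg: "R \<in> pauli_group n"
      unfolding R_def by (intro clifford_groupD(3)[OF U] tensor_prod_pauli_group single_site_string) simp
    note Rc = pauli_group_carrier[OF Rg, folded d_def]
    define g where "g m l = (\<Prod>t<k. if t < 4 then R $$ (digit d t m, digit d t l)
                else 1\<^sub>m d $$ (digit d t m, digit d t l))" for m l
    have g_idx: "g (idx a' c') (idx a c) = (R $$ (a', a))\<^sup>2 * (R $$ (c', c))\<^sup>2"
      if "a < d" "c < d" "a' < d" "c' < d" for a c a' c'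
    proof -
      have "g (idx a' c') (idx a c) = (\<Prod>t<k. if t < 4 then R $$ (?f a' c' t, ?f a c t) else 1)"
        unfolding g_def using d by (intro prod.cong refl) (auto simp: dig[OF that(1,2)] dig[OF that(3,4)])
      also have "\<dots> = (\<Prod>t<4. R $$ (?f a' c' t, ?f a c t))"
        using k by (subst prod.mono_neutral_right[of "{..<k}" "{..<4}"]) (auto intro!: prod.cong)
      also have "\<dots> = (R $$ (a', a))\<^sup>2 * (R $$ (c', c))\<^sup>2"
        by (simp add: eval_nat_numeral lessThan_Suc)
      finally show ?thesis .
    qed
    \<comment> \<open>With s = \<open>bit_sign q\<close>, the exchange relation reads R_{a'a} s_a =
      \<sigma> s_{a'} R_{a'a} entrywise. Multiplying by s_{a'} R_{a'a} converts the two signs of the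
      state into \<sigma>.\<close>
    have comm: "bit_sign q a * bit_sign q a' * (R $$ (a', a))\<^sup>2 = \<sigma> * (R $$ (a', a))\<^sup>2"
      if a: "a < d" "a' < d" for a a'
    proof -
      have "R * site_Z n q = \<sigma> \<cdot>\<^sub>m (site_Z n q * R)"
        unfolding \<sigma>_def by (rule pauli_group_com[OF Rg single_site_string]) simp
      then have "(R * site_Z n q) $$ (a', a) = \<sigma> * (site_Z n q * R) $$ (a', a)"
        using a Rc by (simp add: d_def)
      moreover have "(R * site_Z n q) $$ (a', a) = R $$ (a', a) * bit_sign q a"
      proof -
        have "(R * site_Z n q) $$ (a', a) = (\<Sum>l<d. R $$ (a', l) * site_Z n q $$ (l, a))"
          using mult_mat_index[OF Rc[unfolded d_def] tensor_prod_carrier a(2,1)[unfolded d_def]] by (simp add: d_def)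
        also have "\<dots> = (\<Sum>l<d. if l = a then R $$ (a', a) * bit_sign q a else 0)"
          using a by (intro sum.cong refl) (auto simp: site_Z_index[OF q] d_def)
        finally show ?thesis using a by simp
      qed
      moreover have "(site_Z n q * R) $$ (a', a) = bit_sign q a' * R $$ (a', a)"
      proof -
        have "(site_Z n q * R) $$ (a', a) = (\<Sum>l<d. site_Z n q $$ (a', l) * R $$ (l, a))"
          using mult_mat_index[OF tensor_prod_carrier Rc[unfolded d_def] a(2,1)[unfolded d_def]] by (simp add: d_def)
        also have "\<dots> = (\<Sum>l<d. if l = a' then bit_sign q a' * R $$ (a', a) else 0)"
          using a by (intro sum.cong refl) (auto simp: site_Z_index[OF q] d_def)
        finally show ?thesis using a by simp
      qed
      ultimately have "R $$ (a', a) * bit_sign q a = \<sigma> * (bit_sign q a' * R $$ (a', a))" by simp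
      then have "bit_sign q a * bit_sign q a' * (R $$ (a', a))\<^sup>2
          = \<sigma> * (bit_sign q a' * bit_sign q a') * (R $$ (a', a))\<^sup>2"
        by (simp add: power2_eq_square ac_simps)
      then show ?thesis by (simp add: bit_sign_square)
    qed
    \<comment> \<open>This is tr (R R^T). The first pair contributes \<sigma> Sq / d and the second
      one Sq / d; since Sq * Sq = d * d, their product is \<sigma>.\<close>
    define Sq where "Sq = (\<Sum>a<d. \<Sum>a'<d. (R $$ (a', a))\<^sup>2)"
    have "Sq = (\<Sum>x<d. \<Sum>y<d. (R $$ (x, y))\<^sup>2)" unfolding Sq_def by (rule sum.swap)
    then have Sq: "Sq * Sq = of_nat d * of_nat d"
      using pauli_group_sum_squares[OF Rg] by (simp add: d_def power2_eq_square)
    have "(\<Sum>i<d ^ k. test_sign n j i * (tensor_pow d k U * X * tensor_pow d k (mat_adjoint U)) $$ (i, i))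
      = (\<Sum>l<d ^ k. \<Sum>m<d ^ k. X $$ (l, m) * g m l)"
      unfolding g_def R_def d_def
      by (rule test_observable[OF clifford_groupD(1)[OF U] j k X[unfolded d_def]])
    also have "\<dots> = (\<Sum>l<d ^ k. \<psi> l * (\<Sum>m<d ^ k. \<psi> m * g m l))"
      by (intro sum.cong refl) (simp add: X_def \<psi>_cnj sum_distrib_left mult.assoc)
    also have "\<dots> = (\<Sum>a<d. \<Sum>c<d. bit_sign q a / of_nat d *
        (\<Sum>a'<d. \<Sum>c'<d. bit_sign q a' / of_nat d * g (idx a' c') (idx a c)))"
      unfolding sum_\<psi> ..
    also have "\<dots> = (\<Sum>a<d. \<Sum>c<d. \<Sum>a'<d. \<Sum>c'<d.
        \<sigma> / (of_nat d * of_nat d) * ((R $$ (a', a))\<^sup>2 * (R $$ (c', c))\<^sup>2))"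
    proof (intro sum.cong refl)
      fix a c assume "a \<in> {..<d}" "c \<in> {..<d}"
      then have a: "a < d" "c < d" by auto
      have "bit_sign q a / of_nat d * (\<Sum>a'<d. \<Sum>c'<d. bit_sign q a' / of_nat d * g (idx a' c') (idx a c))
        = (\<Sum>a'<d. \<Sum>c'<d. bit_sign q a / of_nat d * (bit_sign q a' / of_nat d * g (idx a' c') (idx a c)))"
        by (simp only: sum_distrib_left)
      also have "\<dots> = (\<Sum>a'<d. \<Sum>c'<d. \<sigma> / (of_nat d * of_nat d) * ((R $$ (a', a))\<^sup>2 * (R $$ (c', c))\<^sup>2))"
      proof (intro sum.cong refl)
        fix a' c' assume "a' \<in> {..<d}" "c' \<in> {..<d}"
        then have a': "a' < d" "c' < d" by auto
        have "bit_sign q a / of_nat d * (bit_sign q a' / of_nat d * g (idx a' c') (idx a c))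
          = (bit_sign q a * bit_sign q a' * (R $$ (a', a))\<^sup>2) * (R $$ (c', c))\<^sup>2 / (of_nat d * of_nat d)"
          by (simp add: g_idx[OF a a'])
        then show "bit_sign q a / of_nat d * (bit_sign q a' / of_nat d * g (idx a' c') (idx a c))
          = \<sigma> / (of_nat d * of_nat d) * ((R $$ (a', a))\<^sup>2 * (R $$ (c', c))\<^sup>2)"
          unfolding comm[OF a(1) a'(1)] by (simp add: mult.assoc)
      qed
      finally show "bit_sign q a / of_nat d * (\<Sum>a'<d. \<Sum>c'<d. bit_sign q a' / of_nat d * g (idx a' c') (idx a c))
        = (\<Sum>a'<d. \<Sum>c'<d. \<sigma> / (of_nat d * of_nat d) * ((R $$ (a', a))\<^sup>2 * (R $$ (c', c))\<^sup>2))" .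
    qed
    also have "\<dots> = \<sigma> / (of_nat d * of_nat d) * (\<Sum>a<d. \<Sum>c<d. \<Sum>a'<d. \<Sum>c'<d. (R $$ (a', a))\<^sup>2 * (R $$ (c', c))\<^sup>2)"
      by (simp only: sum_distrib_left)
    also have "(\<Sum>a<d. \<Sum>c<d. \<Sum>a'<d. \<Sum>c'<d. (R $$ (a', a))\<^sup>2 * (R $$ (c', c))\<^sup>2) = Sq * Sq"
      unfolding Sq_def sum_product ..
    also have "\<sigma> / (of_nat d * of_nat d) * (Sq * Sq) = \<sigma>"
      unfolding Sq using d by simp
    finally show ?thesis by (simp add: \<sigma>_def R_def)
  qed
  show ?thesis using X tn val unfolding d_def by blast
qed

section \<open>Twirls\<close>

lemma twirl_carrier [simp]: "twirl d k M u A \<in> carrier_mat (d ^ k) (d ^ k)"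
  by (simp add: twirl_def)

lemma twirl_index:
  "i < d ^ k \<Longrightarrow> j < d ^ k \<Longrightarrow> twirl d k M u A $$ (i, j) =
     (LINT w|M. (tensor_pow d k (u w) * A * tensor_pow d k (mat_adjoint (u w))) $$ (i, j))"
  by (simp add: twirl_def)

text \<open>For infinite \<open>A\<close> both sides are 0: by the conventions on
  \<open>card\<close> and division the density is 0, and so is the factor on the right.\<close>

lemma integral_uniform_count_measure_complex:
  fixes f :: "'b \<Rightarrow> complex"
  shows "integral\<^sup>L (uniform_count_measure A) f = (1 / real (card A)) *\<^sub>R (\<Sum>a\<in>A. f a)"
proof (cases "finite A")
  case True
  then show ?thesis
    by (simp add: uniform_count_measure_def lebesgue_integral_point_measure_finite scaleR_sum_right)
next
  case False
  have "AE x in uniform_count_measure A. f x = 0"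
    using False unfolding uniform_count_measure_def point_measure_def by (subst AE_density) auto
  then show ?thesis using False by (simp add: integral_eq_zero_AE)
qed

text \<open>The entry is a polynomial in the entries of \<open>u w\<close> and their conjugates.
  These are measurable and, as \<open>u w\<close> is unitary, bounded by 1.\<close>

lemma integrable_twirl_entry:
  assumes M: "prob_space M"
    and u: "\<And>w. w \<in> space M \<Longrightarrow> unitary_mat d (u w)"
    and meas: "\<And>i j. i < d \<Longrightarrow> j < d \<Longrightarrow> (\<lambda>w. u w $$ (i, j)) \<in> borel_measurable M"
    and A: "A \<in> carrier_mat (d ^ k) (d ^ k)" and i: "i < d ^ k" and d: "d > 0"
  shows "integrable M (\<lambda>w. (tensor_pow d k (u w) * A * tensor_pow d k (mat_adjoint (u w))) $$ (i, i))"
proof -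
  interpret prob_space M by fact
  have dig: "digit d t x < d" for t x using d by (rule digit_less)
  have eq: "(tensor_pow d k (u w) * A * tensor_pow d k (mat_adjoint (u w))) $$ (i, i)
     = (\<Sum>m<d ^ k. \<Sum>l<d ^ k. (\<Prod>t<k. u w $$ (digit d t i, digit d t l)) * A $$ (l, m) *
          (\<Prod>t<k. cnj (u w $$ (digit d t i, digit d t m))))" if "w \<in> space M" for w
    unfolding tensor_pow_conj_index[OF A i i]
    using i by (intro sum.cong refl)
      (simp add: tensor_pow_index mat_adjoint_index[OF unitary_matD(1)[OF u[OF that]] dig dig])
  have "integrable M (\<lambda>w. \<Sum>m<d ^ k. \<Sum>l<d ^ k. (\<Prod>t<k. u w $$ (digit d t i, digit d t l)) * A $$ (l, m) *
          (\<Prod>t<k. cnj (u w $$ (digit d t i, digit d t m))))"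
  proof (intro Bochner_Integration.integrable_sum)
    fix m l
    let ?h = "\<lambda>w. (\<Prod>t<k. u w $$ (digit d t i, digit d t l)) * A $$ (l, m) *
          (\<Prod>t<k. cnj (u w $$ (digit d t i, digit d t m)))"
    have cm: "(\<lambda>w. cnj (u w $$ (digit d t i, digit d t m))) \<in> borel_measurable M" for t
      using meas[OF dig dig]
      by (intro borel_measurable_continuous_onI[of cnj, THEN measurable_compose[rotated]])
         (auto intro: continuous_intros)
    have "?h \<in> borel_measurable M"
      by (intro borel_measurable_times borel_measurable_prod borel_measurable_const meas dig cm)
    moreover have "norm (?h w) \<le> cmod (A $$ (l, m))" if "w \<in> space M" for w
    proof -
      have 1: "(\<Prod>t<k. cmod (u w $$ (digit d t i, digit d t x))) \<le> 1" for x
        using unitary_entry_le_1[OF u[OF that] dig dig] by (intro prod_le_1) auto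
      have "norm (?h w) = ((\<Prod>t<k. cmod (u w $$ (digit d t i, digit d t l))) *
          (\<Prod>t<k. cmod (u w $$ (digit d t i, digit d t m)))) * cmod (A $$ (l, m))"
        by (simp add: norm_mult prod_norm[symmetric])
      also have "\<dots> \<le> 1 * cmod (A $$ (l, m))"
        by (intro mult_right_mono mult_le_one 1 prod_nonneg) auto
      finally show ?thesis by simp
    qed
    ultimately show "integrable M ?h"
      by (intro integrable_const_bound[of _ "cmod (A $$ (l, m))"] AE_I2) auto
  qed
  then show ?thesis using eq by (subst Bochner_Integration.integrable_cong[OF refl]) auto
qed

text \<open>Take the one-dimensional ancilla, for which the extended map is \<Delta> itself.\<close>

lemma trace_norm_le_diamond_norm:
  assumes X: "X \<in> carrier_mat D D" "trace_norm X \<le> 1" and \<Delta>: "\<Delta> X \<in> carrier_mat D D"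
  shows "ereal (trace_norm (\<Delta> X)) \<le> diamond_norm D \<Delta>"
proof -
  have "Matrix.mat D D (\<lambda>(i', j'). X $$ (i' * 1 + i mod 1, j' * 1 + j mod 1)) = X" for i j :: nat
    using X(1) by (intro eq_matI) auto
  then have "ancilla_ext D 1 \<Delta> X = \<Delta> X"
    using \<Delta> unfolding ancilla_ext_def by (intro eq_matI) auto
  then show ?thesis
    unfolding diamond_norm_def using X
    by (intro SUP_upper2[of 1] SUP_upper2[of X]) auto
qed

section \<open>Lower bounds for Clifford designs\<close>

text \<open>If every lightcone had fewer than n / 4 qubits, fewer than a quarter of the n signs
  could be -1, and their mean would be at least 1 - 2 / 4 = 1 / 2 on the ensemble, against at most 0
  on the Clifford group. The test would then separate the twirls by at least 1 / 2, more than
  \<epsilon>.\<close>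

lemma design_has_large_lightcone:
  assumes k: "k \<ge> 4" and q: "q < n" and E: "circuit_ensemble n r G E" and \<epsilon>: "\<epsilon> < 1 / 4"
    and design: "approx_clifford_design n k \<epsilon> E (circuit_unitary n)"
  shows "\<exists>C\<in>space E. real (card (lightcone q C)) \<ge> 1 / 4 * real n"
proof (rule ccontr)
  assume "\<not> ?thesis"
  then have small: "real (card (lightcone q C)) < real n / 4" if "C \<in> space E" for C
    using that by force
  define d where "d = (2 ^ n :: nat)"
  have d: "d > 0" by (simp add: d_def)
  let ?U = "circuit_unitary n"
  interpret E: prob_space E using E by (simp add: circuit_ensemble_def)
  have valid: "valid_circuit n r G C" if "C \<in> space E" for C
    using E that by (simp add: circuit_ensemble_def)
  have meas: "(\<lambda>C. ?U C $$ (i, j)) \<in> borel_measurable E" if "i < d" "j < d" for i j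
    using E that by (simp add: circuit_ensemble_def d_def)
  have cliff: "?U C \<in> clifford_group n" if "C \<in> space E" for C
    using design that by (simp add: approx_clifford_design_def)
  obtain X where X: "X \<in> carrier_mat (d ^ k) (d ^ k)" "trace_norm X \<le> 1"
    and val: "\<And>U j. U \<in> clifford_group n \<Longrightarrow> j < n \<Longrightarrow>
      (\<Sum>i<d ^ k. test_sign n j i * (tensor_pow d k U * X * tensor_pow d k (mat_adjoint U)) $$ (i, i))
      = complex_of_real (com (mat_adjoint U * site_Z n j * U) (site_Z n q))"
    using exists_test_state[OF q k] unfolding d_def by blast
  \<comment> \<open>The diagonal of the averaged observable; its entries are means of numbers of
    modulus 1. The value it takes for a Clifford unitary U is the mean sign \<open>F U\<close>
    defined below.\<close>
  define y where "y i = (\<Sum>j<n. test_sign n j i) / of_nat n" for i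
  have n: "real n > 0" using q by simp
  have y1: "cmod (y i) \<le> 1" for i
  proof -
    have "cmod (\<Sum>j<n. test_sign n j i) \<le> (\<Sum>j<n. 1)"
      by (rule sum_norm_le) (simp add: norm_test_sign)
    then show ?thesis using n by (simp add: y_def norm_divide)
  qed
  define F where "F U = (\<Sum>j<n. com (mat_adjoint U * site_Z n j * U) (site_Z n q)) / real n" for U
  have F: "(\<Sum>i<d ^ k. y i * (tensor_pow d k U * X * tensor_pow d k (mat_adjoint U)) $$ (i, i)) = complex_of_real (F U)"
    if "U \<in> clifford_group n" for U
  proof -
    have "(\<Sum>i<d ^ k. y i * (tensor_pow d k U * X * tensor_pow d k (mat_adjoint U)) $$ (i, i))
      = (\<Sum>i<d ^ k. \<Sum>j<n. test_sign n j i * (tensor_pow d k U * X * tensor_pow d k (mat_adjoint U)) $$ (i, i)) / of_nat n"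
      by (simp add: y_def sum_distrib_right sum_divide_distrib)
    also have "\<dots> = (\<Sum>j<n. \<Sum>i<d ^ k. test_sign n j i * (tensor_pow d k U * X * tensor_pow d k (mat_adjoint U)) $$ (i, i)) / of_nat n"
      by (subst sum.swap) (rule refl)
    also have "\<dots> = complex_of_real (F U)" using val[OF that] by (simp add: F_def)
    finally show ?thesis .
  qed
  let ?T = "clifford_twirl n k X" and ?T' = "twirl d k E ?U X"
  have Tc: "?T \<in> carrier_mat (d ^ k) (d ^ k)" by (simp add: clifford_twirl_def d_def)
  have "Re (\<Sum>i<d ^ k. y i * ?T $$ (i, i)) \<le> 0"
  proof -
    let ?Q = "clifford_group n // phase_rel n" and ?rep = "\<lambda>K :: complex mat set. SOME U. U \<in> K"
    have "(\<Sum>i<d ^ k. y i * ?T $$ (i, i)) = (\<Sum>i<d ^ k. y i * ((1 / real (card ?Q)) *\<^sub>R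
        (\<Sum>K\<in>?Q. (tensor_pow d k (?rep K) * X * tensor_pow d k (mat_adjoint (?rep K))) $$ (i, i))))"
      unfolding clifford_twirl_def d_def
      by (intro sum.cong refl) (simp add: twirl_index integral_uniform_count_measure_complex)
    also have "\<dots> = (1 / real (card ?Q)) *\<^sub>R (\<Sum>i<d ^ k. \<Sum>K\<in>?Q.
        y i * (tensor_pow d k (?rep K) * X * tensor_pow d k (mat_adjoint (?rep K))) $$ (i, i))"
      by (simp add: scaleR_sum_right sum_distrib_left)
    also have "\<dots> = (1 / real (card ?Q)) *\<^sub>R (\<Sum>K\<in>?Q. \<Sum>i<d ^ k.
        y i * (tensor_pow d k (?rep K) * X * tensor_pow d k (mat_adjoint (?rep K))) $$ (i, i))"
      by (subst sum.swap) (rule refl)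
    also have "\<dots> = (1 / real (card ?Q)) *\<^sub>R (\<Sum>K\<in>?Q. complex_of_real (F (?rep K)))"
      using F[OF clifford_rep(2)] by simp
    finally have "Re (\<Sum>i<d ^ k. y i * ?T $$ (i, i)) = 1 / real (card ?Q) * (\<Sum>K\<in>?Q. F (?rep K))"
      by simp
    also have "(\<Sum>K\<in>?Q. F (?rep K)) \<le> 0"
    proof -
      have "(\<Sum>K\<in>?Q. F (?rep K)) = (\<Sum>j<n. \<Sum>K\<in>?Q.
          com (mat_adjoint (?rep K) * site_Z n j * ?rep K) (site_Z n q)) / real n"
        unfolding F_def sum_divide_distrib[symmetric] by (subst sum.swap) (rule refl)
      also have "\<dots> \<le> 0"
        by (rule divide_nonpos_nonneg, rule sum_nonpos, rule clifford_sum_com_nonpos[OF q]) auto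
      finally show ?thesis .
    qed
    then have "1 / real (card ?Q) * (\<Sum>K\<in>?Q. F (?rep K)) \<le> 0"
      by (intro mult_nonneg_nonpos) auto
    finally show ?thesis .
  qed
  moreover have "Re (\<Sum>i<d ^ k. y i * ?T' $$ (i, i)) \<ge> 1 / 2"
  proof -
    let ?h = "\<lambda>i C. (tensor_pow d k (?U C) * X * tensor_pow d k (mat_adjoint (?U C))) $$ (i, i)"
    have int: "integrable E (?h i)" if "i < d ^ k" for i
      by (rule integrable_twirl_entry[OF E.prob_space_axioms _ meas X(1) that d])
         (use clifford_groupD(1)[OF cliff] in \<open>simp_all add: d_def\<close>)
    have "(\<Sum>i<d ^ k. y i * ?T' $$ (i, i)) = (\<Sum>i<d ^ k. LINT C|E. y i * ?h i C)"
      by (intro sum.cong refl) (simp add: twirl_index)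
    also have "\<dots> = (LINT C|E. (\<Sum>i<d ^ k. y i * ?h i C))"
      using int by (intro Bochner_Integration.integral_sum[symmetric]) simp
    also have "\<dots> = (LINT C|E. complex_of_real (F (?U C)))"
      using F[OF cliff] by (intro Bochner_Integration.integral_cong refl) simp
    finally have eq: "Re (\<Sum>i<d ^ k. y i * ?T' $$ (i, i)) = (LINT C|E. F (?U C))" by simp
    have "integrable E (\<lambda>C. \<Sum>i<d ^ k. y i * ?h i C)"
      by (intro Bochner_Integration.integrable_sum integrable_mult_right) (use int in auto)
    then have "integrable E (\<lambda>C. complex_of_real (F (?U C)))"
      using F[OF cliff] by (subst (asm) Bochner_Integration.integrable_cong[OF refl]) auto
    then have intF: "integrable E (\<lambda>C. F (?U C))" by (simp only: complex_of_real_integrable_eq)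
    \<comment> \<open>In the worst case all signs inside the lightcone are -1, which leaves n - 2
      |L| > n / 2.\<close>
    have "F (?U C) \<ge> 1 / 2" if C: "C \<in> space E" for C
    proof -
      let ?L = "lightcone q C"
      have L: "?L \<subseteq> {..<n}" by (rule lightcone_subset[OF valid[OF C] q])
      have "(\<Sum>j<n. com (mat_adjoint (?U C) * site_Z n j * ?U C) (site_Z n q)) \<ge> (\<Sum>j<n. if j \<in> ?L then - 1 else 1)"
      proof (rule sum_mono)
        fix j assume "j \<in> {..<n}"
        then show "(if j \<in> ?L then - 1 else 1) \<le> com (mat_adjoint (?U C) * site_Z n j * ?U C) (site_Z n q)"
          using com_outside_lightcone[OF valid[OF C] q, of j]
            com_cases[of "mat_adjoint (?U C) * site_Z n j * ?U C" "site_Z n q"] by auto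
      qed
      moreover have "(\<Sum>j<n. if j \<in> ?L then - 1 else 1) = real n - 2 * real (card ?L)"
      proof -
        have "(\<Sum>j<n. if j \<in> ?L then - 1 else 1) = (\<Sum>j<n. 1 - (if j \<in> ?L then 2 else 0 :: real))"
          by (intro sum.cong refl) auto
        also have "\<dots> = real n - (\<Sum>j\<in>{..<n} \<inter> ?L. 2)"
          unfolding sum_subtractf sum.inter_restrict[OF finite_lessThan] by simp
        also have "{..<n} \<inter> ?L = ?L" using L by blast
        finally show ?thesis by simp
      qed
      ultimately show ?thesis using small[OF C] n by (simp add: F_def field_simps)
    qed
    then have "(LINT C|E. F (?U C)) \<ge> 1 / 2"
      using intF by (intro E.integral_ge_const AE_I2) auto
    then show ?thesis using eq by simp
  qed
  moreover have "(\<Sum>i<d ^ k. y i * (?T - ?T') $$ (i, i)) = (\<Sum>i<d ^ k. y i * ?T $$ (i, i)) - (\<Sum>i<d ^ k. y i * ?T' $$ (i, i))"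
    using Tc by (simp add: right_diff_distrib sum_subtractf carrier_matD[OF twirl_carrier])
  ultimately have "cmod (\<Sum>i<d ^ k. y i * (?T - ?T') $$ (i, i)) \<ge> 1 / 2"
    using abs_Re_le_cmod[of "\<Sum>i<d ^ k. y i * (?T - ?T') $$ (i, i)"] by simp
  also have "cmod (\<Sum>i<d ^ k. y i * (?T - ?T') $$ (i, i)) \<le> trace_norm (?T - ?T')"
    by (rule trace_norm_ge_diag[OF minus_carrier_mat[OF twirl_carrier] y1])
  finally have half: "1 / 2 \<le> trace_norm (?T - ?T')" .
  have "ereal (trace_norm (?T - ?T')) \<le> diamond_norm (d ^ k) (\<lambda>A. clifford_twirl n k A - twirl d k E ?U A)"
    by (rule trace_norm_le_diamond_norm[OF X, of "\<lambda>A. clifford_twirl n k A - twirl d k E ?U A"])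
       (rule minus_carrier_mat[OF twirl_carrier])
  also have "\<dots> \<le> ereal \<epsilon>"
    using design unfolding approx_clifford_design_def d_def by (rule conjunct2)
  finally have "trace_norm (?T - ?T') \<le> \<epsilon>" by (simp only: ereal_less_eq(3))
  with half have "1 / 2 \<le> \<epsilon>" by (rule order_trans)
  then show False using \<epsilon> by simp
qed

section \<open>From the size of lightcones to circuit depth\<close>

lemma depth_le_ensemble_depth: "C \<in> space E \<Longrightarrow> ereal (real (depth C)) \<le> ensemble_depth E"
  unfolding ensemble_depth_def by (rule SUP_upper)

text \<open>The growth bound gives n / 4 \<le> 2 r^2 depth + 1. For n \<ge> 8 the summand 1 is at
  most n / 8, which leads to the constant 16; using r^2 + 1 keeps the denominator positive when r =
  0.\<close>

lemma design_depth_one_dimensional: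
  assumes k: "k \<ge> 4" and G: "one_dimensional n G" and E: "circuit_ensemble n r G E" and \<epsilon>: "\<epsilon> < 1 / 4"
    and design: "approx_clifford_design n k \<epsilon> E (circuit_unitary n)" and n: "n \<ge> 8"
  shows "ensemble_depth E \<ge> ereal (1 / (16 * (real r * real r + 1)) * real n)"
proof -
  obtain p where p: "p permutes {..<n}" "G \<subseteq> map_prod p p ` cycle_graph n"
    using one_dimensional_cycle_graph[OF G] by blast
  have q: "0 < n" using n by simp
  obtain C where C: "C \<in> space E" and large: "real (card (lightcone 0 C)) \<ge> 1 / 4 * real n"
    using design_has_large_lightcone[OF k q E \<epsilon> design] by blast
  have "valid_circuit n r G C" using E C by (simp add: circuit_ensemble_def)
  from card_lightcone_one_dimensional[OF this q p]
  have "real (card (lightcone 0 C)) \<le> real (2 * (r * r) * depth C + 1)" by (rule of_nat_mono)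
  then have "1 / 4 * real n \<le> 2 * (real r * real r) * real (depth C) + 1" using large by simp
  moreover have "2 * (real r * real r) * real (depth C) \<le> 2 * (real r * real r + 1) * real (depth C)"
    by (intro mult_right_mono) auto
  ultimately have "real n \<le> real (depth C) * (16 * (real r * real r + 1))" using n by (simp add: algebra_simps)
  moreover have pos: "0 < 16 * (real r * real r + 1)" by (simp add: add_nonneg_pos)
  ultimately have "1 / (16 * (real r * real r + 1)) * real n \<le> real (depth C)"
    using pos_divide_le_eq[OF pos, of "real n" "real (depth C)"] by simp
  then show ?thesis using depth_le_ensemble_depth[OF C] by (meson ereal_less_eq(3) order_trans)
qed

text \<open>For n \<ge> 16 one has n / 4 \<ge> sqrt n, which costs the factor 2. The base is r + 2
  rather than r + 1 so that its logarithm is positive even when r = 0.\<close>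

lemma design_depth_all_to_all:
  assumes k: "k \<ge> 4" and E: "circuit_ensemble n r G E" and \<epsilon>: "\<epsilon> < 1 / 4"
    and design: "approx_clifford_design n k \<epsilon> E (circuit_unitary n)" and n: "n \<ge> 16"
  shows "ensemble_depth E \<ge> ereal (1 / (2 * ln (real r + 2)) * ln (real n))"
proof -
  have q: "0 < n" using n by simp
  obtain C where C: "C \<in> space E" and large: "real (card (lightcone 0 C)) \<ge> 1 / 4 * real n"
    using design_has_large_lightcone[OF k q E \<epsilon> design] by blast
  have "valid_circuit n r G C" using E C by (simp add: circuit_ensemble_def)
  from card_lightcone_le_power[OF this q]
  have "real (card (lightcone 0 C)) \<le> real ((r + 1) ^ depth C)" by (rule of_nat_mono)
  also have "\<dots> \<le> (real r + 2) ^ depth C" by (simp add: power_mono)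
  finally have le: "real n / 4 \<le> (real r + 2) ^ depth C" using large by simp
  have "ln (real n) / 2 \<le> ln (real n / 4)"
  proof -
    have "2 * ln 4 = ln (4\<^sup>2 :: real)" by (subst ln_realpow) auto
    also have "\<dots> \<le> ln (real n)" using n by (subst ln_le_cancel_iff) auto
    finally show ?thesis using q by (simp add: ln_div)
  qed
  also have "\<dots> \<le> ln ((real r + 2) ^ depth C)" using le q by (subst ln_le_cancel_iff) auto
  also have "\<dots> = real (depth C) * ln (real r + 2)" by (simp add: ln_realpow)
  finally have le': "ln (real n) \<le> real (depth C) * (2 * ln (real r + 2))" by simp
  have pos: "0 < 2 * ln (real r + 2)" by simp
  have "1 / (2 * ln (real r + 2)) * ln (real n) \<le> real (depth C)"
    using le' pos_divide_le_eq[OF pos, of "ln (real n)" "real (depth C)"] by simp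
  then show ?thesis using depth_le_ensemble_depth[OF C] by (meson ereal_less_eq(3) order_trans)
qed

theorem theoremS12:
  shows "(\<exists>c::real. c > 0 \<and>
      (\<forall>(n::nat) (k::nat) (r::nat) G q E (\<epsilon>::real).
         k \<ge> 4 \<longrightarrow> q < n \<longrightarrow> architecture n G \<longrightarrow> circuit_ensemble n r G E \<longrightarrow>
         \<epsilon> < 1 / 4 \<longrightarrow> approx_clifford_design n k \<epsilon> E (circuit_unitary n) \<longrightarrow>
         (\<exists>C\<in>space E. real (card (lightcone q C)) \<ge> c * real n)))
    \<and> (\<forall>r::nat. \<exists>c::real. c > 0 \<and> (\<exists>N. \<forall>n\<ge>N. \<forall>(k::nat) G E (\<epsilon>::real).
         k \<ge> 4 \<longrightarrow> one_dimensional n G \<longrightarrow> circuit_ensemble n r G E \<longrightarrow>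
         \<epsilon> < 1 / 4 \<longrightarrow> approx_clifford_design n k \<epsilon> E (circuit_unitary n) \<longrightarrow>
         ensemble_depth E \<ge> ereal (c * real n)))
    \<and> (\<forall>r::nat. \<exists>c::real. c > 0 \<and> (\<exists>N. \<forall>n\<ge>N. \<forall>(k::nat) E (\<epsilon>::real).
         k \<ge> 4 \<longrightarrow> circuit_ensemble n r (complete_graph n) E \<longrightarrow>
         \<epsilon> < 1 / 4 \<longrightarrow> approx_clifford_design n k \<epsilon> E (circuit_unitary n) \<longrightarrow>
         ensemble_depth E \<ge> ereal (c * ln (real n))))"
proof (intro conjI allI)
  show "\<exists>c::real. c > 0 \<and>
      (\<forall>(n::nat) (k::nat) (r::nat) G q E (\<epsilon>::real).
         k \<ge> 4 \<longrightarrow> q < n \<longrightarrow> architecture n G \<longrightarrow> circuit_ensemble n r G E \<longrightarrow>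
         \<epsilon> < 1 / 4 \<longrightarrow> approx_clifford_design n k \<epsilon> E (circuit_unitary n) \<longrightarrow>
         (\<exists>C\<in>space E. real (card (lightcone q C)) \<ge> c * real n))"
    by (intro exI[of _ "1 / 4"] conjI allI impI, simp) (rule design_has_large_lightcone)
next
  fix r :: nat
  have "0 < 1 / (16 * (real r * real r + 1))" by (simp add: add_nonneg_pos)
  then show "\<exists>c::real. c > 0 \<and> (\<exists>N. \<forall>n\<ge>N. \<forall>(k::nat) G E (\<epsilon>::real).
         k \<ge> 4 \<longrightarrow> one_dimensional n G \<longrightarrow> circuit_ensemble n r G E \<longrightarrow>
         \<epsilon> < 1 / 4 \<longrightarrow> approx_clifford_design n k \<epsilon> E (circuit_unitary n) \<longrightarrow>
         ensemble_depth E \<ge> ereal (c * real n))"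
    by (intro exI[of _ "1 / (16 * (real r * real r + 1))"] exI[of _ 8] conjI allI impI, assumption)
       (rule design_depth_one_dimensional)
next
  fix r :: nat
  have "0 < 1 / (2 * ln (real r + 2))" by simp
  then show "\<exists>c::real. c > 0 \<and> (\<exists>N. \<forall>n\<ge>N. \<forall>(k::nat) E (\<epsilon>::real).
         k \<ge> 4 \<longrightarrow> circuit_ensemble n r (complete_graph n) E \<longrightarrow>
         \<epsilon> < 1 / 4 \<longrightarrow> approx_clifford_design n k \<epsilon> E (circuit_unitary n) \<longrightarrow>
         ensemble_depth E \<ge> ereal (c * ln (real n)))"
    by (intro exI[of _ "1 / (2 * ln (real r + 2))"] exI[of _ 16] conjI allI impI, assumption)
       (rule design_depth_all_to_all)
qed

end
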